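(* Let $U,V\subset\mathbb R^3$ be domains, $(s,t)\subset\mathbb R$ an open interval, $\underline a=\sum_{i=1}^3a_ie_i\in C^1(U,V)$ a diffeomorphism with real-valued components, and $a:(s,t)\times U\to(s,t)\times V$, $a(x)=x_0+\underline a(\underline x)$. Let $\Omega\subset(s,t)\times U$ be a domain such that $\overline{a(\Omega)}\subset(s,t)\times V$, $\partial\Omega$ and $\partial(a(\Omega))$ are 3-dimensional compact smooth surfaces, and $\overline{a(\Omega)}\subset\mathbb H\setminus\mathbb R$. If $f,g\in C^1(\overline\Omega,\mathbb H)$ satisfy $\mathcal H_a(f)=0$ and $\mathcal H_{a,r}(g)=0$ on $\Omega$, then $$\int_{\partial\Omega}g\,J_a\nu_{a(x)}\,f=4\int_\Omega g\,\frac{\underline a(\underline x)}{\|\underline a(\underline x)\|^2}\,f\,M_a\,dx.$$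
   Context: $\mathbb H$ is the skew-field of quaternions with imaginary units $e_1,e_2,e_3$; $x=x_0+\underline x$, $\underline x=\sum_{k=1}^3x_ke_k$, $\|\cdot\|$ the Euclidean norm; $\mathbb R\times\mathbb R^3=\mathbb H$. "Diffeomorphism" means a $C^1$ bijection with $C^1$ inverse; $(a^{-1})_j$ is the $j$-th real component of $(\underline a)^{-1}$. With $u_i:=\sum_{j=1}^3a_j\big(\frac{\partial(a^{-1})_i}{\partial y_j}\circ a\big)$, $$\mathcal H_a(f)=\underline a\frac{\partial f}{\partial x_0}-\sum_{i=1}^3u_i\frac{\partial f}{\partial x_i},\qquad \mathcal H_{a,r}(f)=\frac{\partial f}{\partial x_0}\underline a-\sum_{i=1}^3u_i\frac{\partial f}{\partial x_i}.$$ For $x\in\mathbb H\setminus\mathbb R$, $\nu_x=2\,d\hat x_0+2\frac{\underline x}{\|\underline x\|^2}\sum_{k=1}^3x_k\,d\hat x_k$, where $d\hat x_k$ is the 3-form with $dx_k\wedge d\hat x_k=dx_0\wedge dx_1\wedge dx_2\wedge dx_3$; on a boundary surface with outward unit normal $(n_0,\dots,n_3)$ and surface measure $dS$ it restricts to $n_k\,dS$. $M_a=|\det Da|$, with $Da$ the Jacobian matrix of $a$, and $J_a\nu_{a(x)}$ is $\nu$ transported to $\partial\Omega$ by the change of variables $a$: for continuous $\varphi,\psi$ on $\partial\Omega$, $\int_{\partial\Omega}\varphi\,J_a\nu_{a(x)}\,\psi=\int_{\partial a(\Omega)}(\varphi\circ a^{-1})\,\nu\,(\psi\circ a^{-1})$.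 $C^1(\overline\Omega,\mathbb H)$ denotes functions continuously differentiable up to the boundary. *)

theory Defs
  imports "HOL-Analysis.Analysis"
begin

unbundle no cross3_syntax
unbundle set_product_syntax

section \<open>Quaternions\<close>

text \<open>
  A quaternion is the pair of its real part and its vector part. The norm of the product
  space \<open>real \<times> real^3\<close> is the Euclidean one and \<open>lborel\<close> is four-dimensional Lebesgue measure.
  The indices 0, 1, 2, 3 of the coordinates are encoded by \<open>None\<close>, \<open>Some 1\<close>, \<open>Some 2\<close>, \<open>Some 3\<close>.
\<close>

type_synonym quat = "real \<times> (real^3)"

definition qmult :: "quat \<Rightarrow> quat \<Rightarrow> quat"  (infixl \<open>*\<^sub>H\<close> 70)
  where "p *\<^sub>H q =
    (fst p * fst q - snd p \<bullet> snd q,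
     fst p *\<^sub>R snd q + fst q *\<^sub>R snd p + cross3 (snd p) (snd q))"

definition qvec :: "real^3 \<Rightarrow> quat"
  where "qvec v = (0, v)"

fun qunit :: "3 option \<Rightarrow> quat"
  where
    "qunit None = (1, 0)"
  | "qunit (Some k) = qvec (axis k 1)"

text \<open>Sanity check of the sign conventions: the Hamilton relations.\<close>

lemma qunit_mult:
  "qunit None *\<^sub>H q = q" "q *\<^sub>H qunit None = q"
  "qunit (Some k) *\<^sub>H qunit (Some k) = - qunit None"
  "qunit (Some 1) *\<^sub>H qunit (Some 2) = qunit (Some 3)"
  "qunit (Some 2) *\<^sub>H qunit (Some 3) = qunit (Some 1)"
  "qunit (Some 3) *\<^sub>H qunit (Some 1) = qunit (Some 2)"
  by (simp_all add: qmult_def qvec_def prod_eq_iff inner_axis_axis)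
    (simp_all add: cross3_def vec_eq_iff forall_3 axis_def)

lemma qmult_assoc: "(p *\<^sub>H q) *\<^sub>H r = p *\<^sub>H (q *\<^sub>H r)"
  by (simp add: qmult_def prod_eq_iff cross3_def vec_eq_iff forall_3 inner_vec_def sum_3
      algebra_simps)


section \<open>Differentiability\<close>

definition partial_derivative ::
    "'a::real_normed_vector \<Rightarrow> ('a \<Rightarrow> 'b::real_normed_vector) \<Rightarrow> 'a \<Rightarrow> 'b"
  where "partial_derivative v f x = vector_derivative (\<lambda>t. f (x + t *\<^sub>R v)) (at 0)"

definition C1_on :: "'a::real_normed_vector set \<Rightarrow> ('a \<Rightarrow> 'b::real_normed_vector) \<Rightarrow> bool"
  where "C1_on S f \<longleftrightarrow>
    (\<exists>D :: 'a \<Rightarrow> 'a \<Rightarrow>\<^sub>L 'b.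
      (\<forall>x\<in>S. (f has_derivative blinfun_apply (D x)) (at x)) \<and> continuous_on S D)"

text \<open>
  Continuously differentiable up to the boundary: the function and its derivative on the open
  set \<open>\<Omega>\<close> both extend continuously to the closure.
\<close>

definition C1_closure :: "'a::real_normed_vector set \<Rightarrow> ('a \<Rightarrow> 'b::real_normed_vector) \<Rightarrow> bool"
  where "C1_closure \<Omega> f \<longleftrightarrow>
    continuous_on (closure \<Omega>) f \<and>
    (\<exists>D :: 'a \<Rightarrow> 'a \<Rightarrow>\<^sub>L 'b.
      (\<forall>x\<in>\<Omega>. (f has_derivative blinfun_apply (D x)) (at x)) \<and> continuous_on (closure \<Omega>) D)"

definition C1_diffeomorphism ::
    "'a::real_normed_vector set \<Rightarrow> 'b::real_normed_vector set \<Rightarrow> ('a \<Rightarrow> 'b) \<Rightarrow> bool"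
  where "C1_diffeomorphism U V a \<longleftrightarrow>
    bij_betw a U V \<and> C1_on U a \<and> C1_on V (inv_into U a)"


section \<open>Hypersurfaces in the space of quaternions\<close>

definition local_parametrization :: "quat set \<Rightarrow> (real^3) set \<Rightarrow> (real^3 \<Rightarrow> quat) \<Rightarrow> bool"
  where "local_parametrization S D X \<longleftrightarrow>
    open D \<and> C1_on D X \<and> (\<forall>u\<in>D. inj (frechet_derivative X (at u))) \<and>
    openin (top_of_set S) (X ` D) \<and> (\<exists>Y. homeomorphism D (X ` D) X Y)"

text \<open>
  An embedded three-dimensional surface without boundary. Smoothness is only required to be of
  class \<open>C\<^sup>1\<close>, so surfaces of every higher class are included.
\<close>

definition smooth_surface :: "quat set \<Rightarrow> bool"
  where "smooth_surface S \<longleftrightarrow> (\<forall>p\<in>S. \<exists>D X. local_parametrization S D X \<and> p \<in> X ` D)"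

definition area_element :: "(real^3 \<Rightarrow> quat) \<Rightarrow> real^3 \<Rightarrow> real"
  where "area_element X u =
    sqrt (det (\<chi> i j. frechet_derivative X (at u) (axis i 1) \<bullet>
                      frechet_derivative X (at u) (axis j 1)))"

text \<open>
  The surface measure is the Borel measure on \<open>S\<close> that is given in every local parametrization by
  the area element. It exists and is unique whenever \<open>S\<close> is a smooth surface.
\<close>

definition surface_measure :: "quat set \<Rightarrow> quat measure"
  where "surface_measure S = (THE M.
    sets M = sets (restrict_space borel S) \<and>
    (\<forall>D X A. local_parametrization S D X \<longrightarrow> A \<in> sets borel \<longrightarrow> A \<subseteq> D \<longrightarrow>
      emeasure M (X ` A) = (\<integral>\<^sup>+u\<in>A. ennreal (area_element X u) \<partial>lborel)))"

definition outward_unit_normal :: "quat set \<Rightarrow> quat \<Rightarrow> quat"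
  where "outward_unit_normal G p = (THE n.
    norm n = 1 \<and>
    (\<forall>D X u v. local_parametrization (frontier G) D X \<longrightarrow> u \<in> D \<longrightarrow> X u = p \<longrightarrow>
      n \<bullet> frechet_derivative X (at u) v = 0) \<and>
    (\<forall>\<^sub>F t in at_right 0. p + t *\<^sub>R n \<notin> closure G))"


section \<open>The operators and forms induced by a diffeomorphism\<close>

definition lift :: "(real^3 \<Rightarrow> real^3) \<Rightarrow> quat \<Rightarrow> quat"
  where "lift a x = (fst x, a (snd x))"

definition u_coeff :: "(real^3) set \<Rightarrow> (real^3 \<Rightarrow> real^3) \<Rightarrow> 3 \<Rightarrow> real^3 \<Rightarrow> real"
  where "u_coeff U a i v =
    (\<Sum>j\<in>UNIV. a v $ j * partial_derivative (axis j 1) (\<lambda>y. inv_into U a y $ i) (a v))"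

definition H_left :: "(real^3) set \<Rightarrow> (real^3 \<Rightarrow> real^3) \<Rightarrow> (quat \<Rightarrow> quat) \<Rightarrow> quat \<Rightarrow> quat"
  where "H_left U a f x =
    qvec (a (snd x)) *\<^sub>H partial_derivative (qunit None) f x -
    (\<Sum>i\<in>UNIV. u_coeff U a i (snd x) *\<^sub>R partial_derivative (qunit (Some i)) f x)"

definition H_right :: "(real^3) set \<Rightarrow> (real^3 \<Rightarrow> real^3) \<Rightarrow> (quat \<Rightarrow> quat) \<Rightarrow> quat \<Rightarrow> quat"
  where "H_right U a f x =
    partial_derivative (qunit None) f x *\<^sub>H qvec (a (snd x)) -
    (\<Sum>i\<in>UNIV. u_coeff U a i (snd x) *\<^sub>R partial_derivative (qunit (Some i)) f x)"

definition jacobian_matrix :: "(quat \<Rightarrow> quat) \<Rightarrow> quat \<Rightarrow> real^(3 option)^(3 option)"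
  where "jacobian_matrix F x = (\<chi> i j. partial_derivative (qunit j) F x \<bullet> qunit i)"

definition M_coeff :: "(real^3 \<Rightarrow> real^3) \<Rightarrow> quat \<Rightarrow> real"
  where "M_coeff a x = \<bar>det (jacobian_matrix (lift a) x)\<bar>"

text \<open>
  The density with respect to the surface measure of the restriction of the 3-form \<open>\<nu>\<close> to a
  surface with unit normal \<open>n\<close>: the 3-form that completes \<open>dx\<^sub>k\<close> to the volume form restricts
  to \<open>n\<^sub>k dS\<close>.
\<close>

definition nu_density :: "quat \<Rightarrow> quat \<Rightarrow> quat"
  where "nu_density y n =
    (2 * fst n) *\<^sub>R qunit None +
    (2 / (norm (snd y))\<^sup>2 * (\<Sum>k\<in>UNIV. snd y $ k * snd n $ k)) *\<^sub>R qvec (snd y)"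

definition integral_nu :: "quat set \<Rightarrow> (quat \<Rightarrow> quat) \<Rightarrow> (quat \<Rightarrow> quat) \<Rightarrow> quat"
  where "integral_nu G \<phi> \<psi> =
    (\<integral>y. \<phi> y *\<^sub>H nu_density y (outward_unit_normal G y) *\<^sub>H \<psi> y
      \<partial>surface_measure (frontier G))"

text \<open>
  The integral over the boundary of \<open>\<Omega>\<close> of \<open>\<phi> J\<^sub>a\<nu> \<psi>\<close>: by definition, \<open>J\<^sub>a\<nu>\<close> is \<open>\<nu>\<close> transported
  from the boundary of the image of \<open>\<Omega>\<close> by the change of variables. Only the values of \<open>\<phi>\<close> and \<open>\<psi>\<close>
  on the boundary of \<open>\<Omega>\<close> enter.
\<close>

definition integral_J_nu ::
    "(real^3) set \<Rightarrow> (real^3 \<Rightarrow> real^3) \<Rightarrow> quat set \<Rightarrow> (quat \<Rightarrow> quat) \<Rightarrow> (quat \<Rightarrow> quat) \<Rightarrow> quat"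
  where "integral_J_nu U a \<Omega> \<phi> \<psi> =
    integral_nu (lift a ` \<Omega>) (\<phi> \<circ> lift (inv_into U a)) (\<psi> \<circ> lift (inv_into U a))"

end

(*
  In the coordinates y = a(x) the two equations lose their coefficients: for F = f o a^-1 they say
  that (vec y) d_0 F is the Euler derivative of F in the vector variable, and similarly for g. The
  divergence of the field g nu f then collapses to 4 g (vec y)/|y|^2 f, and the identity is the
  Gauss-Green theorem on a(Omega) followed by the change of variables a.

  The library has no Gauss-Green theorem. It is obtained with a partition of unity from the case
  of a field supported near a boundary point. There the domain is the region below a graph, and
  fields along the graph integrate to 0 by translation invariance, so that only the fundamental
  theorem of calculus in the vertical direction contributes.

  That the domain lies below, and not on both sides of, its boundary is a global fact about
  connected domains. It holds because every closed hypersurface of Euclidean space separates: near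
  the hypersurface its two sides can be coloured differently, and such colourings glue along a
  subdivision of a box since two of them differ by a global flip on convex sets.
*)
theory Submission
  imports Defs
begin

text \<open>Derivatives of \<open>f\<close> and \<open>g\<close> exist on the open set and have
  continuous limits on the closure; nothing may be differentiated on the boundary itself. Hence the
  local formula moves the graph inward before differentiating along it, and applies the fundamental
  theorem with mere continuity at the end point.

  \<open>surface_measure\<close> and \<open>outward_unit_normal\<close> are definite descriptions,
  so existence and uniqueness must precede any computation of a boundary integral. Charts are
  rotated graphs because there the area element is sqrt(1 + |dh|^2) and the normal is the rotated
  (1, -dh) divided by the same root: the root cancels and leaves the weight that integration below a
  graph produces.

  Boundedness of the image domain has to be derived: an unbounded domain with compact boundary
  contains the outside of a ball, hence real points.

  The constant 4 is the factor 2 of nu times 2: the divergence of y/|y|^2 in three variables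
  contributes (3 - 2)/|y|^2, the degree 1 homogeneity of the vector y another 1/|y|^2.\<close>

section \<open>Translation invariance and changes of variables\<close>

lemma integral_lborel_translation:
  fixes f :: "'a::euclidean_space \<Rightarrow> 'b::euclidean_space"
  assumes [measurable]: "f \<in> borel_measurable borel"
  shows "(\<integral>x. f (x + c) \<partial>lborel) = (\<integral>x. f x \<partial>lborel)"
proof -
  have "(\<integral>x. f x \<partial>lborel) = (\<integral>x. f x \<partial>distr lborel borel ((+) c))"
    by (simp add: lborel_distr_plus)
  also have "\<dots> = (\<integral>x. f (c + x) \<partial>lborel)"
    by (subst integral_distr) auto
  finally show ?thesis by (simp add: add.commute)
qed

lemma nn_integral_lborel_translation:
  fixes f :: "'a::euclidean_space \<Rightarrow> ennreal"
  assumes [measurable]: "f \<in> borel_measurable borel"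
  shows "(\<integral>\<^sup>+x. f (x + c) \<partial>lborel) = (\<integral>\<^sup>+x. f x \<partial>lborel)"
proof -
  have "(\<integral>\<^sup>+x. f x \<partial>lborel) = (\<integral>\<^sup>+x. f x \<partial>distr lborel borel ((+) c))"
    by (simp add: lborel_distr_plus)
  also have "\<dots> = (\<integral>\<^sup>+x. f (c + x) \<partial>lborel)"
    by (subst nn_integral_distr) auto
  finally show ?thesis by (simp add: add.commute)
qed

lemma integrable_bounded_support:
  fixes f :: "'a::euclidean_space \<Rightarrow> 'b::euclidean_space"
  assumes "f \<in> borel_measurable borel" "\<And>x. norm (f x) \<le> B" "bounded K" "\<And>x. x \<notin> K \<Longrightarrow> f x = 0"
  shows "integrable lborel f"
proof -
  obtain R where R: "K \<subseteq> cball 0 R" using assms(3) by (force simp: bounded_iff)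
  show ?thesis
  proof (rule integrableI_bounded_set[where A="cball 0 R" and B=B])
    show "emeasure lborel (cball 0 R) < \<infinity>"
      by (rule emeasure_bounded_finite) auto
    show "AE x\<in>cball 0 R in lborel. norm (f x) \<le> B" using assms(2) by auto
    show "AE x in lborel. x \<notin> cball 0 R \<longrightarrow> f x = 0" using R assms(4) by (intro AE_I2) blast
  qed (use assms in auto)
qed

lemma has_vector_derivative_imp_quotient_tendsto:
  fixes g :: "real \<Rightarrow> 'a::real_normed_vector"
  assumes "(g has_vector_derivative d) (at x)"
  shows "((\<lambda>t. (g (x + t) - g x) /\<^sub>R t) \<longlongrightarrow> d) (at 0)"
proof (subst Lim_null, subst tendsto_norm_zero_iff[symmetric], rule Lim_transform_eventually)
  show "((\<lambda>h. norm (g (x + h) - g x - h *\<^sub>R d) / norm h) \<longlongrightarrow> 0) (at 0)"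
    using assms by (simp add: has_vector_derivative_def has_derivative_at)
  have "norm (g (x + h) - g x - h *\<^sub>R d) / norm h = norm ((g (x + h) - g x) /\<^sub>R h - d)" if "h \<noteq> 0" for h
  proof -
    have "g (x + h) - g x - h *\<^sub>R d = h *\<^sub>R ((g (x + h) - g x) /\<^sub>R h - d)"
      using that by (simp add: scaleR_diff_right)
    then show ?thesis using that by simp
  qed
  then show "\<forall>\<^sub>F h in at 0. norm (g (x + h) - g x - h *\<^sub>R d) / norm h = norm ((g (x + h) - g x) /\<^sub>R h - d)"
    by (auto simp: eventually_at_filter)
qed

text \<open>The integral of a difference quotient vanishes by translation invariance.\<close>

lemma integral_directional_derivative_eq_0:
  fixes f :: "'a::euclidean_space \<Rightarrow> 'b::euclidean_space"
  assumes der: "\<And>x. (f has_derivative D x) (at x)"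
    and bound: "\<And>x v. norm (D x v) \<le> B * norm v"
    and K: "bounded K" "\<And>x. x \<notin> K \<Longrightarrow> f x = 0"
  shows "integrable lborel (\<lambda>x. D x v)" "(\<integral>x. D x v \<partial>lborel) = 0"
proof -
  have cont: "continuous_on UNIV f"
    using has_derivative_continuous[OF der] by (auto simp: continuous_on_eq_continuous_at)
  have [measurable]: "f \<in> borel_measurable borel"
    by (rule borel_measurable_continuous_onI[OF cont])
  define q where "q n x = real (Suc n) *\<^sub>R (f (x + (1 / real (Suc n)) *\<^sub>R v) - f x)" for n x
  obtain R where R: "K \<subseteq> cball 0 R" using K(1) by (force simp: bounded_iff)
  have B: "0 \<le> B"
  proof -
    obtain b :: 'a where "b \<in> Basis" using nonempty_Basis by blast
    then show ?thesis using bound[of 0 b] norm_ge_zero[of "D 0 b"] by (simp del: norm_ge_zero)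
  qed
  \<comment> \<open>The steps 1/(n+1) are at most 1, so every \<open>q n\<close> vanishes outside
    this one ball; the constant \<open>B * norm v\<close> on it dominates the whole
    sequence.\<close>
  define K' :: "'a set" where "K' = cball 0 (R + norm v)"
  have lip: "norm (f y - f x) \<le> B * norm (y - x)" for x y
    by (rule differentiable_bound[where S=UNIV and f'=D])
       (auto intro: der onorm_le bound has_derivative_at_withinI B)
  have qb: "norm (q n x) \<le> B * norm v" for n x
  proof -
    have "norm (q n x) = real (Suc n) * norm (f (x + (1 / real (Suc n)) *\<^sub>R v) - f x)"
      by (simp add: q_def)
    also have "\<dots> \<le> real (Suc n) * (B * norm ((1 / real (Suc n)) *\<^sub>R v))"
      by (intro mult_left_mono order_trans[OF lip]) (auto simp: B)
    also have "\<dots> = B * norm v" by (simp add: field_simps)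
    finally show ?thesis .
  qed
  have q0: "q n x = 0" if "x \<notin> K'" for n x
  proof -
    have "norm x > R + norm v" using that by (auto simp: K'_def)
    moreover have "norm (x + (1 / real (Suc n)) *\<^sub>R v) \<ge> norm x - norm v"
    proof -
      have "norm ((1 / real (Suc n)) *\<^sub>R v) \<le> norm v"
        by (simp add: divide_le_eq field_simps)
      then show ?thesis
        using norm_diff_ineq[of x "(1 / real (Suc n)) *\<^sub>R v"] by linarith
    qed
    ultimately have "norm x > R" "norm (x + (1 / real (Suc n)) *\<^sub>R v) > R"
      using norm_ge_zero[of v] by linarith+
    then have "x \<notin> K" "x + (1 / real (Suc n)) *\<^sub>R v \<notin> K"
      using R by fastforce+
    then show ?thesis using K(2) by (simp add: q_def)
  qed
  have [measurable]: "q n \<in> borel_measurable borel" for n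
    unfolding q_def by measurable
  have qint: "(\<integral>x. q n x \<partial>lborel) = 0" for n
  proof -
    have "compact (f ` cball 0 (max R 0))"
      by (intro compact_continuous_image continuous_on_subset[OF cont]) auto
    then obtain C where C: "\<And>x. x \<in> cball (0::'a) (max R 0) \<Longrightarrow> norm (f x) \<le> C"
      by (fastforce dest!: compact_imp_bounded simp: bounded_iff)
    have "norm (f x) \<le> max C 0" for x
      using C[of x] K(2)[of x] R by (cases "x \<in> K") (auto simp: le_max_iff_disj subset_iff)
    then have i1: "integrable lborel f"
      by (intro integrable_bounded_support[OF _ _ K]) auto
    have "integrable lborel (\<lambda>x. f (x + (1 / real (Suc n)) *\<^sub>R v))"
    proof -
      have "integrable (distr lborel borel ((+) ((1 / real (Suc n)) *\<^sub>R v))) f"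
        using i1 by (simp add: lborel_distr_plus)
      then show ?thesis by (subst (asm) integrable_distr_eq) (auto simp: add.commute)
    qed
    then show ?thesis unfolding q_def
      using i1 by (simp add: integral_lborel_translation)
  qed
  have lim: "(\<lambda>n. q n x) \<longlonglongrightarrow> D x v" for x
  proof -
    have "((\<lambda>t. f (x + t *\<^sub>R v)) has_derivative (\<lambda>t. D x (t *\<^sub>R v))) (at 0)"
      by (rule has_derivative_compose[of "\<lambda>t. x + t *\<^sub>R v" "\<lambda>t. t *\<^sub>R v" 0 UNIV f "D x", simplified])
         (auto intro!: derivative_eq_intros der)
    then have "((\<lambda>t. f (x + t *\<^sub>R v)) has_vector_derivative D x v) (at 0)"
      using linear_simps(5)[OF has_derivative_bounded_linear[OF der]]
      by (simp add: has_vector_derivative_def)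
    then have "((\<lambda>t. (f (x + t *\<^sub>R v) - f x) /\<^sub>R t) \<longlongrightarrow> D x v) (at 0)"
      using has_vector_derivative_imp_quotient_tendsto[of "\<lambda>t. f (x + t *\<^sub>R v)" "D x v" 0] by simp
    moreover have "filterlim (\<lambda>n. 1 / real (Suc n)) (at 0) sequentially"
      using LIMSEQ_Suc[OF lim_1_over_n[where 'a=real]] by (simp add: filterlim_at)
    ultimately have "(\<lambda>n. (f (x + (1 / real (Suc n)) *\<^sub>R v) - f x) /\<^sub>R (1 / real (Suc n))) \<longlonglongrightarrow> D x v"
      by (rule filterlim_compose)
    then show ?thesis by (simp add: q_def)
  qed
  have [measurable]: "(\<lambda>x. D x v) \<in> borel_measurable lborel"
    by (rule borel_measurable_LIMSEQ_metric[OF _ lim]) auto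
  have *: "integrable lborel (\<lambda>x. B * norm v * indicator K' x :: real)"
    unfolding K'_def by (intro integrable_mult_right integrable_real_indicator emeasure_bounded_finite) auto
  have **: "norm (q n x) \<le> B * norm v * indicator K' x" for n x
    using qb[of n x] q0[of x n] by (auto simp: indicator_def)
  have "(\<lambda>n. \<integral>x. q n x \<partial>lborel) \<longlonglongrightarrow> (\<integral>x. D x v \<partial>lborel)"
    by (rule integral_dominated_convergence[OF _ _ *]) (use lim ** in auto)
  then show "(\<integral>x. D x v \<partial>lborel) = 0" by (simp add: qint LIMSEQ_const_iff)
  show "integrable lborel (\<lambda>x. D x v)"
    by (rule integrable_dominated_convergence[OF _ _ * AE_I2[OF lim] AE_I2[OF **]]) auto
qed

lemma nn_integral_lborel_uminus:
  fixes f :: "'a::euclidean_space \<Rightarrow> ennreal"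
  assumes [measurable]: "f \<in> borel_measurable borel"
  shows "(\<integral>\<^sup>+x. f (- x) \<partial>lborel) = (\<integral>\<^sup>+x. f x \<partial>lborel)"
proof -
  have "lborel = distr lborel borel (\<lambda>x::'a. - x)"
    using lborel_affine[of "-1" "0::'a"] by (simp add: density_1)
  then have "(\<integral>\<^sup>+x. f x \<partial>lborel) = (\<integral>\<^sup>+x. f x \<partial>distr lborel borel (\<lambda>x::'a. - x))"
    by simp
  then show ?thesis by (subst (asm) nn_integral_distr) auto
qed

text \<open>
  Weighing \<open>f\<close> against the indicator \<open>b\<close> of the unit ball, which \<open>T\<close> preserves, Fubini and
  translation invariance show that \<open>\<integral> f d\<mu> \<cdot> \<integral> b d\<lambda> = \<integral> f(-x) d\<lambda> \<cdot> \<integral> b d\<mu>\<close> for every translation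
  invariant \<open>\<mu>\<close>, in particular for the image \<open>\<mu>\<close> of \<open>\<lambda>\<close> under \<open>T\<close>.
\<close>

lemma distr_lborel_orthogonal_transformation:
  fixes T :: "'a::euclidean_space \<Rightarrow> 'a"
  assumes T: "orthogonal_transformation T"
  shows "distr lborel borel T = lborel"
proof (rule measure_eqI)
  have lin: "linear T" using T by (rule orthogonal_transformation_linear)
  have [measurable]: "T \<in> borel \<rightarrow>\<^sub>M borel"
    by (intro borel_measurable_continuous_onI linear_continuous_on linear_conv_bounded_linear[THEN iffD1] lin)
  have normT: "norm (T x) = norm x" for x
    by (rule orthogonal_transformation_norm[OF T])
  define b :: "'a \<Rightarrow> ennreal" where "b = indicator (cball 0 1)"
  have [measurable]: "b \<in> borel_measurable borel"
    unfolding b_def by (rule borel_measurable_indicator[OF borel_closed[OF closed_cball]])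
  define c where "c = (\<integral>\<^sup>+y. b y \<partial>lborel)"
  have bT: "b (T x) = b x" for x by (simp add: b_def indicator_def normT)
  have c: "c \<noteq> 0" "c \<noteq> \<infinity>"
  proof -
    have "c = ennreal (measure lborel (cball (0::'a) 1))"
      using emeasure_lborel_cball_finite[of "0::'a" 1]
      by (simp add: c_def b_def emeasure_eq_ennreal_measure)
    then show "c \<noteq> 0" "c \<noteq> \<infinity>"
      using content_cball_pos[of 1 "0::'a"] by auto
  qed
  fix A :: "'a set" assume "A \<in> sets (distr lborel borel T)"
  then have A[measurable]: "A \<in> sets borel" by simp
  define f :: "'a \<Rightarrow> ennreal" where "f = indicator A"
  have [measurable]: "f \<in> borel_measurable borel" by (simp add: f_def)
  \<comment> \<open>Since T (x + S y) = T x + y, translating x by \<open>S y\<close> moves y from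
    the argument of \<open>b\<close> to that of \<open>f\<close>.\<close>
  obtain S where S: "\<And>y. T (S y) = y"
    using orthogonal_transformation_surj[OF T] by (metis surj_def)
  have "(\<integral>\<^sup>+x. f (T x) \<partial>lborel) * c = (\<integral>\<^sup>+x. (\<integral>\<^sup>+y. f (T x) * b y \<partial>lborel) \<partial>lborel)"
    by (simp add: nn_integral_cmult nn_integral_multc c_def)
  also have "\<dots> = (\<integral>\<^sup>+x. (\<integral>\<^sup>+y. f (T x) * b (y + T x) \<partial>lborel) \<partial>lborel)"
    by (simp add: nn_integral_cmult nn_integral_lborel_translation)
  also have "\<dots> = (\<integral>\<^sup>+y. (\<integral>\<^sup>+x. f (T x) * b (y + T x) \<partial>lborel) \<partial>lborel)"
    by (rule lborel_pair.Fubini') measurable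
  also have "\<dots> = (\<integral>\<^sup>+y. (\<integral>\<^sup>+x. f (T x - y) * b (T x) \<partial>lborel) \<partial>lborel)"
  proof (rule nn_integral_cong)
    fix y
    show "(\<integral>\<^sup>+x. f (T x) * b (y + T x) \<partial>lborel) = (\<integral>\<^sup>+x. f (T x - y) * b (T x) \<partial>lborel)"
      using nn_integral_lborel_translation[of "\<lambda>x. f (T x - y) * b (T x)" "S y"]
      by (simp add: linear_add[OF lin] S add.commute)
  qed
  also have "\<dots> = (\<integral>\<^sup>+x. (\<integral>\<^sup>+y. f (T x - y) * b (T x) \<partial>lborel) \<partial>lborel)"
    by (rule lborel_pair.Fubini') measurable
  also have "\<dots> = (\<integral>\<^sup>+x. (\<integral>\<^sup>+y. f y \<partial>lborel) * b x \<partial>lborel)"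
  proof (rule nn_integral_cong)
    fix x
    have "(\<integral>\<^sup>+y. f (T x - y) \<partial>lborel) = (\<integral>\<^sup>+y. f (T x + y) \<partial>lborel)"
      using nn_integral_lborel_uminus[of "\<lambda>y. f (T x + y)"] by simp
    also have "\<dots> = (\<integral>\<^sup>+y. f y \<partial>lborel)"
      using nn_integral_lborel_translation[of f "T x"] by (simp add: add.commute)
    finally show "(\<integral>\<^sup>+y. f (T x - y) * b (T x) \<partial>lborel) = (\<integral>\<^sup>+y. f y \<partial>lborel) * b x"
      by (simp add: nn_integral_multc bT)
  qed
  also have "\<dots> = (\<integral>\<^sup>+y. f y \<partial>lborel) * c"
    by (simp add: nn_integral_cmult c_def)
  finally have "(\<integral>\<^sup>+x. f (T x) \<partial>lborel) = (\<integral>\<^sup>+y. f y \<partial>lborel)"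
    using c by (simp add: mult.commute[of _ c] ennreal_mult_cancel_left)
  moreover have "emeasure (distr lborel borel T) A = (\<integral>\<^sup>+x. f (T x) \<partial>lborel)"
    using nn_integral_distr[of T lborel borel f] A by (simp add: f_def)
  ultimately show "emeasure (distr lborel borel T) A = emeasure lborel A"
    by (simp add: f_def)
qed simp

text \<open>\<open>has_measure_differentiable_image\<close> equates finite measure of the image with
  integrability of the Jacobian. The identity in \<open>ennreal\<close> follows by splitting on
  whether the integral is infinite; in that case a finite measure of the image would be a
  contradiction.\<close>

lemma emeasure_differentiable_image:
  fixes g :: "real^'n::{finite,wellorder} \<Rightarrow> real^'n::_"
  assumes S[measurable]: "S \<in> sets borel" and gS[measurable]: "g ` S \<in> sets borel"
    and der: "\<And>x. x \<in> S \<Longrightarrow> (g has_derivative g' x) (at x)"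
    and inj: "inj_on g S"
    and [measurable]: "(\<lambda>x. indicator S x * \<bar>det (matrix (g' x))\<bar>) \<in> borel_measurable borel"
  shows "emeasure lborel (g ` S) = (\<integral>\<^sup>+x. ennreal (indicator S x * \<bar>det (matrix (g' x))\<bar>) \<partial>lborel)"
    (is "_ = integral\<^sup>N lborel ?J")
proof -
  have SL: "S \<in> sets lebesgue" by (simp add: sets_completionI_sets)
  have der': "(g has_derivative g' x) (at x within S)" if "x \<in> S" for x
    using der[OF that] by (rule has_derivative_at_withinI)
  note iff = has_measure_differentiable_image[OF SL der' inj]
  have em: "emeasure lebesgue (g ` S) = emeasure lborel (g ` S)" by simp
  show ?thesis
  proof (cases "integral\<^sup>N lborel ?J = \<infinity>")
    case False
    then obtain r where r: "0 \<le> r" "integral\<^sup>N lborel ?J = ennreal r"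
      by (cases "integral\<^sup>N lborel ?J") auto
    have "((\<lambda>x. indicator S x * \<bar>det (matrix (g' x))\<bar>) has_integral r) UNIV"
      by (rule nn_integral_has_integral[OF _ _ r(2,1)]) auto
    then have "((\<lambda>x. \<bar>det (matrix (g' x))\<bar>) has_integral r) S"
      using has_integral_restrict_UNIV[of S "\<lambda>x. \<bar>det (matrix (g' x))\<bar>" r]
      by (simp add: indicator_def of_bool_def if_distribR if_distrib[of "\<lambda>c. c * _"] cong: if_cong)
    then have "g ` S \<in> lmeasurable" "measure lebesgue (g ` S) = r"
      using iff by auto
    then show ?thesis using r em by (metis emeasure_eq_measure2)
  next
    case True
    have False if fin: "emeasure lborel (g ` S) \<noteq> \<infinity>"
    proof -
      have "g ` S \<in> lmeasurable"
        using fin em by (intro fmeasurableI) (simp_all add: less_top sets_completionI_sets gS)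
      then have "((\<lambda>x. \<bar>det (matrix (g' x))\<bar>) has_integral measure lebesgue (g ` S)) S"
        using iff by auto
      then have "integral\<^sup>N lborel ?J = measure lebesgue (g ` S)"
        by (intro nn_integral_has_integral_lebesgue) auto
      then show False using True by simp
    qed
    then show ?thesis using True by auto
  qed
qed

section \<open>Integration by parts below a graph\<close>

text \<open>Over u, \<open>v\<close> splits as c(u) (1, 0) + (dh u v', v') with c(u) =
  \<open>fst v - dh u (snd v)\<close>. The fundamental theorem turns the vertical part
  \<open>G1\<close> into the boundary term. The part \<open>G2\<close> is tangent to the vertical
  translates of the graph: after a shear by \<open>h\<close> it is, on each translate, a derivative
  of a compactly supported function of u and integrates to 0. Only translates strictly below the
  graph occur, where \<open>w\<close> is differentiable.\<close>

lemma gauss_green_subgraph: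
  fixes w :: "real \<times> 'a::euclidean_space \<Rightarrow> 'b::euclidean_space" and h :: "'a \<Rightarrow> real" and Q :: "'a set"
  defines "below \<equiv> {y. snd y \<in> Q \<and> fst y < h (snd y)}"
  assumes Q: "open Q"
    and h: "\<And>u. u \<in> Q \<Longrightarrow> (h has_derivative dh u) (at u)"
    and dh: "\<And>v. continuous_on Q (\<lambda>u. dh u v)"
    and hC: "\<And>u. u \<in> Q \<Longrightarrow> \<bar>h u\<bar> \<le> C"
    and dhC: "\<And>u v. u \<in> Q \<Longrightarrow> \<bar>dh u v\<bar> \<le> C * norm v"
    and K: "compact K" "snd ` K \<subseteq> Q"
    and w0: "\<And>y. y \<notin> K \<Longrightarrow> w y = 0"
    and wd: "\<And>y. y \<in> below \<Longrightarrow> (w has_derivative Dw y) (at y)"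
    and wc: "continuous_on {y. snd y \<in> Q \<and> fst y \<le> h (snd y)} w"
    and Dc: "\<And>v. continuous_on below (\<lambda>y. Dw y v)"
    and Db: "\<And>y v. y \<in> below \<Longrightarrow> norm (Dw y v) \<le> B * norm v"
  shows "integrable lborel (\<lambda>y. indicator below y *\<^sub>R Dw y v)" (is ?A)
    and "integrable lborel (\<lambda>u. indicator Q u *\<^sub>R (fst v - dh u (snd v)) *\<^sub>R w (h u, u))" (is ?B)
    and "(\<integral>y. indicator below y *\<^sub>R Dw y v \<partial>lborel) =
      (\<integral>u. indicator Q u *\<^sub>R (fst v - dh u (snd v)) *\<^sub>R w (h u, u) \<partial>lborel)" (is ?C)
proof -
  have hcont: "continuous_on Q h"
    using has_derivative_continuous[OF h] by (auto intro: continuous_at_imp_continuous_on)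
  have QU: "open ((UNIV::real set) \<times> Q)" by (intro open_Times Q open_UNIV)
  have hcont2: "continuous_on (UNIV \<times> Q) (\<lambda>y::real \<times> 'a. h (snd y))"
    by (rule continuous_on_compose2[OF hcont]) (auto intro: continuous_intros)
  have obelow: "open below"
  proof -
    have "open ((UNIV \<times> Q) \<inter> (\<lambda>y. fst y - h (snd y)) -` {..<0})"
      by (intro continuous_open_preimage QU continuous_intros hcont2)
    moreover have "below = (UNIV \<times> Q) \<inter> (\<lambda>y. fst y - h (snd y)) -` {..<0}"
      by (auto simp: below_def)
    ultimately show ?thesis by simp
  qed
  have bs[measurable]: "below \<in> sets borel" "Q \<in> sets borel" using obelow Q by auto
  have oK: "open (- K)" using K(1) compact_imp_closed by blast
  have Dlin: "linear (Dw y)" if "y \<in> below" for y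
    using has_derivative_linear[OF wd[OF that]] .
  have D0: "Dw y v = 0" if y: "y \<in> below" "y \<notin> K" for y v
  proof -
    have "(w has_derivative (\<lambda>v. 0)) (at y)"
      by (rule has_derivative_transform_within_open[OF _ oK]) (use y w0 in auto)
    then show ?thesis using wd[OF y(1)] has_derivative_unique by metis
  qed
  define v0 v' where "v0 = fst v" and "v' = snd v"
  define c where "c u = v0 - dh u v'" for u
  have cQ: "continuous_on Q c" unfolding c_def by (intro continuous_intros dh)
  have cb: "\<bar>c u\<bar> \<le> \<bar>v0\<bar> + C * norm v'" if "u \<in> Q" for u
    using dhC[OF that, of v'] by (simp add: c_def)
  have Bb: "norm (Dw y x) \<le> \<bar>B\<bar> * norm x" if "y \<in> below" for x y
    using Db[OF that, of x] by (rule order_trans) (simp add: mult_right_mono)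
  have Cb: "C * norm x \<le> \<bar>C\<bar> * norm x" for x :: 'a by (simp add: mult_right_mono)
  have bK: "bounded K" using K(1) by (rule compact_imp_bounded)
  obtain R where R: "\<And>y. y \<in> K \<Longrightarrow> norm y \<le> R" using bK by (auto simp: bounded_iff)
  define F where "F x y = indicator below y *\<^sub>R Dw y x" for x y
  have Fm[measurable]: "F x \<in> borel_measurable borel" for x
    unfolding F_def by (intro borel_measurable_continuous_on_indicator Dc bs)
  have Fi: "integrable lborel (F x)" for x
  proof (rule integrable_bounded_support[OF Fm _ bK])
    show "norm (F x y) \<le> \<bar>B\<bar> * norm x" for y
      using Bb[of y x] by (auto simp: F_def indicator_def)
    show "F x y = 0" if "y \<notin> K" for y using D0 that by (auto simp: F_def indicator_def)
  qed
  then show ?A by (simp add: F_def[abs_def])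
  define G1 where "G1 y = indicator below y *\<^sub>R c (snd y) *\<^sub>R Dw y (1, 0)" for y
  define G2 where "G2 y = indicator below y *\<^sub>R Dw y (dh (snd y) v', v')" for y
  have G1m[measurable]: "G1 \<in> borel_measurable borel"
    unfolding G1_def
    by (intro borel_measurable_continuous_on_indicator continuous_intros Dc continuous_on_compose2[OF cQ])
       (use bs in \<open>auto simp: below_def\<close>)
  have G1i: "integrable lborel G1"
  proof (rule integrable_bounded_support[OF G1m _ bK])
    show "norm (G1 y) \<le> (\<bar>v0\<bar> + \<bar>C\<bar> * norm v') * \<bar>B\<bar>" for y
    proof (cases "y \<in> below")
      case True
      then have "\<bar>c (snd y)\<bar> \<le> \<bar>v0\<bar> + \<bar>C\<bar> * norm v'"
        using cb[of "snd y"] Cb[of v'] by (auto simp: below_def)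
      moreover have "norm (Dw y (1, 0)) \<le> \<bar>B\<bar>" using Bb[OF True, of "(1,0)"] by simp
      ultimately show ?thesis using True by (auto simp: G1_def intro!: mult_mono)
    qed (simp add: G1_def)
    show "G1 y = 0" if "y \<notin> K" for y using D0 that by (auto simp: G1_def indicator_def)
  qed
  have F_eq: "F v y = G1 y + G2 y" for y
  proof (cases "y \<in> below")
    case True
    have "v = c (snd y) *\<^sub>R (1, 0) + (dh (snd y) v', v')"
      by (simp add: c_def v0_def v'_def prod_eq_iff)
    then have "Dw y v = c (snd y) *\<^sub>R Dw y (1, 0) + Dw y (dh (snd y) v', v')"
      using linear_add[OF Dlin[OF True]] linear_scale[OF Dlin[OF True]] by metis
    then show ?thesis using True by (simp add: F_def G1_def G2_def)
  qed (simp add: F_def G1_def G2_def)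
  have G2i: "integrable lborel G2"
  proof -
    have "G2 = (\<lambda>y. F v y - G1 y)" using F_eq by auto
    then show ?thesis using Fi G1i by auto
  qed
  have G2m[measurable]: "G2 \<in> borel_measurable borel" using G2i by simp
  have inner1: "(\<integral>z. G1 (z, u) \<partial>lborel) = indicator Q u *\<^sub>R c u *\<^sub>R w (h u, u)" for u
  proof (cases "u \<in> Q")
    case True
    define \<phi> where "\<phi> z = G1 (z, u)" for z
    \<comment> \<open>The lower limit lies beneath the graph and beneath \<open>K\<close>, which
      sits in the ball of radius \<open>R\<close>, so \<open>w\<close> vanishes there.\<close>
    define m where "m = min (h u) (- R) - 1"
    have far: "(z, u) \<notin> K" if "z \<le> m" for z
    proof
      assume "(z, u) \<in> K"
      then have "\<bar>z\<bar> \<le> R" using R[of "(z, u)"] norm_fst_le[of z u] by simp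
      then show False using that by (auto simp: m_def)
    qed
    have "((\<lambda>z. c u *\<^sub>R Dw (z, u) (1, 0)) has_integral c u *\<^sub>R w (h u, u) - c u *\<^sub>R w (m, u)) {m..h u}"
    \<comment> \<open>The interior version fits: at the upper end point, on the graph,
      \<open>w\<close> is only continuous.\<close>
    proof (rule fundamental_theorem_of_calculus_interior)
      show "m \<le> h u" by (simp add: m_def)
      show "continuous_on {m..h u} (\<lambda>z. c u *\<^sub>R w (z, u))"
        by (intro continuous_intros continuous_on_compose2[OF wc]) (auto simp: True)
      fix z assume "z \<in> {m<..<h u}"
      then have "(z, u) \<in> below" using True by (simp add: below_def)
      then have "((\<lambda>z. w (z, u)) has_derivative (\<lambda>t. Dw (z, u) (t, 0))) (at z)"
        by (intro has_derivative_compose[of "\<lambda>z. (z, u)" "\<lambda>t. (t, 0)" z UNIV w, OF _ wd])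
           (auto intro!: derivative_eq_intros)
      moreover have "(\<lambda>t. Dw (z, u) (t, 0)) = (\<lambda>t. t *\<^sub>R Dw (z, u) (1, 0))"
      proof
        fix t
        have "(t, 0::'a) = t *\<^sub>R (1, 0)" by simp
        then show "Dw (z, u) (t, 0) = t *\<^sub>R Dw (z, u) (1, 0)"
          using linear_scale[OF Dlin[OF \<open>(z, u) \<in> below\<close>], of t "(1, 0)"] by argo
      qed
      ultimately have "((\<lambda>z. w (z, u)) has_vector_derivative Dw (z, u) (1, 0)) (at z)"
        unfolding has_vector_derivative_def by (rule back_subst)
      then show "((\<lambda>z. c u *\<^sub>R w (z, u)) has_vector_derivative c u *\<^sub>R Dw (z, u) (1, 0)) (at z)"
        by (auto intro!: derivative_eq_intros)
    qed
    then have "((\<lambda>z. if z \<in> {m..h u} then c u *\<^sub>R Dw (z, u) (1, 0) else 0) has_integral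
        c u *\<^sub>R w (h u, u)) UNIV"
      using w0[OF far[OF order_refl]] by (subst has_integral_restrict_UNIV) simp
    then have "(\<phi> has_integral c u *\<^sub>R w (h u, u)) UNIV"
    proof (rule has_integral_spike_finite[rotated 2])
      \<comment> \<open>The region below the graph omits the end point \<open>h u\<close>, which the
        closed interval contains.\<close>
      show "finite {h u}" by simp
      fix z assume "z \<in> UNIV - {h u}"
      then show "\<phi> z = (if z \<in> {m..h u} then c u *\<^sub>R Dw (z, u) (1, 0) else 0)"
        using D0[of "(z, u)" "(1,0)"] far[of z] True
        by (auto simp: \<phi>_def G1_def below_def indicator_def)
    qed
    moreover have "integrable lborel \<phi>"
    proof (rule integrable_bounded_support)
      show "\<phi> \<in> borel_measurable borel" unfolding \<phi>_def by measurable
      show "bounded (fst ` K)" by (rule bounded_fst[OF bK])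
      show "norm (\<phi> z) \<le> (\<bar>v0\<bar> + \<bar>C\<bar> * norm v') * \<bar>B\<bar>" for z
      proof (cases "(z, u) \<in> below")
        case T: True
        then have "\<bar>c u\<bar> \<le> \<bar>v0\<bar> + \<bar>C\<bar> * norm v'"
          using cb[of u] Cb[of v'] by (auto simp: below_def)
        moreover have "norm (Dw (z, u) (1, 0)) \<le> \<bar>B\<bar>" using Bb[OF T, of "(1,0)"] by simp
        ultimately show ?thesis using T by (auto simp: \<phi>_def G1_def intro!: mult_mono)
      qed (simp add: G1_def \<phi>_def)
      show "\<phi> z = 0" if "z \<notin> fst ` K" for z
      proof -
        have "(z, u) \<notin> K" using that by force
        then show ?thesis using D0[of "(z, u)"] by (auto simp: \<phi>_def G1_def indicator_def)
      qed
    qed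
    ultimately have "(\<integral>z. \<phi> z \<partial>lborel) = c u *\<^sub>R w (h u, u)"
      using has_integral_integral_lborel has_integral_unique by blast
    then show ?thesis using True by (simp add: \<phi>_def)
  qed (simp add: G1_def below_def)
  have G1p: "integrable ((lborel :: real measure) \<Otimes>\<^sub>M (lborel :: 'a measure)) (case_prod (\<lambda>z u. G1 (z, u)))"
    using G1i by (simp add: lborel_prod)
  have int1: "(\<integral>y. G1 y \<partial>lborel) = (\<integral>u. indicator Q u *\<^sub>R c u *\<^sub>R w (h u, u) \<partial>lborel)"
    using lborel_pair.integral_snd[OF G1p] by (simp add: inner1 lborel_prod)
  show ?B using lborel_pair.integrable_snd[OF G1p] by (simp add: inner1 c_def v0_def v'_def)
  \<comment> \<open>\<open>G2\<close> in sheared coordinates: \<open>fst y\<close> is now the height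
    relative to the graph, so that the region becomes the product \<open>E\<close>.\<close>
  define \<Phi> where "\<Phi> y = G2 (fst y + h (snd y), snd y)" for y
  define E where "E = {..<0::real} \<times> Q"
  have E: "open E" unfolding E_def by (intro open_Times Q) auto
  have \<Phi>_eq: "\<Phi> y = indicator E y *\<^sub>R
      (dh (snd y) v' *\<^sub>R Dw (fst y + h (snd y), snd y) (1, 0) + Dw (fst y + h (snd y), snd y) (0, v'))" for y
  proof (cases "y \<in> E")
    case True
    then have b: "(fst y + h (snd y), snd y) \<in> below" by (auto simp: E_def below_def)
    have "(dh (snd y) v', v') = dh (snd y) v' *\<^sub>R (1, 0) + (0, v')" by simp
    then show ?thesis using True b linear_add[OF Dlin[OF b]] linear_scale[OF Dlin[OF b]]
      by (metis (no_types, lifting) G2_def \<Phi>_def indicator_simps(1) scaleR_one snd_conv)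
  next
    case False
    then have b: "(fst y + h (snd y), snd y) \<notin> below" by (auto simp: E_def below_def mem_Times_iff)
    with False show ?thesis by (simp add: \<Phi>_def G2_def)
  qed
  have Eb: "(fst y + h (snd y), snd y) \<in> below" if "y \<in> E" for y
    using that by (auto simp: E_def below_def)
  have G2K: "G2 y = 0" if "y \<notin> K" for y using D0 that by (auto simp: G2_def indicator_def)
  have pairb: "norm (dh u x, x) \<le> (\<bar>C\<bar> + 1) * norm x" if "u \<in> Q" for u x
    using norm_Pair_le[of "dh u x" x] dhC[OF that, of x] Cb[of x] by (simp add: algebra_simps)
  have DE: "norm (Dw (z + h u, u) (dh u x, x)) \<le> \<bar>B\<bar> * (\<bar>C\<bar> + 1) * norm x" if "(z, u) \<in> E" for z u x
  proof -
    have "norm (Dw (z + h u, u) (dh u x, x)) \<le> \<bar>B\<bar> * norm (dh u x, x)"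
      using Bb[OF Eb[OF that]] by simp
    also have "\<dots> \<le> \<bar>B\<bar> * ((\<bar>C\<bar> + 1) * norm x)"
      using that by (intro mult_left_mono pairb) (auto simp: E_def)
    finally show ?thesis by (simp add: mult.assoc)
  qed
  have \<Phi>i: "integrable lborel \<Phi>"
  proof (rule integrable_bounded_support)
    have s: "continuous_on E (\<lambda>y. (fst y + h (snd y), snd y))"
      by (intro continuous_intros continuous_on_subset[OF hcont2]) (auto simp: E_def)
    have D': "continuous_on E (\<lambda>y. Dw (fst y + h (snd y), snd y) x)" for x
      by (rule continuous_on_compose2[OF Dc s]) (use Eb in auto)
    show "\<Phi> \<in> borel_measurable borel"
      unfolding \<Phi>_eq[abs_def]
      by (intro borel_measurable_continuous_on_indicator continuous_intros D' continuous_on_compose2[OF dh])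
         (use E in \<open>auto simp: E_def\<close>)
    show "norm (\<Phi> y) \<le> \<bar>B\<bar> * (\<bar>C\<bar> + 1) * norm v'" for y
    proof (cases "y \<in> E")
      case True
      then show ?thesis using DE[of "fst y" "snd y" v'] Eb[OF True] by (simp add: \<Phi>_def G2_def)
    qed (simp add: \<Phi>_eq)
    show "bounded (cball (0::real) (R + \<bar>C\<bar>) \<times> snd ` K)"
      by (intro bounded_Times bounded_snd bK bounded_cball)
    show "\<Phi> y = 0" if "y \<notin> cball 0 (R + \<bar>C\<bar>) \<times> snd ` K" for y
    proof (rule ccontr)
      assume nz: "\<Phi> y \<noteq> 0"
      then have k: "(fst y + h (snd y), snd y) \<in> K" using G2K by (auto simp: \<Phi>_def)
      have "snd y \<in> Q" using nz by (auto simp: \<Phi>_eq E_def indicator_def)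
      then have "\<bar>h (snd y)\<bar> \<le> \<bar>C\<bar>" using hC[of "snd y"] by linarith
      moreover have "\<bar>fst y + h (snd y)\<bar> \<le> R"
        using R[OF k] norm_fst_le[of "fst y + h (snd y)" "snd y"] by simp
      ultimately have "\<bar>fst y\<bar> \<le> R + \<bar>C\<bar>" by linarith
      moreover have "snd y \<in> snd ` K" using imageI[OF k, of snd] by simp
      ultimately show False using that by (auto simp: mem_Times_iff)
    qed
  qed
  have inner2: "(\<integral>u. \<Phi> (z, u) \<partial>lborel) = 0" for z :: real
  proof (cases "z < 0")
    case True
    \<comment> \<open>This is \<open>w\<close> on the translate of the graph by \<open>z\<close>.
      Extension by 0 beyond \<open>Q\<close> keeps it differentiable because \<open>K\<close>
      projects to a compact subset of the open set \<open>Q\<close>.\<close>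
    define \<psi> where "\<psi> u = (if u \<in> Q then w (z + h u, u) else 0)" for u
    define D\<psi> where "D\<psi> u x = (if u \<in> Q then Dw (z + h u, u) (dh u x, x) else 0)" for u x
    have "(\<integral>u. D\<psi> u v' \<partial>lborel) = 0"
    proof (rule integral_directional_derivative_eq_0(2))
      show "bounded (snd ` K)" by (rule bounded_snd[OF bK])
      show z: "\<psi> u = 0" if "u \<notin> snd ` K" for u
      proof -
        have "(z + h u, u) \<notin> K" using that by force
        then show ?thesis using w0 by (auto simp: \<psi>_def)
      qed
      show "norm (D\<psi> u x) \<le> \<bar>B\<bar> * (\<bar>C\<bar> + 1) * norm x" for u x
        using DE[of z u x] True by (auto simp: D\<psi>_def E_def)
      show "(\<psi> has_derivative D\<psi> u) (at u)" for u
      proof (cases "u \<in> Q")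
        case u: True
        have "((\<lambda>u. w (z + h u, u)) has_derivative (\<lambda>x. Dw (z + h u, u) (dh u x, x))) (at u)"
        proof (rule has_derivative_compose[of "\<lambda>u. (z + h u, u)" "\<lambda>x. (dh u x, x)" u UNIV w])
          show "((\<lambda>u. (z + h u, u)) has_derivative (\<lambda>x. (dh u x, x))) (at u)"
            by (auto intro!: derivative_eq_intros h u)
          show "(w has_derivative Dw (z + h u, u)) (at (z + h u, u))"
            by (rule wd) (use u True in \<open>auto simp: below_def\<close>)
        qed
        then have "((\<lambda>u. w (z + h u, u)) has_derivative D\<psi> u) (at u)"
          using u by (simp add: D\<psi>_def[abs_def])
        then show ?thesis
          by (rule has_derivative_transform_within_open[OF _ Q u]) (simp add: \<psi>_def)
      next
        case False
        have o: "open (- snd ` K)"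
          by (intro open_Compl compact_imp_closed compact_continuous_image K(1) continuous_on_snd
              continuous_on_id)
        have "(\<psi> has_derivative (\<lambda>x. 0)) (at u)"
          by (rule has_derivative_transform_within_open[OF _ o]) (use z False K(2) in auto)
        moreover have "D\<psi> u = (\<lambda>x. 0)" using False by (auto simp: D\<psi>_def)
        ultimately show ?thesis by simp
      qed
    qed
    moreover have "\<Phi> (z, u) = D\<psi> u v'" for u
      using True by (auto simp: \<Phi>_def G2_def D\<psi>_def below_def)
    ultimately show ?thesis by simp
  qed (auto simp: \<Phi>_eq E_def)
  have \<Phi>p: "integrable ((lborel :: real measure) \<Otimes>\<^sub>M (lborel :: 'a measure)) (case_prod (\<lambda>z u. \<Phi> (z, u)))"
    using \<Phi>i by (simp add: lborel_prod)
  have G2p: "integrable ((lborel :: real measure) \<Otimes>\<^sub>M (lborel :: 'a measure)) (case_prod (\<lambda>z u. G2 (z, u)))"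
    using G2i by (simp add: lborel_prod)
  have "(\<integral>y. G2 y \<partial>lborel) = (\<integral>u. (\<integral>z. G2 (z, u) \<partial>lborel) \<partial>lborel)"
    using lborel_pair.integral_snd[OF G2p] by (simp add: lborel_prod)
  also have "\<dots> = (\<integral>u. (\<integral>z. \<Phi> (z, u) \<partial>lborel) \<partial>lborel)"
  proof (rule Bochner_Integration.integral_cong[OF refl])
    fix u
    have "(\<lambda>z. G2 (z, u)) \<in> borel_measurable borel" by measurable
    from integral_lborel_translation[OF this, of "h u"]
    show "(\<integral>z. G2 (z, u) \<partial>lborel) = (\<integral>z. \<Phi> (z, u) \<partial>lborel)" by (simp add: \<Phi>_def)
  qed
  also have "\<dots> = (\<integral>z. (\<integral>u. \<Phi> (z, u) \<partial>lborel) \<partial>lborel)"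
    by (rule lborel_pair.Fubini_integral[OF \<Phi>p])
  also have "\<dots> = 0" by (simp add: inner2)
  finally have int2: "(\<integral>y. G2 y \<partial>lborel) = 0" .
  have "(\<integral>y. F v y \<partial>lborel) = (\<integral>y. G1 y \<partial>lborel)"
    using int2 by (simp add: F_eq G1i G2i)
  then show ?C using int1 by (simp add: F_def c_def v0_def v'_def)
qed

section \<open>Crossing a hypersurface\<close>

text \<open>Purely topological and local: no smoothness, and no choice of sides that is coherent
  along \<open>S\<close>. The clause on closures makes both sides reach every point of
  \<open>S\<close> in \<open>N\<close>; in particular \<open>S\<close> has empty interior.\<close>

definition two_sided :: "'a::real_normed_vector set \<Rightarrow> bool" where
  "two_sided S \<longleftrightarrow> (\<forall>x\<in>S. \<forall>e>0. \<exists>N A B. open N \<and> x \<in> N \<and> N \<subseteq> ball x e \<and>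
    open A \<and> open B \<and> connected A \<and> connected B \<and> A \<inter> B = {} \<and>
    N - S = A \<union> B \<and> N \<inter> S \<subseteq> closure A \<inter> closure B)"

text \<open>The two colours are swapped on crossing \<open>S\<close>. Asking for both colours in
  every neighbourhood of a point of \<open>S\<close> expresses the swap without naming sides. Such a
  colouring of a large box is the form in which separation is proved.\<close>

definition crossing_colouring :: "'a::real_normed_vector set \<Rightarrow> 'a set \<Rightarrow> ('a \<Rightarrow> bool) \<Rightarrow> bool" where
  "crossing_colouring S C \<sigma> \<longleftrightarrow>
    (\<forall>x\<in>C - S. \<exists>W. open W \<and> x \<in> W \<and> (\<forall>y\<in>W. \<sigma> y = \<sigma> x)) \<and>
    (\<forall>x\<in>C \<inter> S. \<forall>W. open W \<longrightarrow> x \<in> W \<longrightarrow> (\<exists>y\<in>W - S. \<exists>z\<in>W - S. \<sigma> y \<noteq> \<sigma> z))"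

lemma two_sidedD:
  assumes "two_sided S" "x \<in> S" "e > 0"
  obtains N A B where "open N" "x \<in> N" "N \<subseteq> ball x e" "open A" "open B" "connected A" "connected B"
    "A \<inter> B = {}" "N - S = A \<union> B" "N \<inter> S \<subseteq> closure A \<inter> closure B"
  using assms unfolding two_sided_def by meson

lemma crossing_colouring_subset:
  "crossing_colouring S C \<sigma> \<Longrightarrow> C' \<subseteq> C \<Longrightarrow> crossing_colouring S C' \<sigma>"
  unfolding crossing_colouring_def by blast

lemma crossing_colouringD:
  assumes "crossing_colouring S C \<sigma>" "x \<in> C" "x \<in> S" "open W" "x \<in> W"
  obtains y z where "y \<in> W - S" "z \<in> W - S" "\<sigma> y \<noteq> \<sigma> z"
  using assms unfolding crossing_colouring_def by blast

text \<open>The flip by \<open>c\<close> is built in because gluing replaces a colouring by itself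
  or by its opposite.\<close>

lemma crossing_colouring_cong:
  assumes "open C" "closed S" "crossing_colouring S C \<sigma>" "\<And>y. y \<in> C - S \<Longrightarrow> \<tau> y = (\<sigma> y \<noteq> c)"
  shows "crossing_colouring S C \<tau>"
  unfolding crossing_colouring_def
proof (intro conjI ballI allI impI)
  fix x assume x: "x \<in> C - S"
  then obtain W where W: "open W" "x \<in> W" "\<forall>y\<in>W. \<sigma> y = \<sigma> x"
    using assms(3) unfolding crossing_colouring_def by blast
  have "open (W \<inter> (C - S))" using W(1) assms(1,2) by (intro open_Int open_Diff)
  moreover have "x \<in> W \<inter> (C - S)" using x W(2) by blast
  moreover have "\<forall>y\<in>W \<inter> (C - S). \<tau> y = \<tau> x" using W(3) assms(4) x by auto
  ultimately show "\<exists>W. open W \<and> x \<in> W \<and> (\<forall>y\<in>W. \<tau> y = \<tau> x)" by blast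
next
  fix x W assume x: "x \<in> C \<inter> S" "open W" "x \<in> W"
  have "open (W \<inter> C)" "x \<in> W \<inter> C" using x assms(1) by auto
  then obtain y z where "y \<in> W \<inter> C - S" "z \<in> W \<inter> C - S" "\<sigma> y \<noteq> \<sigma> z"
    using crossing_colouringD[OF assms(3)] x(1) by (metis IntD1 IntD2)
  then show "\<exists>y\<in>W - S. \<exists>z\<in>W - S. \<tau> y \<noteq> \<tau> z"
    using assms(4) by (intro bexI[of _ y] bexI[of _ z]) auto
qed

lemma crossing_colouring_constant:
  assumes "crossing_colouring S C \<sigma>" "connected A" "A \<subseteq> C - S" "x \<in> A" "y \<in> A"
  shows "\<sigma> x = \<sigma> y"
proof -
  have "\<sigma> constant_on A"
  proof (rule locally_constant_imp_constant[OF assms(2)])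
    fix a assume a: "a \<in> A"
    then obtain W where W: "open W" "a \<in> W" "\<forall>y\<in>W. \<sigma> y = \<sigma> a"
      using assms(1,3) unfolding crossing_colouring_def by blast
    show "\<exists>T. openin (top_of_set A) T \<and> a \<in> T \<and> (\<forall>x\<in>T. \<sigma> x = \<sigma> a)"
      by (intro exI[of _ "A \<inter> W"] conjI openin_open_Int W(1)) (use a W(2,3) in blast)+
  qed
  then show ?thesis using assms(4,5) by (auto simp: constant_on_def)
qed

text \<open>Each side is connected and hence of one colour, while both colours occur in
  \<open>N - S\<close>.\<close>

lemma crossing_colouring_sides:
  assumes "crossing_colouring S C \<sigma>" "open N" "N \<subseteq> C" "x \<in> N \<inter> S"
    and "connected A" "connected B" "N - S = A \<union> B"
    and "y \<in> A" "z \<in> B"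
  shows "\<sigma> y \<noteq> \<sigma> z"
proof -
  have AB: "A \<subseteq> C - S" "B \<subseteq> C - S" using assms(3,7) by blast+
  obtain y' z' where yz: "y' \<in> N - S" "z' \<in> N - S" "\<sigma> y' \<noteq> \<sigma> z'"
    by (rule crossing_colouringD[OF assms(1) _ _ assms(2)]) (use assms(3,4) in auto)
  note c = crossing_colouring_constant[OF assms(1)]
  have "y' \<in> A \<union> B" "z' \<in> A \<union> B" using yz assms(7) by auto
  then show ?thesis
    using c[OF assms(5) AB(1)] c[OF assms(6) AB(2)] yz(3) assms(8,9) by (metis UnE)
qed

text \<open>Whether the two colourings agree is locally constant, also at a point of
  \<open>S\<close>: there both change on crossing, so agreement on one side forces agreement on the
  other. Connectedness of \<open>C\<close> leaves a single value \<open>c\<close>.\<close>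

lemma crossing_colouring_unique:
  assumes S: "closed S" "two_sided S" and C: "open C" "connected C"
    and \<sigma>: "crossing_colouring S C \<sigma>" and \<tau>: "crossing_colouring S C \<tau>"
  shows "\<exists>c. \<forall>y\<in>C - S. \<tau> y = (\<sigma> y \<noteq> c)"
proof -
  define P where "P c = \<Union>{W. open W \<and> W \<subseteq> C \<and> (\<forall>y\<in>W - S. \<tau> y = (\<sigma> y \<noteq> c))}" for c
  have oP: "open (P c)" for c unfolding P_def by (rule open_Union) auto
  have "C \<subseteq> P True \<union> P False"
  proof
    fix x assume x: "x \<in> C"
    have "\<exists>W c. open W \<and> x \<in> W \<and> W \<subseteq> C \<and> (\<forall>y\<in>W - S. \<tau> y = (\<sigma> y \<noteq> c))"
    proof (cases "x \<in> S")
      case False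
      obtain W1 where W1: "open W1" "x \<in> W1" "\<forall>y\<in>W1. \<sigma> y = \<sigma> x"
        using \<sigma> x False unfolding crossing_colouring_def by blast
      obtain W2 where W2: "open W2" "x \<in> W2" "\<forall>y\<in>W2. \<tau> y = \<tau> x"
        using \<tau> x False unfolding crossing_colouring_def by blast
      show ?thesis
        by (intro exI[of _ "W1 \<inter> W2 \<inter> C"] exI[of _ "\<tau> x \<noteq> \<sigma> x"] conjI open_Int W1(1) W2(1) C(1))
           (use W1(2,3) W2(2,3) x in blast)+
    next
      case True
      obtain e where e: "e > 0" "ball x e \<subseteq> C" using C(1) x open_contains_ball by blast
      obtain N A B where N: "open N" "x \<in> N" "N \<subseteq> ball x e" "connected A" "connected B"
        "N - S = A \<union> B" "N \<inter> S \<subseteq> closure A \<inter> closure B"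
        by (rule two_sidedD[OF S(2) True e(1)])
      have NC: "N \<subseteq> C" using N(3) e(2) by blast
      have "x \<in> closure A" "x \<in> closure B" using N(2,7) True by auto
      then obtain a b where ab: "a \<in> A" "b \<in> B" by (metis all_not_in_conv closure_empty)
      have AB: "A \<subseteq> C - S" "B \<subseteq> C - S" using NC N(6) by blast+
      have s: "\<sigma> a \<noteq> \<sigma> b" "\<tau> a \<noteq> \<tau> b"
        by (rule crossing_colouring_sides[OF _ N(1) NC _ N(4-6) ab]; use \<sigma> \<tau> True N(2) in blast)+
      have "\<forall>y\<in>N - S. \<tau> y = (\<sigma> y \<noteq> (\<tau> a \<noteq> \<sigma> a))"
      proof
        fix y assume "y \<in> N - S"
        then consider "y \<in> A" | "y \<in> B" using N(6) by blast
        then show "\<tau> y = (\<sigma> y \<noteq> (\<tau> a \<noteq> \<sigma> a))"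
        proof cases
          case 1
          then show ?thesis
            using crossing_colouring_constant[OF \<sigma> N(4) AB(1) ab(1) 1]
              crossing_colouring_constant[OF \<tau> N(4) AB(1) ab(1) 1] by auto
        next
          case 2
          then show ?thesis
            using crossing_colouring_constant[OF \<sigma> N(5) AB(2) ab(2) 2]
              crossing_colouring_constant[OF \<tau> N(5) AB(2) ab(2) 2] s by auto
        qed
      qed
      then show ?thesis using N(1,2) NC by blast
    qed
    then obtain W c where W: "open W" "x \<in> W" "W \<subseteq> C" "\<forall>y\<in>W - S. \<tau> y = (\<sigma> y \<noteq> c)"
      by blast
    then have "x \<in> P c" unfolding P_def by blast
    then show "x \<in> P True \<union> P False" by (cases c) auto
  qed
  \<comment> \<open>A common point would have a neighbourhood contained in \<open>S\<close>, but
    two-sidedness puts points of the complement near every point of \<open>S\<close>.\<close>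
  moreover have "P True \<inter> P False = {}"
  proof (rule ccontr)
    assume "P True \<inter> P False \<noteq> {}"
    then obtain x W1 W2 where W: "open W1" "open W2" "x \<in> W1" "x \<in> W2"
      "\<forall>y\<in>W1 - S. \<tau> y = (\<sigma> y \<noteq> True)" "\<forall>y\<in>W2 - S. \<tau> y = (\<sigma> y \<noteq> False)"
      unfolding P_def by blast
    then have sub: "W1 \<inter> W2 \<subseteq> S" by blast
    obtain e where e: "e > 0" "ball x e \<subseteq> W1 \<inter> W2"
      using W(1-4) open_contains_ball[of "W1 \<inter> W2"] by blast
    have "x \<in> S" using sub W by blast
    obtain N A B where N: "x \<in> N" "N \<subseteq> ball x e" "N - S = A \<union> B"
        "N \<inter> S \<subseteq> closure A \<inter> closure B"
      by (rule two_sidedD[OF S(2) \<open>x \<in> S\<close> e(1)])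
    have "N \<subseteq> S" using N(2) e(2) sub by blast
    then have "A = {}" using N(3) by blast
    then show False using N(1,4) \<open>x \<in> S\<close> by auto
  qed
  ultimately have "P True \<inter> C = {} \<or> P False \<inter> C = {}"
    using connectedD[OF C(2) oP oP] by blast
  then obtain c where c: "C \<subseteq> P c" using \<open>C \<subseteq> P True \<union> P False\<close> by blast
  have "\<tau> y = (\<sigma> y \<noteq> c)" if "y \<in> C - S" for y
    using c that unfolding P_def by blast
  then show ?thesis by blast
qed

text \<open>Connectedness of the overlap makes the discrepancy a single flip, and flipping one of
  the colourings removes it.\<close>

lemma crossing_colouring_Un:
  assumes S: "closed S" "two_sided S" and C: "open C" "open D" "connected (C \<inter> D)"
    and \<sigma>: "crossing_colouring S C \<sigma>" and \<tau>: "crossing_colouring S D \<tau>"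
  shows "\<exists>\<rho>. crossing_colouring S (C \<union> D) \<rho>"
proof -
  obtain c where c: "\<forall>y\<in>(C \<inter> D) - S. \<tau> y = (\<sigma> y \<noteq> c)"
    using crossing_colouring_unique[OF S _ C(3) crossing_colouring_subset[OF \<sigma>]
      crossing_colouring_subset[OF \<tau>]] C(1,2) by blast
  define \<rho> where "\<rho> y = (if y \<in> C then \<sigma> y else \<tau> y \<noteq> c)" for y
  have "crossing_colouring S C \<rho>"
    by (rule crossing_colouring_cong[OF C(1) S(1) \<sigma>, of _ False]) (simp add: \<rho>_def)
  moreover have "crossing_colouring S D \<rho>"
    by (rule crossing_colouring_cong[OF C(2) S(1) \<tau>, of _ c]) (use c in \<open>auto simp: \<rho>_def\<close>)
  ultimately have "crossing_colouring S (C \<union> D) \<rho>" unfolding crossing_colouring_def by blast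
  then show ?thesis by blast
qed

text \<open>Neighbouring boxes of a subdivision share only a face, which is no open overlap. Their
  thickenings are open, and thickenings of convex sets meet in a convex, hence connected,
  set.\<close>

definition thicken :: "real \<Rightarrow> 'a::real_normed_vector set \<Rightarrow> 'a set" where
  "thicken d K = (\<Union>x\<in>K. ball x d)"

lemma open_thicken: "open (thicken d K)" unfolding thicken_def by auto

lemma convex_thicken:
  assumes "convex K" shows "convex (thicken d K)"
proof -
  have "thicken d K = (\<Union>x\<in>K. \<Union>y\<in>ball 0 d. {x + y})"
    by (auto simp: thicken_def dist_norm) (metis add.commute diff_add_cancel mem_ball_0 norm_minus_commute)
  then show ?thesis using convex_sums[OF assms convex_ball[of 0 d]] by simp
qed

lemma thicken_mono: "d \<le> d' \<Longrightarrow> K \<subseteq> K' \<Longrightarrow> thicken d K \<subseteq> thicken d' K'"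
  unfolding thicken_def by fastforce

lemma thicken_Un: "thicken d (K \<union> L) = thicken d K \<union> thicken d L"
  unfolding thicken_def by auto

text \<open>
  Colourings of overlapping convex sets agree up to a global flip on the overlap, so local
  colourings can be glued along a subdivision of a box.
\<close>

lemma crossing_colouring_cbox:
  fixes a b :: "'a::euclidean_space"
  assumes S: "closed S" "two_sided S" and ne: "box a b \<noteq> {}"
  shows "\<exists>d>0. \<exists>\<sigma>. crossing_colouring S (thicken d (cbox a b)) \<sigma>"
proof -
  \<comment> \<open>Boxes with empty interior count as coloured, as \<open>operative\<close> demands
    of degenerate boxes.\<close>
  define g :: "'a set \<Rightarrow> bool" where
    "g K \<longleftrightarrow> interior K = {} \<or> (\<exists>d>0. \<exists>\<sigma>. crossing_colouring S (thicken d K) \<sigma>)" for K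
  have mono: "g K" if "g L" "K \<subseteq> L" for K L
    using that crossing_colouring_subset[OF _ thicken_mono[OF order_refl that(2)]] interior_mono[OF that(2)]
    unfolding g_def by blast
  have glue: "g K" if K: "K = cbox a b" and k: "k \<in> Basis"
    and l: "g (K \<inter> {x. x \<bullet> k \<le> c})" and r: "g (K \<inter> {x. x \<bullet> k \<ge> c})" for K a b k c
  proof (cases "box a b = {}")
    case True
    then show ?thesis by (simp add: g_def K)
  next
    case False
    have cl: "closure (box a b) = K" using False K closure_box by blast
    let ?l = "K \<inter> {x. x \<bullet> k \<le> c}" and ?r = "K \<inter> {x. x \<bullet> k \<ge> c}"
    consider "interior ?l = {}" | "interior ?r = {}"
      | d e \<sigma> \<tau> where "d > 0" "e > 0" "crossing_colouring S (thicken d ?l) \<sigma>" "crossing_colouring S (thicken e ?r) \<tau>"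
      using l r unfolding g_def by blast
    then show ?thesis
    proof cases
      \<comment> \<open>A half with empty interior means that the cut misses the open box, so the
        other half is all of \<open>K\<close>.\<close>
      case 1
      have "box a b \<inter> {x. x \<bullet> k < c} \<subseteq> interior ?l"
        by (rule interior_maximal)
           (auto simp: K inner_commute[of _ k] intro!: open_Int open_halfspace_lt subsetD[OF box_subset_cbox])
      then have "box a b \<subseteq> {x. x \<bullet> k \<ge> c}" using 1 by fastforce
      moreover have "closed {x. x \<bullet> k \<ge> c}"
        using closed_halfspace_ge[of c k] by (simp add: inner_commute)
      ultimately have "K \<subseteq> {x. x \<bullet> k \<ge> c}" using closure_minimal cl by blast
      then show ?thesis using r by (simp add: Int_absorb2)
    next
      case 2
      have "box a b \<inter> {x. x \<bullet> k > c} \<subseteq> interior ?r"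
        by (rule interior_maximal)
           (auto simp: K inner_commute[of _ k] intro!: open_Int open_halfspace_gt subsetD[OF box_subset_cbox])
      then have "box a b \<subseteq> {x. x \<bullet> k \<le> c}" using 2 by fastforce
      moreover have "closed {x. x \<bullet> k \<le> c}"
        using closed_halfspace_le[of k c] by (simp add: inner_commute)
      ultimately have "K \<subseteq> {x. x \<bullet> k \<le> c}" using closure_minimal cl by blast
      then show ?thesis using l by (simp add: Int_absorb2)
    next
      case 3
      define m where "m = min d e"
      have m: "m > 0" "crossing_colouring S (thicken m ?l) \<sigma>" "crossing_colouring S (thicken m ?r) \<tau>"
        using 3(1,2) crossing_colouring_subset[OF 3(3) thicken_mono[of m d]]
          crossing_colouring_subset[OF 3(4) thicken_mono[of m e]] by (auto simp: m_def)
      have "convex {x. x \<bullet> k \<le> c}" "convex {x. x \<bullet> k \<ge> c}"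
        using convex_halfspace_le[of k c] convex_halfspace_ge[of c k] by (simp_all add: inner_commute)
      then have "convex (thicken m ?l \<inter> thicken m ?r)"
        unfolding K by (intro convex_Int convex_thicken convex_box)
      then have "\<exists>\<rho>. crossing_colouring S (thicken m ?l \<union> thicken m ?r) \<rho>"
        by (intro crossing_colouring_Un[OF S open_thicken open_thicken _ m(2,3)] convex_connected)
      moreover have "thicken m ?l \<union> thicken m ?r = thicken m K"
        unfolding thicken_Un[symmetric] by (rule arg_cong[where f="thicken m"]) auto
      ultimately show ?thesis using m(1) by (auto simp: g_def)
    qed
  qed

  \<comment> \<open>With conjunction as the operation, additivity under a single hyperplane cut is
    what \<open>tagged_division\<close> extends to every division of the box.\<close>
  interpret operative "(\<and>)" True g
  proof -
    interpret comm_monoid_set "(\<and>)" True by (rule comm_monoid_set_and)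
    show "operative (\<and>) True g"
    proof
      show "g (cbox a b) = True" if "box a b = {}" for a b using that by (simp add: g_def)
      show "g (cbox a b) = (g (cbox a b \<inter> {x. x \<bullet> k \<le> c}) \<and> g (cbox a b \<inter> {x. c \<le> x \<bullet> k}))"
        if "k \<in> Basis" for a b c k
        using glue[OF refl that] mono[of "cbox a b"] by blast
    qed
  qed
  have F_iff: "F f d \<longleftrightarrow> (\<forall>x\<in>d. f x)" if "finite d" for f and d :: "'x set"
    using that by (induction d) auto
  have loc: "\<exists>e>0. \<exists>\<sigma>. crossing_colouring S (ball x e) \<sigma>" for x
  proof (cases "x \<in> S")
    case False
    then obtain e where e: "e > 0" "ball x e \<subseteq> - S"
      using S(1) open_contains_ball[of "- S"] by (auto simp: closed_def)
    then have "crossing_colouring S (ball x e) (\<lambda>_. True)" unfolding crossing_colouring_def by blast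
    then show ?thesis using e(1) by blast
  next
    case True
    obtain N A B where N: "open N" "x \<in> N" "open A" "open B" "A \<inter> B = {}"
        "N - S = A \<union> B" "N \<inter> S \<subseteq> closure A \<inter> closure B"
      by (rule two_sidedD[OF S(2) True zero_less_one])
    have "crossing_colouring S N (\<lambda>x. x \<in> A)"
      unfolding crossing_colouring_def
    proof (intro conjI ballI allI impI)
      fix y assume "y \<in> N - S"
      then have "y \<in> A \<or> y \<in> B" using N(6) by blast
      then show "\<exists>W. open W \<and> y \<in> W \<and> (\<forall>z\<in>W. (z \<in> A) = (y \<in> A))" using N(3-5) by blast
    next
      fix y W assume y: "y \<in> N \<inter> S" "open W" "y \<in> W"
      then have "y \<in> closure A" "y \<in> closure B" using N(7) by auto
      then have "A \<inter> W \<noteq> {}" "B \<inter> W \<noteq> {}"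
        using open_Int_closure_eq_empty[OF y(2)] y(3) by blast+
      then show "\<exists>y\<in>W - S. \<exists>z\<in>W - S. (y \<in> A) \<noteq> (z \<in> A)" using N(5,6) by blast
    qed
    moreover obtain e where "e > 0" "ball x e \<subseteq> N" using N(1,2) open_contains_ball by blast
    ultimately show ?thesis using crossing_colouring_subset by blast
  qed
  then obtain E where E: "\<And>x. E x > 0" "\<And>x. \<exists>\<sigma>. crossing_colouring S (ball x (E x)) \<sigma>" by metis
  \<comment> \<open>Half the radius: a piece inside \<open>ball x (E x / 2)\<close>, thickened by
    \<open>E x / 2\<close>, still lies in the ball that carries a colouring.\<close>
  have "gauge (\<lambda>x. ball x (E x / 2))" using E(1) by (simp add: gauge_def)
  then obtain p where p: "p tagged_division_of cbox a b" "(\<lambda>x. ball x (E x / 2)) fine p"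
    by (rule fine_division_exists)
  have "g K" if "(x, K) \<in> p" for x K
  proof -
    have "K \<subseteq> ball x (E x / 2)" using p(2) that by (auto simp: fine_def)
    then have "thicken (E x / 2) K \<subseteq> ball x (E x)"
    proof (intro subsetI)
      fix z assume "z \<in> thicken (E x / 2) K"
      then obtain y where "y \<in> K" "dist y z < E x / 2" by (auto simp: thicken_def)
      then show "z \<in> ball x (E x)"
        using \<open>K \<subseteq> ball x (E x / 2)\<close> dist_triangle[of x z y] by fastforce
    qed
    moreover obtain \<sigma> where "crossing_colouring S (ball x (E x)) \<sigma>" using E(2) by blast
    ultimately have "crossing_colouring S (thicken (E x / 2) K) \<sigma>"
      using crossing_colouring_subset by blast
    then show ?thesis using half_gt_zero[OF E(1)[of x]] unfolding g_def by blast
  qed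
  then have "g (cbox a b)"
    using tagged_division[OF p(1)] F_iff[OF tagged_division_of_finite[OF p(1)], of "\<lambda>(x, l). g l"] by auto
  then show ?thesis using ne by (simp add: g_def)
qed

text \<open>Colour a box around \<open>G\<close> and \<open>N\<close>: \<open>G\<close> is connected
  and avoids \<open>S\<close>, hence has one colour, whereas the two sides of \<open>N\<close> have
  different colours.\<close>

lemma connected_one_sided:
  fixes S :: "'a::euclidean_space set"
  assumes S: "compact S" "two_sided S" and G: "connected G" "G \<inter> S = {}" "bounded G"
    and N: "open N" "x \<in> N \<inter> S" "connected A" "connected B" "bounded N"
      "N - S = A \<union> B"
  shows "A \<inter> G = {} \<or> B \<inter> G = {}"
proof (rule ccontr)
  assume "\<not> ?thesis"
  then obtain y z where yz: "y \<in> A" "z \<in> B" "y \<in> G" "z \<in> G" by blast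
  have "bounded (G \<union> N)" using G(3) N(5) by simp
  then obtain a where a: "G \<union> N \<subseteq> box (- a) a" using bounded_subset_box_symmetric by blast
  then have "box (- a) a \<noteq> {}" using N(2) by blast
  from crossing_colouring_cbox[OF compact_imp_closed[OF S(1)] S(2) this]
  obtain d \<sigma> where d: "d > 0" "crossing_colouring S (thicken d (cbox (- a) a)) \<sigma>" by blast
  have "cbox (- a) a \<subseteq> thicken d (cbox (- a) a)" using d(1) by (force simp: thicken_def)
  then have sub: "G \<union> N \<subseteq> thicken d (cbox (- a) a)" using a box_subset_cbox by blast
  have "\<sigma> y = \<sigma> z"
    by (rule crossing_colouring_constant[OF d(2) G(1)]) (use sub G(2) yz in auto)
  moreover have "\<sigma> y \<noteq> \<sigma> z"
    by (rule crossing_colouring_sides[OF d(2) N(1) _ N(2-4,6)]) (use sub yz in auto)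
  ultimately show False by blast
qed

section \<open>Hypersurfaces as graphs\<close>

text \<open>\<open>T\<close> is the Householder reflection in the hyperplane orthogonal to a - b, or
  the identity if a = b.\<close>

lemma orthogonal_transformation_exists_unit:
  fixes a b :: "'a::real_inner"
  assumes "norm a = norm b"
  shows "\<exists>T. orthogonal_transformation T \<and> T a = b"
proof (cases "a = b")
  case True
  then show ?thesis by (intro exI[of _ "\<lambda>x. x"]) simp
next
  case False
  define c where "c = a - b"
  define T where "T x = x - (2 * (x \<bullet> c) / (c \<bullet> c)) *\<^sub>R c" for x
  have c: "c \<bullet> c \<noteq> 0" using False by (simp add: c_def)
  have "a \<bullet> a = b \<bullet> b" using assms by (simp add: dot_square_norm)
  then have ac: "2 * (a \<bullet> c) = c \<bullet> c" by (simp add: c_def inner_diff inner_commute)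
  have "linear T"
  proof (rule linearI)
    show "T (x + y) = T x + T y" for x y
      by (simp add: T_def inner_add_left distrib_left add_divide_distrib scaleR_left_distrib)
    show "T (k *\<^sub>R x) = k *\<^sub>R T x" for k x
      by (simp add: T_def scaleR_diff_right mult.left_commute)
  qed
  moreover have "T x \<bullet> T y = x \<bullet> y" for x y
  proof -
    have cy: "c \<bullet> y = y \<bullet> c" by (rule inner_commute)
    have "T x \<bullet> T y = x \<bullet> y - 2 * (y \<bullet> c) / (c \<bullet> c) * (x \<bullet> c) -
        2 * (x \<bullet> c) / (c \<bullet> c) * (y \<bullet> c - 2 * (y \<bullet> c) / (c \<bullet> c) * (c \<bullet> c))"
      unfolding T_def inner_diff_left inner_diff_right inner_scaleR_left inner_scaleR_right cy by argo
    then show ?thesis using c by simp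
  qed
  moreover have "T a = b" using c by (simp add: T_def ac) (simp add: c_def)
  ultimately show ?thesis by (auto simp: orthogonal_transformation_def)
qed

text \<open>The lower bound \<open>m\<close> for \<open>A y0\<close> absorbs a perturbation of norm
  below m/2, which gives |x - x0| <= (2/m) |A y - A y0| |x0|. Needed because the inverse function
  theorem presents the derivative of the inverse as a pointwise \<open>inv\<close>.\<close>

lemma continuous_on_inv_blinfun:
  fixes A :: "'c::topological_space \<Rightarrow> ('a::euclidean_space \<Rightarrow>\<^sub>L 'a)"
  assumes A: "continuous_on V A" and bij: "\<And>y. y \<in> V \<Longrightarrow> bij (blinfun_apply (A y))"
  shows "continuous_on V (\<lambda>y. inv (blinfun_apply (A y)) b)"
  unfolding continuous_on_def
proof
  fix y0 assume y0: "y0 \<in> V"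
  define x0 where "x0 = inv (blinfun_apply (A y0)) b"
  have x0: "A y0 x0 = b" unfolding x0_def using bij[OF y0] by (simp add: bij_is_surj surj_f_inv_f)
  obtain m where m: "m > 0" "\<And>x. m * norm x \<le> norm (A y0 x)"
    using linear_inj_bounded_below_pos[of "blinfun_apply (A y0)"] bij[OF y0]
    by (metis bij_is_inj blinfun.bounded_linear_right bounded_linear.linear mult.commute)
  have lim: "((\<lambda>y. norm (A y - A y0)) \<longlongrightarrow> 0) (at y0 within V)"
    using A y0 by (auto simp: continuous_on_def intro!: tendsto_eq_intros)
  have ev: "\<forall>\<^sub>F y in at y0 within V. norm (inv (blinfun_apply (A y)) b - x0) \<le> 2 / m * norm (A y - A y0) * norm x0"
  proof -
    have "\<forall>\<^sub>F y in at y0 within V. norm (A y - A y0) < m / 2"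
      using order_tendstoD(2)[OF lim, of "m / 2"] m(1) by simp
    moreover have "\<forall>\<^sub>F y in at y0 within V. y \<in> V" by (simp add: eventually_at_filter)
    ultimately show ?thesis
    proof eventually_elim
      case (elim y)
      define x where "x = inv (blinfun_apply (A y)) b"
      have x: "A y x = b" unfolding x_def using bij[OF elim(2)] by (simp add: bij_is_surj surj_f_inv_f)
      have "A y0 (x - x0) = (A y0 - A y) (x - x0) + (A y0 - A y) x0"
        using x x0 by (simp add: blinfun.diff_left blinfun.diff_right)
      then have "norm (A y0 (x - x0)) \<le> norm ((A y0 - A y) (x - x0)) + norm ((A y0 - A y) x0)"
        by (simp add: norm_triangle_ineq)
      also have "\<dots> \<le> norm (A y0 - A y) * norm (x - x0) + norm (A y0 - A y) * norm x0"
        by (intro add_mono norm_blinfun)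
      also have "\<dots> \<le> m / 2 * norm (x - x0) + norm (A y - A y0) * norm x0"
        using elim(1) by (intro add_mono mult_right_mono) (auto simp: norm_minus_commute)
      finally have "m * norm (x - x0) \<le> m / 2 * norm (x - x0) + norm (A y - A y0) * norm x0"
        using m(2)[of "x - x0"] by linarith
      then have "m / 2 * norm (x - x0) \<le> norm (A y - A y0) * norm x0" by linarith
      then have "norm (x - x0) \<le> 2 / m * (norm (A y - A y0) * norm x0)"
        using m(1) by (simp add: field_simps)
      then show ?case by (simp add: x_def mult.assoc)
    qed
  qed
  have "((\<lambda>y. 2 / m * norm (A y - A y0) * norm x0) \<longlongrightarrow> 0) (at y0 within V)"
    by (intro tendsto_mult_left_zero tendsto_mult_right_zero lim)
  then have "((\<lambda>y. inv (blinfun_apply (A y)) b - x0) \<longlongrightarrow> 0) (at y0 within V)"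
    by (rule Lim_null_comparison[OF ev])
  then show "((\<lambda>y. inv (blinfun_apply (A y)) b) \<longlongrightarrow> inv (blinfun_apply (A y0)) b) (at y0 within V)"
    unfolding x0_def by (simp add: LIM_zero_iff)
qed

text \<open>\<open>T\<close> turns space so that near \<open>p\<close> the surface is a graph over
  the last three coordinates; orthogonality preserves distances, areas, normals and Lebesgue
  measure. \<open>dh\<close> is the gradient as a vector. The bounds belong to the chart because
  integration below the graph uses them on the whole base ball.\<close>

locale graph_chart =
  fixes S :: "quat set" and p :: quat and T :: "quat \<Rightarrow> quat"
    and h :: "real^3 \<Rightarrow> real" and dh :: "real^3 \<Rightarrow> real^3" and r :: real
  assumes r_pos: "0 < r" and T: "orthogonal_transformation T" and p_in: "p \<in> S"
    and h: "\<And>u. u \<in> ball (snd (T p)) r \<Longrightarrow> (h has_derivative (\<lambda>v. dh u \<bullet> v)) (at u)"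
    and dh: "continuous_on (ball (snd (T p)) r) dh"
    and bounded_h: "bounded (h ` ball (snd (T p)) r)"
    and bounded_dh: "bounded (dh ` ball (snd (T p)) r)"
    and graph: "\<And>x. x \<in> ball p r \<Longrightarrow> x \<in> S \<longleftrightarrow> fst (T x) = h (snd (T x))"
begin

lemma linear_T: "linear T" using T by (rule orthogonal_transformation_linear)

lemma bounded_linear_T: "bounded_linear T" using linear_T by (rule linear_conv_bounded_linear[THEN iffD1])

lemma norm_T [simp]: "norm (T x) = norm x" by (rule orthogonal_transformation_norm[OF T])

lemma dist_T [simp]: "dist (T x) (T y) = dist x y"
  using linear_diff[OF linear_T, of x y, symmetric] by (simp add: dist_norm)

lemma T_inv [simp]: "T (inv T y) = y"
  by (rule surj_f_inv_f[OF orthogonal_transformation_surj[OF T]])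

lemma inv_T [simp]: "inv T (T x) = x"
  by (rule inv_f_f[OF orthogonal_transformation_inj[OF T]])

lemma orthogonal_inv_T: "orthogonal_transformation (inv T)"
  by (rule orthogonal_transformation_inv[OF T])

lemma bounded_linear_inv_T: "bounded_linear (inv T)"
  using orthogonal_transformation_linear[OF orthogonal_inv_T] by (rule linear_conv_bounded_linear[THEN iffD1])

lemma inner_inv_T: "inv T x \<bullet> inv T y = x \<bullet> y"
  using orthogonal_inv_T unfolding orthogonal_transformation_def by blast

lemma dist_inv_T [simp]: "dist (inv T x) (inv T y) = dist x y"
  using dist_T[of "inv T x" "inv T y"] by simp

lemma continuous_on_T [continuous_intros]: "continuous_on A f \<Longrightarrow> continuous_on A (\<lambda>x. T (f x))"
  by (rule bounded_linear.continuous_on[OF bounded_linear_T])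

lemma continuous_on_inv_T [continuous_intros]: "continuous_on A f \<Longrightarrow> continuous_on A (\<lambda>x. inv T (f x))"
  by (rule bounded_linear.continuous_on[OF bounded_linear_inv_T])

lemma snd_T_in_ball: "x \<in> ball q e \<Longrightarrow> snd (T x) \<in> ball (snd (T q)) e"
  using dist_snd_le[of "T q" "T x"] by simp

lemma continuous_on_h: "continuous_on (ball (snd (T p)) r) h"
  using has_derivative_continuous[OF h] by (auto intro: continuous_at_imp_continuous_on)

text \<open>The same rotation and function serve at every nearby point of the surface, so a fact
  proved at the centre of a chart transfers to all of them.\<close>

lemma chart_at:
  assumes "q \<in> S" "0 < r'" "dist p q + r' \<le> r"
  shows "graph_chart S q T h dh r'"
proof -
  have b: "ball (snd (T q)) r' \<subseteq> ball (snd (T p)) r"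
  proof
    fix u assume "u \<in> ball (snd (T q)) r'"
    then show "u \<in> ball (snd (T p)) r"
      using dist_triangle[of "snd (T p)" u "snd (T q)"] dist_snd_le[of "T p" "T q"] assms(3) by auto
  qed
  have c: "ball q r' \<subseteq> ball p r"
  proof
    fix u assume "u \<in> ball q r'"
    then show "u \<in> ball p r" using dist_triangle[of p u q] assms(3) by auto
  qed
  show ?thesis
    using assms T h dh graph b c bounded_h bounded_dh
    by (intro graph_chart.intro) (auto intro: continuous_on_subset bounded_subset[OF _ image_mono])
qed

text \<open>Reversing the vertical axis exchanges the two sides; it lets the domain always be placed
  below its boundary.\<close>

lemma chart_flip: "graph_chart S p (\<lambda>x. (- fst (T x), snd (T x))) (\<lambda>u. - h u) (\<lambda>u. - dh u) r"
proof (rule graph_chart.intro)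
  have l: "linear (\<lambda>x. (- fst (T x), snd (T x)))"
    using linear_add[OF linear_T] linear_scale[OF linear_T] by (intro linearI) auto
  have "T x \<bullet> T y = x \<bullet> y" for x y using T unfolding orthogonal_transformation_def by blast
  then show "orthogonal_transformation (\<lambda>x. (- fst (T x), snd (T x)))"
    using l by (auto simp: orthogonal_transformation_def inner_prod_def)
  show "bounded ((\<lambda>u. - h u) ` ball (snd (- fst (T p), snd (T p))) r)"
    using bounded_h by (auto simp: bounded_iff)
  show "bounded ((\<lambda>u. - dh u) ` ball (snd (- fst (T p), snd (T p))) r)"
    using bounded_dh by (auto simp: bounded_iff)
qed (use r_pos p_in h dh graph in \<open>auto intro!: derivative_eq_intros continuous_intros\<close>)

end

text \<open>The implicit function theorem by way of the inverse function theorem: \<open>T\<close>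
  makes the normal at \<open>X u0\<close> vertical, so the horizontal part of
  \<open>T \<circ> X\<close> is locally invertible, and \<open>h\<close> is the vertical part
  composed with that inverse.\<close>

lemma graph_chart_exists:
  assumes lp: "local_parametrization S D X" and u0: "u0 \<in> D"
  shows "\<exists>T h dh r. graph_chart S (X u0) T h dh r"
proof -
  have D: "open D" and opX: "openin (top_of_set S) (X ` D)" and "\<exists>Y. homeomorphism D (X ` D) X Y"
    and C1: "C1_on D X" and inj: "\<And>u. u \<in> D \<Longrightarrow> inj (frechet_derivative X (at u))"
    using lp by (auto simp: local_parametrization_def)
  then obtain Y where Y: "homeomorphism D (X ` D) X Y" by blast
  obtain DX :: "real^3 \<Rightarrow> ((real^3) \<Rightarrow>\<^sub>L quat)"
    where DX: "\<And>u. u \<in> D \<Longrightarrow> (X has_derivative DX u) (at u)" and cDX: "continuous_on D DX"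
    using C1 unfolding C1_on_def by blast
  have injDX: "inj (blinfun_apply (DX u))" if "u \<in> D" for u
    using inj[OF that] frechet_derivative_at[OF DX[OF that]] by simp
  have "dim (range (DX u0)) < DIM(quat)"
  proof -
    have "dim (range (DX u0)) \<le> dim (UNIV :: (real^3) set)"
      by (intro dim_image_le bounded_linear.linear blinfun.bounded_linear_right)
    then show ?thesis by (simp add: dim_UNIV)
  qed
  then obtain n' where n': "n' \<noteq> 0" "\<And>y. y \<in> span (range (DX u0)) \<Longrightarrow> orthogonal n' y"
    using orthogonal_to_subspace_exists by blast
  define n where "n = n' /\<^sub>R norm n'"
  have nn: "norm n = norm ((1, 0) :: quat)" using n'(1) by (simp add: n_def)
  have no: "n \<bullet> DX u0 v = 0" for v
    using n'(2)[of "DX u0 v"] by (simp add: n_def orthogonal_def span_base)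
  obtain T :: "quat \<Rightarrow> quat" where T: "orthogonal_transformation T" "T n = (1, 0)"
    using orthogonal_transformation_exists_unit[OF nn] by blast
  have linT: "bounded_linear T"
    using orthogonal_transformation_linear[OF T(1)] by (rule linear_conv_bounded_linear[THEN iffD1])
  have inv_T: "inv T (T y) = y" for y by (rule inv_f_f[OF orthogonal_transformation_inj[OF T(1)]])
  have bl: "bounded_linear (\<lambda>x. snd (T x))" "bounded_linear (\<lambda>x. fst (T x))"
    by (intro bounded_linear_compose[OF bounded_linear_snd linT] bounded_linear_compose[OF bounded_linear_fst linT])+
  define \<phi> where "\<phi> u = snd (T (X u))" for u
  define \<phi>' where "\<phi>' u = Blinfun (\<lambda>x. snd (T x)) o\<^sub>L DX u" for u
  have \<phi>'_apply: "\<phi>' u v = snd (T (DX u v))" for u v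
    by (simp add: \<phi>'_def bounded_linear_Blinfun_apply[OF bl(1)])
  have d\<phi>: "(\<phi> has_derivative \<phi>' u) (at u)" if "u \<in> D" for u
    unfolding \<phi>_def \<phi>'_apply[abs_def] by (rule bounded_linear.has_derivative[OF bl(1) DX[OF that]])
  have c\<phi>': "continuous_on D \<phi>'"
    unfolding \<phi>'_def by (intro continuous_intros bounded_bilinear.continuous_on[OF bounded_bilinear_blinfun_compose] cDX)
  \<comment> \<open>A tangent vector without horizontal part is vertical after the rotation; being
    orthogonal to \<open>n\<close>, it is 0.\<close>
  have "inj (blinfun_apply (\<phi>' u0))"
  proof (rule linear_injective_0[THEN iffD2, rule_format])
    show "linear (blinfun_apply (\<phi>' u0))" by (intro bounded_linear.linear blinfun.bounded_linear_right)
    fix v assume "\<phi>' u0 v = 0"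
    then have s: "snd (T (DX u0 v)) = 0" by (simp add: \<phi>'_apply)
    have "fst (T (DX u0 v)) = T n \<bullet> T (DX u0 v)" by (simp add: T(2) inner_prod_def)
    also have "\<dots> = 0" using T(1) no[of v] unfolding orthogonal_transformation_def by metis
    finally have "T (DX u0 v) = T 0"
      using s linear_0[OF bounded_linear.linear[OF linT]] by (simp add: prod_eq_iff)
    then have "DX u0 v = DX u0 0"
      using orthogonal_transformation_inj[OF T(1)] by (simp add: inj_eq)
    then show "v = 0" using injDX[OF u0] by (rule injD[rotated])
  qed
  then obtain g where g: "linear g" "g \<circ> blinfun_apply (\<phi>' u0) = id"
    using linear_injective_left_inverse[OF bounded_linear.linear[OF blinfun.bounded_linear_right[of "\<phi>' u0"]]]
    by blast
  have gb: "bounded_linear g" using g(1) by (rule linear_conv_bounded_linear[THEN iffD1])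
  have "Blinfun g o\<^sub>L \<phi>' u0 = id_blinfun"
    using g(2) by (intro blinfun_eqI) (simp add: bounded_linear_Blinfun_apply[OF gb] fun_eq_iff)
  note ift = inverse_function_theorem[where f=\<phi> and f'=\<phi>', OF D _ c\<phi>' u0 this]
  obtain U V \<psi> \<psi>' where U: "open U" "U \<subseteq> D" "u0 \<in> U" and V: "open V" "\<phi> u0 \<in> V"
    and hom: "homeomorphism U V \<phi> \<psi>"
    and d\<psi>: "\<And>y. y \<in> V \<Longrightarrow> (\<psi> has_derivative \<psi>' y) (at y)"
    and \<psi>': "\<And>y. y \<in> V \<Longrightarrow> \<psi>' y = inv (blinfun_apply (\<phi>' (\<psi> y)))"
    and bij: "\<And>y. y \<in> V \<Longrightarrow> bij (blinfun_apply (\<phi>' (\<psi> y)))"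
    by (rule ift, erule d\<phi>) (rule that)
  have \<psi>U: "\<psi> y \<in> U" if "y \<in> V" for y using hom that by (auto simp: homeomorphism_def)
  have c\<psi>: "continuous_on V \<psi>" using hom by (auto simp: homeomorphism_def)
  have cDX\<psi>: "continuous_on V (\<lambda>y. DX (\<psi> y))"
    by (rule continuous_on_compose2[OF cDX c\<psi>]) (use \<psi>U U(2) in auto)
  have c\<psi>': "continuous_on V (\<lambda>y. \<psi>' y b)" for b
  proof -
    have "continuous_on V (\<lambda>y. inv (blinfun_apply (\<phi>' (\<psi> y))) b)"
      by (rule continuous_on_inv_blinfun[OF continuous_on_compose2[OF c\<phi>' c\<psi>] bij]) (use \<psi>U U(2) in auto)
    then show ?thesis by (rule continuous_on_eq) (simp add: \<psi>')
  qed
  define h where "h y = fst (T (X (\<psi> y)))" for y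
  define h' where "h' y v = fst (T (DX (\<psi> y) (\<psi>' y v)))" for y v
  define dh where "dh y = (\<Sum>b\<in>Basis. h' y b *\<^sub>R b)" for y
  have h: "(h has_derivative h' y) (at y)" if "y \<in> V" for y
    unfolding h_def h'_def
    by (rule bounded_linear.has_derivative[OF bl(2) has_derivative_compose[OF d\<psi>[OF that] DX]])
       (use \<psi>U that U(2) in auto)
  have dh: "h' y = (\<lambda>v. dh y \<bullet> v)" if "y \<in> V" for y
  proof
    fix v
    have "h' y v = h' y (\<Sum>b\<in>Basis. (v \<bullet> b) *\<^sub>R b)" by (simp add: euclidean_representation)
    also have "\<dots> = (\<Sum>b\<in>Basis. (v \<bullet> b) * h' y b)"
      using has_derivative_linear[OF h[OF that]] by (simp add: linear_sum linear_scale)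
    also have "\<dots> = dh y \<bullet> v"
      by (simp add: dh_def inner_sum_left inner_commute[of v] mult.commute)
    finally show "h' y v = dh y \<bullet> v" .
  qed
  have cdh: "continuous_on V dh"
    unfolding dh_def h'_def
    by (intro continuous_intros bounded_linear.continuous_on[OF bl(2)]
        bounded_bilinear.continuous_on[OF bounded_bilinear_blinfun_apply] cDX\<psi> c\<psi>')
  \<comment> \<open>Openness of the image of \<open>U\<close> in \<open>S\<close> excludes further
    sheets of \<open>S\<close> near \<open>X u0\<close>: it yields a ball in which \<open>S\<close>
    is exactly the graph.\<close>
  have "openin (top_of_set (X ` D)) (X ` U)"
    using homeomorphism_imp_open_map[OF Y] U(1,2) by (simp add: open_openin_trans open_subset)
  then have "openin (top_of_set S) (X ` U)" using opX openin_trans by blast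
  then obtain Ob where Ob: "open Ob" "X ` U = S \<inter> Ob" by (auto simp: openin_open)
  have "X u0 \<in> Ob" using Ob(2) U(3) by blast
  then obtain r1 where r1: "r1 > 0" "ball (X u0) r1 \<subseteq> Ob" using Ob(1) open_contains_ball by blast
  \<comment> \<open>A closed ball, so that compactness gives the bounds on \<open>h\<close> and
    \<open>dh\<close>.\<close>
  obtain r2 where r2: "r2 > 0" "cball (snd (T (X u0))) r2 \<subseteq> V"
    using V open_contains_cball by (metis \<phi>_def)
  define r where "r = min r1 r2"
  have rV: "cball (snd (T (X u0))) r \<subseteq> V" using r2(2) by (auto simp: r_def)
  have bdd: "bounded (k ` ball (snd (T (X u0))) r)" if "continuous_on V k" for k :: "real^3 \<Rightarrow> 'z::metric_space"
  proof -
    have "compact (k ` cball (snd (T (X u0))) r)"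
      by (intro compact_continuous_image continuous_on_subset[OF that rV]) auto
    then show ?thesis by (rule bounded_subset[OF compact_imp_bounded]) auto
  qed
  have ch: "continuous_on V h"
    using has_derivative_continuous[OF h] by (auto intro: continuous_at_imp_continuous_on)
  have bV: "ball (snd (T (X u0))) r \<subseteq> V" using rV by auto
  have "graph_chart S (X u0) T h dh r"
  proof (rule graph_chart.intro)
    show "0 < r" using r1 r2 by (simp add: r_def)
    show "X u0 \<in> S" using Ob(2) U(3) by blast
    show "(h has_derivative (\<lambda>v. dh u \<bullet> v)) (at u)" if "u \<in> ball (snd (T (X u0))) r" for u
      using h[of u] dh[of u] that bV by auto
    show "continuous_on (ball (snd (T (X u0))) r) dh" by (rule continuous_on_subset[OF cdh bV])
    fix x assume x: "x \<in> ball (X u0) r"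
    have "dist (snd (T (X u0))) (snd (T x)) \<le> dist (T (X u0)) (T x)" by (rule dist_snd_le)
    also have "\<dots> = dist (X u0) x"
      using linear_diff[OF bounded_linear.linear[OF linT], of "X u0" x, symmetric]
      by (simp add: dist_norm orthogonal_transformation_norm[OF T(1)])
    finally have xV: "snd (T x) \<in> V" using x bV by auto
    show "x \<in> S \<longleftrightarrow> fst (T x) = h (snd (T x))"
    proof
      assume "x \<in> S"
      moreover have "x \<in> Ob" using x r1(2) by (auto simp: r_def)
      ultimately obtain u where u: "u \<in> U" "x = X u" using Ob(2) by blast
      then have "\<psi> (snd (T x)) = u" using hom by (auto simp: homeomorphism_def \<phi>_def)
      then show "fst (T x) = h (snd (T x))" by (simp add: h_def u)
    next
      assume *: "fst (T x) = h (snd (T x))"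
      let ?u = "\<psi> (snd (T x))"
      have "\<phi> ?u = snd (T x)" using hom xV by (auto simp: homeomorphism_def)
      then have "T (X ?u) = T x" using * by (simp add: prod_eq_iff \<phi>_def h_def)
      then have "x = X ?u" using inv_T by metis
      then show "x \<in> S" using Ob(2) \<psi>U[OF xV] by blast
    qed
  qed (use T(1) bdd[OF ch] bdd[OF cdh] in auto)
  then show ?thesis by blast
qed

text \<open>The region is the image of (0,1) x Q under affine interpolation between the two graphs
  in each fibre.\<close>

lemma connected_between_graphs:
  fixes l m :: "'a::real_normed_vector \<Rightarrow> real"
  assumes "connected Q" "continuous_on Q l" "continuous_on Q m" "\<And>u. u \<in> Q \<Longrightarrow> l u < m u"
  shows "connected {y. snd y \<in> Q \<and> l (snd y) < fst y \<and> fst y < m (snd y)}"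
proof -
  have l: "continuous_on ({0<..<1::real} \<times> Q) (\<lambda>y. l (snd y))" and m: "continuous_on ({0<..<1::real} \<times> Q) (\<lambda>y. m (snd y))"
    by (rule continuous_on_compose2[OF assms(2)] continuous_on_compose2[OF assms(3)];
        auto intro!: continuous_intros)+
  let ?F = "\<lambda>y. (l (snd y) + fst y * (m (snd y) - l (snd y)), snd y)"
  have "connected (?F ` ({0<..<1::real} \<times> Q))"
    by (intro connected_continuous_image connected_Times assms(1) continuous_intros l m) auto
  moreover have "?F ` ({0<..<1::real} \<times> Q) = {y. snd y \<in> Q \<and> l (snd y) < fst y \<and> fst y < m (snd y)}"
  proof (intro equalityI subsetI)
    fix y assume "y \<in> ?F ` ({0<..<1::real} \<times> Q)"
    then obtain t u where y: "y = (l u + t * (m u - l u), u)" "0 < t" "t < 1" "u \<in> Q" by force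
    have "0 < t * (m u - l u)" "t * (m u - l u) < 1 * (m u - l u)"
      using y(2-3) assms(4)[OF y(4)] by (auto intro!: mult_strict_right_mono)
    then show "y \<in> {y. snd y \<in> Q \<and> l (snd y) < fst y \<and> fst y < m (snd y)}" using y by simp
  next
    fix y assume y: "y \<in> {y. snd y \<in> Q \<and> l (snd y) < fst y \<and> fst y < m (snd y)}"
    define t where "t = (fst y - l (snd y)) / (m (snd y) - l (snd y))"
    have d: "m (snd y) - l (snd y) > 0" using y by auto
    then have "t * (m (snd y) - l (snd y)) = fst y - l (snd y)" by (simp add: t_def)
    then have "y = ?F (t, snd y)" by (simp add: prod_eq_iff)
    moreover have "t \<in> {0<..<1}" using y d by (simp add: t_def)
    ultimately show "y \<in> ?F ` ({0<..<1::real} \<times> Q)" using y by blast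
  qed
  ultimately show ?thesis by simp
qed

context graph_chart
begin

lemma p_eq: "fst (T p) = h (snd (T p))"
  using graph[of p] r_pos p_in by simp

text \<open>The base is so small that the graph stays strictly within the height of the cylinder.
  Both parts are then regions between two graphs over a ball, hence connected; this is the reason
  for a cylinder instead of a ball.\<close>

lemma cylinder:
  assumes "e > 0"
  obtains N where "open N" "p \<in> N" "N \<subseteq> ball p e" "N \<subseteq> ball p r"
    "open {x \<in> N. h (snd (T x)) < fst (T x)}" "open {x \<in> N. fst (T x) < h (snd (T x))}"
    "connected {x \<in> N. h (snd (T x)) < fst (T x)}" "connected {x \<in> N. fst (T x) < h (snd (T x))}"
    "N - S = {x \<in> N. h (snd (T x)) < fst (T x)} \<union> {x \<in> N. fst (T x) < h (snd (T x))}"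
    "N \<inter> S \<subseteq> closure {x \<in> N. h (snd (T x)) < fst (T x)} \<inter> closure {x \<in> N. fst (T x) < h (snd (T x))}"
proof -
  define z0 u0 where "z0 = fst (T p)" and "u0 = snd (T p)"
  define m where "m = min e r"
  have m: "m > 0" using assms r_pos by (simp add: m_def)
  have "isCont h u0"
    by (rule has_derivative_continuous[OF h]) (simp add: u0_def r_pos)
  then obtain d where d: "d > 0" "\<And>u. dist u u0 < d \<Longrightarrow> dist (h u) (h u0) < m / 2"
    using m unfolding continuous_at_eps_delta by (metis half_gt_zero dist_norm)
  \<comment> \<open>\<open>d\<close> controls the oscillation of \<open>h\<close>, and m/2 keeps the
    cylinder inside \<open>ball p m\<close>.\<close>
  define \<delta> where "\<delta> = min d (m / 2)"
  have \<delta>: "\<delta> > 0" using d(1) m by (simp add: \<delta>_def)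
  define Q where "Q = ball u0 \<delta>"
  have Qr: "Q \<subseteq> ball (snd (T p)) r"
    using m by (auto simp: Q_def u0_def \<delta>_def m_def)
  have hQ: "\<bar>h u - z0\<bar> < m / 2" if "u \<in> Q" for u
    using d(2)[of u] that p_eq by (simp add: Q_def \<delta>_def z0_def u0_def dist_commute dist_real_def)
  have hQ': "h u < z0 + m / 2" "z0 - m / 2 < h u" if "u \<in> Q" for u
    using hQ[OF that] by linarith+
  have ch: "continuous_on Q h" by (rule continuous_on_subset[OF continuous_on_h Qr])
  define N where "N = {x. \<bar>fst (T x) - z0\<bar> < m / 2 \<and> snd (T x) \<in> Q}"
  have cT: "continuous_on A (\<lambda>x. fst (T x))" "continuous_on A (\<lambda>x. snd (T x))" for A
    by (intro continuous_intros)+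
  have oQ: "open {x. snd (T x) \<in> Q}"
    using open_vimage[of Q "\<lambda>x. snd (T x)"] cT by (simp add: Q_def vimage_def)
  have oN: "open N"
    unfolding N_def by (intro open_Collect_conj open_Collect_less oQ continuous_intros)
  have pN: "p \<in> N" using m \<delta> by (simp add: N_def Q_def z0_def u0_def)
  have Nm: "N \<subseteq> ball p m"
  proof
    fix x assume "x \<in> N"
    then have "\<bar>fst (T x) - z0\<bar> < m / 2" "dist u0 (snd (T x)) < m / 2"
      by (auto simp: N_def Q_def \<delta>_def)
    moreover have "dist (T p) (T x) \<le> dist (fst (T p)) (fst (T x)) + dist (snd (T p)) (snd (T x))"
      using norm_Pair_le[of "fst (T p) - fst (T x)" "snd (T p) - snd (T x)"]
      by (simp add: dist_norm fst_diff[symmetric] snd_diff[symmetric] del: fst_diff snd_diff)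
    ultimately show "x \<in> ball p m"
      by (simp add: z0_def u0_def dist_real_def abs_minus_commute)
  qed
  have chN: "continuous_on N (\<lambda>x. h (snd (T x)))"
    by (rule continuous_on_compose2[OF ch cT(2)]) (auto simp: N_def)
  let ?A = "{x \<in> N. h (snd (T x)) < fst (T x)}" and ?B = "{x \<in> N. fst (T x) < h (snd (T x))}"
  have oA: "open ?A"
  proof -
    have "open (N \<inter> (\<lambda>x. h (snd (T x)) - fst (T x)) -` {..<0})"
      by (intro continuous_open_preimage oN continuous_intros chN)
    also have "N \<inter> (\<lambda>x. h (snd (T x)) - fst (T x)) -` {..<0} = ?A" by auto
    finally show ?thesis .
  qed
  have oB: "open ?B"
  proof -
    have "open (N \<inter> (\<lambda>x. h (snd (T x)) - fst (T x)) -` {0<..})"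
      by (intro continuous_open_preimage oN continuous_intros chN)
    also have "N \<inter> (\<lambda>x. h (snd (T x)) - fst (T x)) -` {0<..} = ?B" by auto
    finally show ?thesis .
  qed
  have img: "inv T ` {y. P y} = {x. P (T x)}" for P
  proof (intro equalityI subsetI)
    fix x assume "x \<in> {x. P (T x)}"
    then show "x \<in> inv T ` {y. P y}" by (intro image_eqI[of _ _ "T x"]) auto
  qed auto
  have "connected (inv T ` {y. snd y \<in> Q \<and> h (snd y) < fst y \<and> fst y < z0 + m / 2})"
    by (intro connected_continuous_image continuous_on_inv_T continuous_on_id
        connected_between_graphs[where m = "\<lambda>_. z0 + m / 2"] ch continuous_on_const)
       (use hQ' in \<open>auto simp: Q_def\<close>)
  also have "inv T ` {y. snd y \<in> Q \<and> h (snd y) < fst y \<and> fst y < z0 + m / 2} = ?A"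
    unfolding img
  proof (rule set_eqI)
    fix x
    show "x \<in> {x. snd (T x) \<in> Q \<and> h (snd (T x)) < fst (T x) \<and> fst (T x) < z0 + m / 2} \<longleftrightarrow> x \<in> ?A"
      unfolding N_def mem_Collect_eq abs_less_iff
      using hQ'[of "snd (T x)"] by (cases "snd (T x) \<in> Q") (simp_all, argo)
  qed
  finally have cA: "connected ?A" .
  have "connected (inv T ` {y. snd y \<in> Q \<and> z0 - m / 2 < fst y \<and> fst y < h (snd y)})"
    by (intro connected_continuous_image continuous_on_inv_T continuous_on_id
        connected_between_graphs[where l = "\<lambda>_. z0 - m / 2"] ch continuous_on_const)
       (use hQ' in \<open>auto simp: Q_def\<close>)
  also have "inv T ` {y. snd y \<in> Q \<and> z0 - m / 2 < fst y \<and> fst y < h (snd y)} = ?B"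
    unfolding img
  proof (rule set_eqI)
    fix x
    show "x \<in> {x. snd (T x) \<in> Q \<and> z0 - m / 2 < fst (T x) \<and> fst (T x) < h (snd (T x))} \<longleftrightarrow> x \<in> ?B"
      unfolding N_def mem_Collect_eq abs_less_iff
      using hQ'[of "snd (T x)"] by (cases "snd (T x) \<in> Q") (simp_all, argo)
  qed
  finally have cB: "connected ?B" .
  have NS: "N - S = ?A \<union> ?B"
    using graph Nm by (auto simp: m_def)
  have cl: "x \<in> closure ?A \<inter> closure ?B" if x: "x \<in> N \<inter> S" for x
  proof -
    have "x \<in> ball p r" using x Nm by (auto simp: m_def)
    then have gx: "fst (T x) = h (snd (T x))" using graph x by blast
    obtain k where k: "k > 0" "ball x k \<subseteq> N" using oN x open_contains_ball by blast
    \<comment> \<open>A vertical displacement by half the minimum: closer than \<epsilon>, still in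
      \<open>N\<close>, and off the graph on the side given by the sign \<open>s\<close>.\<close>
    have *: "\<exists>y. dist y x < \<epsilon> \<and> y \<in> N \<and> T y = (fst (T x) + s * (min \<epsilon> k / 2), snd (T x))" if "\<epsilon> > 0" "\<bar>s\<bar> = 1" for \<epsilon> s
    proof (intro exI conjI)
      let ?y = "inv T (fst (T x) + s * (min \<epsilon> k / 2), snd (T x))"
      have "dist ?y x = dist (T ?y) (T x)" by (rule dist_T[symmetric])
      also have "\<dots> = min \<epsilon> k / 2"
        using that k(1) by (simp add: dist_prod_def dist_real_def abs_mult)
      finally have d: "dist ?y x = min \<epsilon> k / 2" .
      then show "dist ?y x < \<epsilon>" using that k(1) by auto
      have "min \<epsilon> k / 2 < k" using k(1) min.cobounded2[of \<epsilon> k] by linarith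
      then have "dist x ?y < k" using d by (simp add: dist_commute)
      then show "?y \<in> N" using k(2) by auto
      show "T ?y = (fst (T x) + s * (min \<epsilon> k / 2), snd (T x))" by simp
    qed
    have "x \<in> closure ?A"
      unfolding closure_approachable
    proof (intro allI impI)
      fix \<epsilon> :: real assume "\<epsilon> > 0"
      then obtain y where "dist y x < \<epsilon>" "y \<in> N" "T y = (fst (T x) + 1 * (min \<epsilon> k / 2), snd (T x))"
        using *[of \<epsilon> 1] by auto
      then show "\<exists>y\<in>?A. dist y x < \<epsilon>" using gx \<open>\<epsilon> > 0\<close> k(1) by (intro bexI[of _ y]) auto
    qed
    moreover have "x \<in> closure ?B"
      unfolding closure_approachable
    proof (intro allI impI)
      fix \<epsilon> :: real assume "\<epsilon> > 0"
      then obtain y where "dist y x < \<epsilon>" "y \<in> N" "T y = (fst (T x) + (-1) * (min \<epsilon> k / 2), snd (T x))"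
        using *[of \<epsilon> "-1"] by auto
      then show "\<exists>y\<in>?B. dist y x < \<epsilon>" using gx \<open>\<epsilon> > 0\<close> k(1) by (intro bexI[of _ y]) auto
    qed
    ultimately show ?thesis by blast
  qed
  show ?thesis
    by (rule that[OF oN pN _ _ oA oB cA cB NS]) (use Nm cl in \<open>auto simp: m_def\<close>)
qed

end

section \<open>Boundary charts with the domain on one side\<close>

lemma smooth_surface_chart:
  assumes "smooth_surface S" "p \<in> S"
  obtains T h dh r where "graph_chart S p T h dh r"
proof -
  obtain D X where "local_parametrization S D X" "p \<in> X ` D"
    using assms unfolding smooth_surface_def by blast
  then obtain u where "u \<in> D" "p = X u" by blast
  then show ?thesis using graph_chart_exists[OF \<open>local_parametrization S D X\<close>] that by blast
qed

lemma smooth_surface_two_sided: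
  assumes "smooth_surface S"
  shows "two_sided S"
  unfolding two_sided_def
proof (intro ballI allI impI)
  fix x and e :: real assume x: "x \<in> S" "e > 0"
  obtain T h dh r where c: "graph_chart S x T h dh r"
    by (rule smooth_surface_chart[OF assms x(1)])
  obtain N where N: "open N" "x \<in> N" "N \<subseteq> ball x e" and "N \<subseteq> ball x r"
    and N': 
    "open {x \<in> N. h (snd (T x)) < fst (T x)}" "open {x \<in> N. fst (T x) < h (snd (T x))}"
    "connected {x \<in> N. h (snd (T x)) < fst (T x)}" "connected {x \<in> N. fst (T x) < h (snd (T x))}"
    "N - S = {x \<in> N. h (snd (T x)) < fst (T x)} \<union> {x \<in> N. fst (T x) < h (snd (T x))}"
    "N \<inter> S \<subseteq> closure {x \<in> N. h (snd (T x)) < fst (T x)} \<inter> closure {x \<in> N. fst (T x) < h (snd (T x))}"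
    by (rule graph_chart.cylinder[OF c x(2)])
  show "\<exists>N A B. open N \<and> x \<in> N \<and> N \<subseteq> ball x e \<and> open A \<and> open B \<and> connected A \<and> connected B \<and>
      A \<inter> B = {} \<and> N - S = A \<union> B \<and> N \<inter> S \<subseteq> closure A \<inter> closure B"
    by (rule exI[of _ N], rule exI[of _ "{x \<in> N. h (snd (T x)) < fst (T x)}"],
        rule exI[of _ "{x \<in> N. fst (T x) < h (snd (T x))}"], intro conjI N N') auto
qed

locale domain_chart = graph_chart "frontier G" p T h dh r
  for G :: "quat set" and p T h dh r +
  assumes below: "\<And>x. x \<in> ball p r \<Longrightarrow> x \<in> G \<longleftrightarrow> fst (T x) < h (snd (T x))"
begin

lemma domain_chart_at:
  assumes "q \<in> frontier G" "0 < r'" "dist p q + r' \<le> r"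
  shows "domain_chart G q T h dh r'"
proof (intro domain_chart.intro domain_chart_axioms.intro chart_at[OF assms])
  fix x assume "x \<in> ball q r'"
  then have "x \<in> ball p r" using dist_triangle[of p x q] assms(3) by auto
  then show "x \<in> G \<longleftrightarrow> fst (T x) < h (snd (T x))" by (rule below)
qed

end

text \<open>The two halves of a cylinder avoid the frontier, so each is contained in
  \<open>G\<close> or disjoint from it. Separation excludes that both are contained, and
  \<open>p\<close> being in the closure excludes that both are disjoint.\<close>

lemma domain_chart_exists:
  assumes G: "open G" "connected G" "bounded G" and sm: "smooth_surface (frontier G)"
    and p: "p \<in> frontier G"
  obtains T h dh r where "domain_chart G p T h dh r"
proof -
  have cpt: "compact (frontier G)" using G(3) by (rule compact_frontier_bounded)
  obtain T h dh r where "graph_chart (frontier G) p T h dh r" by (rule smooth_surface_chart[OF sm p])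
  then interpret c: graph_chart "frontier G" p T h dh r .
  obtain N where N: "open N" "p \<in> N" "N \<subseteq> ball p 1" "N \<subseteq> ball p r"
    and "open {x \<in> N. h (snd (T x)) < fst (T x)}" and "open {x \<in> N. fst (T x) < h (snd (T x))}"
    and N': "connected {x \<in> N. h (snd (T x)) < fst (T x)}" "connected {x \<in> N. fst (T x) < h (snd (T x))}"
    "N - frontier G = {x \<in> N. h (snd (T x)) < fst (T x)} \<union> {x \<in> N. fst (T x) < h (snd (T x))}"
    and "N \<inter> frontier G \<subseteq> closure {x \<in> N. h (snd (T x)) < fst (T x)} \<inter> closure {x \<in> N. fst (T x) < h (snd (T x))}"
    by (rule c.cylinder[OF zero_less_one])
  let ?A = "{x \<in> N. h (snd (T x)) < fst (T x)}" and ?B = "{x \<in> N. fst (T x) < h (snd (T x))}"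
  have GF: "G \<inter> frontier G = {}" using G(1) by (simp add: frontier_def interior_open)
  have bN: "bounded N" by (rule bounded_subset[OF bounded_ball N(3)])
  have one: "?A \<inter> G = {} \<or> ?B \<inter> G = {}"
    by (rule connected_one_sided[OF cpt smooth_surface_two_sided[OF sm] G(2) GF G(3) N(1) _ N'(1,2) bN N'(3)])
       (use N(2) p in blast)
  have "G \<inter> N \<noteq> {}"
    using p N(1,2) open_Int_closure_eq_empty[OF N(1), of G] by (auto simp: frontier_def)
  then have some: "?A \<inter> G \<noteq> {} \<or> ?B \<inter> G \<noteq> {}" using GF N'(3) by blast
  have dich: "C \<subseteq> G \<or> C \<inter> G = {}" if "connected C" "C \<subseteq> N - frontier G" for C
    using connected_Int_frontier[OF that(1), of G] that(2) by blast
  have AB: "?A \<subseteq> G \<and> ?B \<inter> G = {} \<or> ?A \<inter> G = {} \<and> ?B \<subseteq> G"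
    using one some dich[OF N'(1)] dich[OF N'(2)] N'(3) by blast
  obtain e where e: "e > 0" "ball p e \<subseteq> N" using N(1,2) open_contains_ball by blast
  define k where "k = min e r"
  have k: "0 < k" "dist p p + k \<le> r" using e(1) c.r_pos by (auto simp: k_def)
  have kN: "ball p k \<subseteq> N" using e(2) by (auto simp: k_def)
  have gr: "x \<in> frontier G \<longleftrightarrow> fst (T x) = h (snd (T x))" if "x \<in> N" for x
    using c.graph that N(4) by blast
  have tri: "x \<in> ?A \<and> \<not> fst (T x) < h (snd (T x)) \<or> x \<in> ?B \<and> \<not> h (snd (T x)) < fst (T x) \<or>
      x \<notin> G \<and> \<not> fst (T x) < h (snd (T x)) \<and> \<not> h (snd (T x)) < fst (T x)" if "x \<in> N" for x
  proof (cases "fst (T x)" "h (snd (T x))" rule: linorder_cases)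
    case equal
    then have "x \<notin> G" using gr[OF that] GF by blast
    then show ?thesis using equal by simp
  qed (use that in simp_all)
  note ck = c.chart_at[OF p k]
  show ?thesis
  proof (cases "?B \<inter> G = {}")
    case False
    then have "?A \<inter> G = {}" "?B \<subseteq> G" using AB by argo+
    then have A0: "\<And>x. x \<in> ?A \<Longrightarrow> x \<notin> G" and B0: "\<And>x. x \<in> ?B \<Longrightarrow> x \<in> G"
      unfolding disjoint_iff subset_iff by iprover+
    have "domain_chart G p T h dh k"
    proof (intro domain_chart.intro ck domain_chart_axioms.intro)
      fix x assume "x \<in> ball p k"
      then have xN: "x \<in> N" using kN by blast
      show "x \<in> G \<longleftrightarrow> fst (T x) < h (snd (T x))"
        using tri[OF xN] A0[of x] B0[of x] unfolding mem_Collect_eq by argo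
    qed
    then show ?thesis by (rule that)
  next
    case True
    then have "?A \<subseteq> G" using AB some by argo
    then have A0: "\<And>x. x \<in> ?A \<Longrightarrow> x \<in> G" and B0: "\<And>x. x \<in> ?B \<Longrightarrow> x \<notin> G"
      using True unfolding disjoint_iff subset_iff by iprover+
    \<comment> \<open>Here the domain lies above the graph, and the flipped chart puts it
      below.\<close>
    have "domain_chart G p (\<lambda>x. (- fst (T x), snd (T x))) (\<lambda>u. - h u) (\<lambda>u. - dh u) k"
    proof (intro domain_chart.intro graph_chart.chart_flip[OF ck] domain_chart_axioms.intro)
      fix x assume "x \<in> ball p k"
      then have xN: "x \<in> N" using kN by blast
      have "x \<in> G \<longleftrightarrow> h (snd (T x)) < fst (T x)"
        using tri[OF xN] A0[of x] B0[of x] unfolding mem_Collect_eq by argo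
      then show "x \<in> G \<longleftrightarrow> fst (- fst (T x), snd (T x)) < - h (snd (- fst (T x), snd (T x)))"
        by simp
    qed
    then show ?thesis by (rule that)
  qed
qed

section \<open>Surface measure\<close>

text \<open>The Jacobian formula for the sets \<open>{x \<in> S. g x \<in> B}\<close> says that the
  two measures agree on each \<open>B\<close>. The value 0 off \<open>S\<close> only makes the map
  total, as the density vanishes there.\<close>

lemma density_image_eq_distr:
  fixes g :: "real^'n::{finite,wellorder} \<Rightarrow> real^'n::_"
  assumes S[measurable]: "S \<in> sets borel" and gS[measurable]: "g ` S \<in> sets borel"
    and der: "\<And>x. x \<in> S \<Longrightarrow> (g has_derivative g' x) (at x)"
    and inj: "inj_on g S"
    and J[measurable]: "(\<lambda>x. indicator S x * \<bar>det (matrix (g' x))\<bar>) \<in> borel_measurable borel"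
  shows "(\<lambda>x. if x \<in> S then g x else 0) \<in> borel \<rightarrow>\<^sub>M borel" (is "?g \<in> _")
    and "density lborel (indicator (g ` S)) =
      distr (density lborel (\<lambda>x. ennreal (indicator S x * \<bar>det (matrix (g' x))\<bar>))) borel
        (\<lambda>x. if x \<in> S then g x else 0)" (is "?M = ?N")
proof -
  have "continuous_on S g"
    using has_derivative_continuous[OF der] by (auto intro: continuous_at_imp_continuous_on)
  then show m[measurable]: "?g \<in> borel \<rightarrow>\<^sub>M borel"
    by (rule borel_measurable_continuous_on_if[OF S]) auto
  show "?M = ?N"
  proof (rule measure_eqI)
    fix B assume "B \<in> sets ?M"
    then have B[measurable]: "B \<in> sets borel" by simp
    let ?S = "{x \<in> S. g x \<in> B}"
    have "?S = S \<inter> (?g -` B \<inter> space borel)" by auto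
    then have S'[measurable]: "?S \<in> sets borel" using measurable_sets[OF m B] by auto
    have gS': "g ` ?S = g ` S \<inter> B" by auto
    have eq: "indicator ?S x * \<bar>det (matrix (g' x))\<bar> = indicator S x * \<bar>det (matrix (g' x))\<bar> * indicator ?S x" for x
      by (auto simp: indicator_def)
    have "emeasure lborel (g ` ?S) = (\<integral>\<^sup>+x. ennreal (indicator ?S x * \<bar>det (matrix (g' x))\<bar>) \<partial>lborel)"
    proof (rule emeasure_differentiable_image[OF S'])
      show "g ` ?S \<in> sets borel" unfolding gS' by measurable
      show "inj_on g ?S" using inj by (rule inj_on_subset) auto
      show "(\<lambda>x. indicator ?S x * \<bar>det (matrix (g' x))\<bar>) \<in> borel_measurable borel"
        unfolding eq by measurable
    qed (use der in auto)
    also have "\<dots> = (\<integral>\<^sup>+x. ennreal (indicator S x * \<bar>det (matrix (g' x))\<bar>) * indicator (?g -` B \<inter> space lborel) x \<partial>lborel)"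
      by (intro nn_integral_cong) (auto simp: indicator_def)
    also have "\<dots> = emeasure ?N B"
      using measurable_sets[OF m B] by (subst emeasure_distr) (auto simp: emeasure_density)
    finally show "emeasure ?M B = emeasure ?N B"
      unfolding gS' by (simp add: emeasure_density nn_integral_set_ennreal[symmetric] flip: indicator_inter_arith)
  qed simp
qed

lemma nn_integral_change_of_variables:
  fixes g :: "real^'n::{finite,wellorder} \<Rightarrow> real^'n::_"
  assumes S: "S \<in> sets borel" and gS: "g ` S \<in> sets borel"
    and der: "\<And>x. x \<in> S \<Longrightarrow> (g has_derivative g' x) (at x)"
    and inj: "inj_on g S"
    and J: "(\<lambda>x. indicator S x * \<bar>det (matrix (g' x))\<bar>) \<in> borel_measurable borel"
    and F[measurable]: "F \<in> borel_measurable borel"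
  shows "(\<integral>\<^sup>+y. indicator (g ` S) y * F y \<partial>lborel) =
    (\<integral>\<^sup>+x. ennreal (indicator S x * \<bar>det (matrix (g' x))\<bar>) * F (g x) \<partial>lborel)"
proof -
  note [measurable] = S gS J density_image_eq_distr(1)[OF S gS der inj J]
  have "(\<integral>\<^sup>+y. indicator (g ` S) y * F y \<partial>lborel) = (\<integral>\<^sup>+y. F y \<partial>density lborel (indicator (g ` S)))"
    by (subst nn_integral_density) auto
  also have "\<dots> = (\<integral>\<^sup>+x. ennreal (indicator S x * \<bar>det (matrix (g' x))\<bar>) * F (if x \<in> S then g x else 0) \<partial>lborel)"
    by (simp add: density_image_eq_distr(2)[OF S gS der inj J] nn_integral_distr nn_integral_density)
  also have "\<dots> = (\<integral>\<^sup>+x. ennreal (indicator S x * \<bar>det (matrix (g' x))\<bar>) * F (g x) \<partial>lborel)"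
    by (intro nn_integral_cong) (auto simp: indicator_def)
  finally show ?thesis .
qed

section \<open>Graphs as parametrizations and their area\<close>

context graph_chart
begin

definition param :: "real^3 \<Rightarrow> quat" where "param w = inv T (h w, w)"

text \<open>The graph over the outer part of the base ball may leave \<open>ball p r\<close>, where
  the chart no longer describes \<open>S\<close>.\<close>

definition chart_dom :: "(real^3) set" where "chart_dom = {w \<in> ball (snd (T p)) r. param w \<in> ball p r}"

definition area :: "real^3 \<Rightarrow> real" where "area w = sqrt (1 + (norm (dh w))\<^sup>2)"

lemma T_param [simp]: "T (param w) = (h w, w)" by (simp add: param_def)

lemma continuous_on_param: "continuous_on (ball (snd (T p)) r) param"
  unfolding param_def by (intro continuous_intros continuous_on_h)

lemma open_dom: "open chart_dom"
proof -
  have "open (ball (snd (T p)) r \<inter> param -` ball p r)"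
    by (intro continuous_open_preimage continuous_on_param) auto
  then show ?thesis by (simp add: chart_dom_def vimage_def Int_def)
qed

lemma dom_ball: "w \<in> chart_dom \<Longrightarrow> w \<in> ball (snd (T p)) r" by (simp add: chart_dom_def)

lemma param_inverse: "x \<in> S \<Longrightarrow> x \<in> ball p r \<Longrightarrow> param (snd (T x)) = x"
proof -
  assume "x \<in> S" "x \<in> ball p r"
  then have "(h (snd (T x)), snd (T x)) = T x" using graph[of x] by (simp add: prod_eq_iff)
  then show ?thesis by (simp add: param_def)
qed

lemma snd_T_in_dom: "x \<in> S \<Longrightarrow> x \<in> ball p r \<Longrightarrow> snd (T x) \<in> chart_dom"
  using snd_T_in_ball[of x p r] by (simp add: chart_dom_def param_inverse)

lemma param_in: "w \<in> chart_dom \<Longrightarrow> param w \<in> S" "w \<in> chart_dom \<Longrightarrow> param w \<in> ball p r"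
  using graph[of "param w"] by (auto simp: chart_dom_def)

lemma image_param: "param ` chart_dom = S \<inter> ball p r"
  using param_in snd_T_in_dom param_inverse by (auto simp: image_iff) metis

lemma has_derivative_param:
  assumes "w \<in> ball (snd (T p)) r"
  shows "(param has_derivative (\<lambda>v. inv T (dh w \<bullet> v, v))) (at w)"
  unfolding param_def
  by (rule bounded_linear.has_derivative[OF bounded_linear_inv_T])
     (intro has_derivative_Pair h assms has_derivative_ident)

text \<open>Makes the defining property of \<open>surface_measure\<close> applicable to the chart
  itself.\<close>

lemma local_parametrization_param: "local_parametrization S chart_dom param"
  unfolding local_parametrization_def
proof (intro conjI ballI)
  show "open chart_dom" by (rule open_dom)
  have bl: "bounded_linear (\<lambda>v. inv T (dh w \<bullet> v, v))" for w
    by (intro bounded_linear_compose[OF bounded_linear_inv_T] bounded_linear_Pair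
        bounded_linear_inner_right bounded_linear_ident)
  show "C1_on chart_dom param"
    unfolding C1_on_def
  proof (intro exI conjI ballI)
    fix w assume w: "w \<in> chart_dom"
    show "(param has_derivative blinfun_apply (Blinfun (\<lambda>v. inv T (dh w \<bullet> v, v)))) (at w)"
      using has_derivative_param[OF dom_ball[OF w]] by (simp add: bounded_linear_Blinfun_apply[OF bl])
  next
    show "continuous_on chart_dom (\<lambda>w. Blinfun (\<lambda>v. inv T (dh w \<bullet> v, v)))"
    proof (rule continuous_on_blinfun_componentwise)
      have "continuous_on chart_dom dh" by (rule continuous_on_subset[OF dh]) (auto simp: chart_dom_def)
      then show "continuous_on chart_dom (\<lambda>w. blinfun_apply (Blinfun (\<lambda>v. inv T (dh w \<bullet> v, v))) i)" for i
        unfolding bounded_linear_Blinfun_apply[OF bl] by (intro continuous_intros)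
    qed
  qed
  show "inj (frechet_derivative param (at w))" if "w \<in> chart_dom" for w
  proof -
    have "inj (\<lambda>v. inv T (dh w \<bullet> v, v))"
      by (rule injI) (metis T_inv prod.inject)
    then show ?thesis using frechet_derivative_at[OF has_derivative_param[OF dom_ball[OF that]]] by simp
  qed
  show "openin (top_of_set S) (param ` chart_dom)"
    unfolding image_param by (rule openin_open_Int) simp
  show "\<exists>Y. homeomorphism chart_dom (param ` chart_dom) param Y"
  proof (intro exI homeomorphismI)
    show "continuous_on chart_dom param"
      by (rule continuous_on_subset[OF continuous_on_param]) (auto simp: chart_dom_def)
    show "continuous_on (param ` chart_dom) (\<lambda>x. snd (T x))" by (intro continuous_intros)
  qed auto
qed

text \<open>The Gram matrix of the graph is the identity plus dh dh^T, with determinant 1 +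
  |dh|^2.\<close>

lemma area_element_param:
  assumes "w \<in> chart_dom"
  shows "area_element param w = area w"
proof -
  have "frechet_derivative param (at w) = (\<lambda>v. inv T (dh w \<bullet> v, v))"
    using frechet_derivative_at[OF has_derivative_param[OF dom_ball[OF assms]]] by simp
  moreover have "(norm (dh w))\<^sup>2 = dh w $ 1 * dh w $ 1 + dh w $ 2 * dh w $ 2 + dh w $ 3 * dh w $ 3"
    by (simp add: power2_norm_eq_inner inner_vec_def sum_3)
  ultimately show ?thesis
    unfolding area_element_def area_def
    by (simp add: inner_inv_T det_3 axis_def inner_vec_def sum_3 algebra_simps)
qed

end

lemma local_parametrizationE:
  assumes "local_parametrization S D X"
  obtains Y and DX :: "real^3 \<Rightarrow> ((real^3) \<Rightarrow>\<^sub>L quat)" where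
    "open D" "homeomorphism D (X ` D) X Y" "openin (top_of_set S) (X ` D)" "X ` D \<subseteq> S" "inj_on X D"
    "continuous_on D X" "continuous_on D DX" "\<And>u. u \<in> D \<Longrightarrow> (X has_derivative DX u) (at u)"
    "\<And>u. u \<in> D \<Longrightarrow> frechet_derivative X (at u) = DX u"
proof -
  obtain Y where Y: "homeomorphism D (X ` D) X Y"
    using assms by (auto simp: local_parametrization_def)
  obtain DX :: "real^3 \<Rightarrow> ((real^3) \<Rightarrow>\<^sub>L quat)" where
    DX: "\<And>u. u \<in> D \<Longrightarrow> (X has_derivative DX u) (at u)" "continuous_on D DX"
    using assms unfolding local_parametrization_def C1_on_def by blast
  have D: "open D" and op: "openin (top_of_set S) (X ` D)"
    using assms by (simp_all add: local_parametrization_def)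
  have inj: "inj_on X D" using homeomorphism_apply1[OF Y] by (rule inj_on_inverseI)
  have cX: "continuous_on D X" using Y by (simp add: homeomorphism_def)
  have fd: "frechet_derivative X (at u) = DX u" if "u \<in> D" for u
    by (rule frechet_derivative_at[OF DX(1)[OF that], symmetric])
  show ?thesis by (rule that[OF D Y op openin_imp_subset[OF op] inj cX DX(2) DX(1) fd])
qed

lemma sets_surface:
  assumes "closed S" "B \<subseteq> S" "B \<in> sets borel"
  shows "B \<in> sets (restrict_space borel S)"
  using assms by (auto simp: sets_restrict_space_iff)

text \<open>Continuous images of Borel sets need not be Borel. Here the image is, within the Borel
  set parametrized by \<open>D\<close>, the preimage of \<open>A\<close> under the continuous
  inverse \<open>Y\<close>.\<close>

lemma borel_image_parametrization:
  assumes "closed S" and lp: "local_parametrization S D X" and A: "A \<in> sets borel" "A \<subseteq> D"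
  shows "X ` A \<in> sets borel"
proof -
  obtain Y where Y: "homeomorphism D (X ` D) X Y" and op: "openin (top_of_set S) (X ` D)"
    by (rule local_parametrizationE[OF lp]) (rule that; blast)
  obtain Ob where "open Ob" "X ` D = S \<inter> Ob" using op by (auto simp: openin_open)
  then have XD[measurable]: "X ` D \<in> sets borel" using assms(1) by auto
  show ?thesis
  proof (cases "D = {}")
    case False
    then obtain d where d: "d \<in> D" by blast
    let ?Y = "\<lambda>x. if x \<in> X ` D then Y x else d"
    have m: "?Y \<in> borel_measurable borel"
      using Y by (intro borel_measurable_continuous_on_if) (auto simp: homeomorphism_def)
    have "X ` A = X ` D \<inter> (?Y -` A \<inter> space borel)"
    proof (intro equalityI subsetI)
      fix x assume "x \<in> X ` A"
      then obtain u where u: "u \<in> A" "x = X u" by blast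
      then have "x \<in> X ` D" "Y x = u" using A(2) homeomorphism_apply1[OF Y, of u] by blast+
      then show "x \<in> X ` D \<inter> (?Y -` A \<inter> space borel)" using u(1) by simp
    next
      fix x assume x: "x \<in> X ` D \<inter> (?Y -` A \<inter> space borel)"
      then have "Y x \<in> A" "X (Y x) = x" using Y by (auto simp: homeomorphism_def)
      then show "x \<in> X ` A" by (intro image_eqI[of x X "Y x" A]) simp_all
    qed
    then show ?thesis by (rule ssubst) (rule sets.Int[OF XD measurable_sets[OF m A(1)]])
  qed (use A in auto)
qed

lemma continuous_on_area_element:
  assumes lp: "local_parametrization S D X"
  shows "continuous_on D (area_element X)"
proof -
  obtain DX :: "real^3 \<Rightarrow> ((real^3) \<Rightarrow>\<^sub>L quat)" where
    c: "continuous_on D DX" and f: "\<And>u. u \<in> D \<Longrightarrow> frechet_derivative X (at u) = DX u"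
    by (rule local_parametrizationE[OF lp]) (rule that; blast)
  have "continuous_on D (\<lambda>u. sqrt (det (\<chi> i j. DX u (axis i 1) \<bullet> DX u (axis j 1))))"
    unfolding det_3 by (simp, intro continuous_intros c)
  then show ?thesis
    by (rule continuous_on_eq) (simp add: area_element_def f)
qed

context graph_chart
begin

text \<open>Near \<open>u\<close> the identity fst (T (X y)) = h (snd (T (X y))) holds because
  \<open>X\<close> maps into the surface; differentiate both sides.\<close>

lemma tangent:
  assumes DX: "(X has_derivative DX) (at u)" and u: "open D" "u \<in> D" "X ` D \<subseteq> S" "X u \<in> ball p r"
  shows "fst (T (DX v)) = dh (snd (T (X u))) \<bullet> snd (T (DX v))"
proof -
  have "isCont X u" using DX by (rule has_derivative_continuous)
  then have "\<forall>\<^sub>F y in at u. X y \<in> ball p r"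
    using u(4) unfolding isCont_def by (rule topological_tendstoD[OF _ open_ball])
  moreover have "\<forall>\<^sub>F y in at u. y \<in> D" using u(1,2) by (rule eventually_at_in_open')
  ultimately have ev: "\<forall>\<^sub>F y in at u. h (snd (T (X y))) = fst (T (X y))"
  proof eventually_elim
    case (elim y)
    then show ?case using graph[of "X y"] u(3) by auto
  qed
  have eq: "h (snd (T (X u))) = fst (T (X u))" using graph[of "X u"] u(2-4) by auto
  have "((\<lambda>y. snd (T (X y))) has_derivative (\<lambda>v. snd (T (DX v)))) (at u)"
    by (intro bounded_linear.has_derivative[OF bounded_linear_compose[OF bounded_linear_snd bounded_linear_T]] DX)
  moreover have "(h has_derivative (\<lambda>v. dh (snd (T (X u))) \<bullet> v)) (at (snd (T (X u))))"
    by (rule h[OF snd_T_in_ball[OF u(4)]])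
  ultimately have "((\<lambda>y. h (snd (T (X y)))) has_derivative (\<lambda>v. dh (snd (T (X u))) \<bullet> snd (T (DX v)))) (at u)"
    by (rule has_derivative_compose)
  then have "((\<lambda>y. fst (T (X y))) has_derivative (\<lambda>v. dh (snd (T (X u))) \<bullet> snd (T (DX v)))) (at u)"
    by (rule has_derivative_transform_eventually[OF _ ev eq]) simp
  moreover have "((\<lambda>y. fst (T (X y))) has_derivative (\<lambda>v. fst (T (DX v)))) (at u)"
    by (intro bounded_linear.has_derivative[OF bounded_linear_compose[OF bounded_linear_fst bounded_linear_T]] DX)
  ultimately have "(\<lambda>v. fst (T (DX v))) = (\<lambda>v. dh (snd (T (X u))) \<bullet> snd (T (DX v)))"
    by (rule has_derivative_unique[rotated])
  then show ?thesis by meson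
qed

text \<open>With A the Jacobian matrix of the transition to graph coordinates and d the gradient,
  the Gram matrix of \<open>X\<close> is A^T (I + d d^T) A; take determinants and square
  roots.\<close>

lemma area_element_transition:
  assumes lp: "local_parametrization S D X" and u: "u \<in> D" "X u \<in> ball p r"
  shows "area_element X u =
    area (snd (T (X u))) * \<bar>det (matrix (\<lambda>v. snd (T (frechet_derivative X (at u) v))))\<bar>"
proof -
  obtain DX :: "real^3 \<Rightarrow> ((real^3) \<Rightarrow>\<^sub>L quat)" where
    D: "open D" "X ` D \<subseteq> S" and DX: "\<And>u. u \<in> D \<Longrightarrow> (X has_derivative DX u) (at u)"
    and fd: "\<And>u. u \<in> D \<Longrightarrow> frechet_derivative X (at u) = DX u"
    by (rule local_parametrizationE[OF lp]) (rule that; blast)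
  define d where "d = dh (snd (T (X u)))"
  define g where "g v = snd (T (DX u v))" for v
  have DXg: "T (DX u v) = (d \<bullet> g v, g v)" for v
    using tangent[OF DX[OF u(1)] D(1) u(1) D(2) u(2), of v] by (simp add: prod_eq_iff d_def g_def)
  have inn: "DX u v \<bullet> DX u w = (d \<bullet> g v) * (d \<bullet> g w) + g v \<bullet> g w" for v w
  proof -
    have "DX u v \<bullet> DX u w = T (DX u v) \<bullet> T (DX u w)"
      using T unfolding orthogonal_transformation_def by metis
    then show ?thesis by (simp add: DXg)
  qed
  define A where "A = matrix g"
  define Gm :: "real^3^3" where "Gm = (\<chi> i j. d $ i * d $ j + (if i = j then 1 else 0))"
  have "(\<chi> i j. DX u (axis i 1) \<bullet> DX u (axis j 1)) = transpose A ** Gm ** A"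
    unfolding inn
    by (simp add: vec_eq_iff forall_3 A_def matrix_def transpose_def matrix_matrix_mult_def sum_3 Gm_def
        inner_vec_def algebra_simps)
  then have "det (\<chi> i j. DX u (axis i 1) \<bullet> DX u (axis j 1)) = det Gm * (det A)\<^sup>2"
    by (simp add: det_mul det_transpose power2_eq_square)
  moreover have "det Gm = 1 + (norm d)\<^sup>2"
    by (simp add: Gm_def det_3 power2_norm_eq_inner inner_vec_def sum_3 algebra_simps)
  ultimately show ?thesis
    by (simp add: area_element_def fd[OF u(1)] real_sqrt_mult area_def d_def[symmetric] A_def g_def[abs_def])
qed

definition dens :: "real^3 \<Rightarrow> real" where "dens w = indicator chart_dom w * area w"

text \<open>The default \<open>p\<close> is a point of \<open>S\<close>, so that the map goes into
  \<open>S\<close> everywhere; \<open>dens\<close> is 0 where the default is used.\<close>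

definition emb :: "real^3 \<Rightarrow> quat" where "emb w = (if w \<in> chart_dom then param w else p)"

definition chart_measure :: "quat measure" where
  "chart_measure = distr (density lborel (\<lambda>w. ennreal (dens w))) (restrict_space borel S) emb"

lemma area_nonneg [simp]: "0 \<le> area w" by (simp add: area_def)

lemma dens_nonneg [simp]: "0 \<le> dens w" by (simp add: dens_def)

lemma borel_dom [measurable]: "chart_dom \<in> sets borel" using open_dom by simp

lemma continuous_on_area: "continuous_on chart_dom area"
  unfolding area_def by (intro continuous_intros continuous_on_subset[OF dh]) (auto simp: chart_dom_def)

lemma dens_measurable [measurable]: "dens \<in> borel_measurable borel"
  using borel_measurable_continuous_on_indicator[OF borel_dom continuous_on_area] by (simp add: dens_def[abs_def])

lemma continuous_on_param_dom: "continuous_on chart_dom param"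
  by (rule continuous_on_subset[OF continuous_on_param]) (auto simp: chart_dom_def)

lemma emb_in: "emb w \<in> S" using param_in p_in by (simp add: emb_def)

lemma emb_borel [measurable]: "emb \<in> borel \<rightarrow>\<^sub>M borel"
  unfolding emb_def[abs_def]
  by (intro borel_measurable_continuous_on_if borel_dom continuous_on_param_dom continuous_on_const)

lemma emb_measurable [measurable]: "emb \<in> borel \<rightarrow>\<^sub>M restrict_space borel S"
  by (rule measurable_restrict_space2) (auto simp: emb_in)

lemma sets_chart_measure [measurable_cong, simp]: "sets chart_measure = sets (restrict_space borel S)"
  by (simp add: chart_measure_def)

lemma emeasure_chart_measure:
  assumes A: "A \<in> sets (restrict_space borel S)"
  shows "emeasure chart_measure A = (\<integral>\<^sup>+w. ennreal (dens w) * indicator A (emb w) \<partial>lborel)"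
proof -
  have "emb -` A \<inter> space lborel \<in> sets lborel"
    using measurable_sets[OF emb_measurable A] by simp
  then show ?thesis
    unfolding chart_measure_def using A
    by (subst emeasure_distr) (auto simp: emeasure_density indicator_def intro!: nn_integral_cong)
qed

text \<open>Change of variables along the transition \<open>g\<close> from the parameters of
  \<open>X\<close> to graph coordinates, where \<open>area_element_transition\<close> converts one
  area element into the other. This independence of the parametrization lets chart measures be
  glued.\<close>

lemma emeasure_chart_measure_image:
  assumes cl: "closed S" and lp: "local_parametrization S D X" and A: "A \<in> sets borel" "A \<subseteq> D"
  shows "emeasure chart_measure (X ` A) =
    (\<integral>\<^sup>+u. ennreal (area_element X u) * indicator {u \<in> A. X u \<in> ball p r} u \<partial>lborel)"
proof -
  obtain DX :: "real^3 \<Rightarrow> ((real^3) \<Rightarrow>\<^sub>L quat)" where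
    D: "open D" "openin (top_of_set S) (X ` D)" "X ` D \<subseteq> S" "inj_on X D" "continuous_on D X" "continuous_on D DX"
    and DX: "\<And>u. u \<in> D \<Longrightarrow> (X has_derivative DX u) (at u)"
    and fd: "\<And>u. u \<in> D \<Longrightarrow> frechet_derivative X (at u) = DX u"
    by (rule local_parametrizationE[OF lp]) (rule that; blast)
  have XA: "X ` A \<in> sets borel" by (rule borel_image_parametrization[OF cl lp A])
  have XAS: "X ` A \<subseteq> S" using A D(3) by blast
  have XA': "X ` A \<in> sets (restrict_space borel S)" by (rule sets_surface[OF cl XAS XA])
  define D0 where "D0 = {u \<in> D. X u \<in> ball p r}"
  define g where "g u = snd (T (X u))" for u
  define g' where "g' u v = snd (T (DX u v))" for u v
  have oD0: "open D0"
    using continuous_open_preimage[OF D(5,1) open_ball[of p r]] by (simp add: D0_def vimage_def Int_def)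
  have Xg: "param (g u) = X u" "g u \<in> chart_dom" if "u \<in> D0" for u
    using that D(3) param_inverse[of "X u"] snd_T_in_dom[of "X u"] by (auto simp: D0_def g_def)
  have gD0: "g ` D0 = {w \<in> chart_dom. param w \<in> X ` D}"
  proof (intro equalityI subsetI)
    fix w assume "w \<in> g ` D0"
    then show "w \<in> {w \<in> chart_dom. param w \<in> X ` D}" using Xg by (auto simp: D0_def)
  next
    fix w assume w: "w \<in> {w \<in> chart_dom. param w \<in> X ` D}"
    then obtain u where u: "u \<in> D" "param w = X u" by auto
    then have "u \<in> D0" using w param_in(2)[of w] by (simp add: D0_def)
    moreover have "g u = w" using u by (simp add: g_def flip: u(2))
    ultimately show "w \<in> g ` D0" by blast
  qed
  obtain Ob where Ob: "open Ob" "X ` D = S \<inter> Ob" using D(2) by (auto simp: openin_open)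
  have "g ` D0 = chart_dom \<inter> param -` Ob" unfolding gD0 Ob(2) using param_in(1) by blast
  then have "open (g ` D0)"
    using continuous_open_preimage[OF continuous_on_param_dom open_dom Ob(1)] by simp
  then have gD0b: "g ` D0 \<in> sets borel" by simp
  have der: "(g has_derivative g' u) (at u)" if "u \<in> D0" for u
    unfolding g_def g'_def
    by (rule bounded_linear.has_derivative[OF bounded_linear_compose[OF bounded_linear_snd bounded_linear_T] DX])
       (use that in \<open>simp add: D0_def\<close>)
  have inj: "inj_on g D0"
  proof (rule inj_onI)
    fix u u' assume u: "u \<in> D0" "u' \<in> D0" "g u = g u'"
    then have "X u = X u'" using Xg by metis
    then show "u = u'" using D(4) u by (auto simp: D0_def inj_on_def)
  qed
  have J: "(\<lambda>u. indicator D0 u * \<bar>det (matrix (g' u))\<bar>) \<in> borel_measurable borel"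
  proof -
    have "continuous_on D0 (\<lambda>u. \<bar>det (matrix (g' u))\<bar>)"
      unfolding det_3 matrix_def g'_def
      by (simp, intro continuous_intros continuous_on_subset[OF D(6)]) (auto simp: D0_def)
    then show ?thesis
      using borel_measurable_continuous_on_indicator[of D0 "\<lambda>u. \<bar>det (matrix (g' u))\<bar>"] oD0 by simp
  qed
  define F where "F w = ennreal (dens w) * indicator (X ` A) (emb w)" for w
  have [measurable]: "X ` A \<in> sets borel" by fact
  have F: "F \<in> borel_measurable borel" unfolding F_def by measurable
  have "emeasure chart_measure (X ` A) = (\<integral>\<^sup>+w. F w \<partial>lborel)"
    by (simp add: emeasure_chart_measure[OF XA'] F_def)
  also have "\<dots> = (\<integral>\<^sup>+w. indicator (g ` D0) w * F w \<partial>lborel)"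
    unfolding gD0 using A(2) by (intro nn_integral_cong) (auto simp: F_def dens_def emb_def indicator_def)
  also have "\<dots> = (\<integral>\<^sup>+u. ennreal (indicator D0 u * \<bar>det (matrix (g' u))\<bar>) * F (g u) \<partial>lborel)"
    by (rule nn_integral_change_of_variables[OF _ gD0b der inj J F]) (use oD0 in auto)
  also have "\<dots> = (\<integral>\<^sup>+u. ennreal (area_element X u) * indicator {u \<in> A. X u \<in> ball p r} u \<partial>lborel)"
  proof (rule nn_integral_cong)
    fix u
    show "ennreal (indicator D0 u * \<bar>det (matrix (g' u))\<bar>) * F (g u) =
      ennreal (area_element X u) * indicator {u \<in> A. X u \<in> ball p r} u"
    proof (cases "u \<in> D0")
      case True
      then have uD: "u \<in> D" "X u \<in> ball p r" by (auto simp: D0_def)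
      have "X u \<in> X ` A \<longleftrightarrow> u \<in> A" using D(4) uD(1) A(2) by (auto simp: inj_on_def)
      moreover have "area_element X u = area (g u) * \<bar>det (matrix (g' u))\<bar>"
        using area_element_transition[OF lp uD] by (simp add: fd[OF uD(1)] g_def g'_def[abs_def])
      ultimately show ?thesis
        using True Xg[OF True] uD
        by (auto simp: F_def dens_def emb_def indicator_def ennreal_mult' mult.commute)
    next
      case False
      then show ?thesis using A(2) by (auto simp: D0_def indicator_def)
    qed
  qed
  finally show ?thesis .
qed

end

section \<open>Existence and uniqueness of the measure described by
  \<open>surface_measure\<close>\<close>

definition area_measure :: "quat set \<Rightarrow> quat measure \<Rightarrow> bool" where
  "area_measure S M \<longleftrightarrow> sets M = sets (restrict_space borel S) \<and>
    (\<forall>D X A. local_parametrization S D X \<longrightarrow> A \<in> sets borel \<longrightarrow> A \<subseteq> D \<longrightarrow>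
      emeasure M (X ` A) = (\<integral>\<^sup>+u\<in>A. ennreal (area_element X u) \<partial>lborel))"

context graph_chart
begin

text \<open>As \<open>param\<close> is itself a local parametrization, the defining property leaves
  no freedom inside the ball.\<close>

lemma emeasure_area_measure_ball:
  assumes M: "area_measure S M" and A: "A \<in> sets (restrict_space borel S)"
  shows "emeasure M (A \<inter> ball p r) = emeasure chart_measure A"
proof -
  let ?A = "{w \<in> chart_dom. emb w \<in> A}"
  have "?A = chart_dom \<inter> (emb -` A \<inter> space borel)" by auto
  then have A': "?A \<in> sets borel" using measurable_sets[OF emb_measurable A] by auto
  have AS: "A \<subseteq> S" using sets.sets_into_space[OF A] by (simp add: space_restrict_space)
  have "emeasure M (param ` ?A) = (\<integral>\<^sup>+u\<in>?A. ennreal (area_element param u) \<partial>lborel)"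
    using M local_parametrization_param A' unfolding area_measure_def by blast
  moreover have "param ` ?A = A \<inter> ball p r"
  proof (intro equalityI subsetI)
    fix x assume "x \<in> A \<inter> ball p r"
    then have x: "x \<in> A" "x \<in> S" "x \<in> ball p r" using AS by auto
    then have "snd (T x) \<in> ?A"
      using snd_T_in_dom[OF x(2,3)] param_inverse[OF x(2,3)] by (simp add: emb_def)
    then show "x \<in> param ` ?A"
      by (intro image_eqI[of x param "snd (T x)"]) (simp_all add: param_inverse[OF x(2,3)])
  next
    fix x assume "x \<in> param ` ?A"
    then obtain w where "w \<in> chart_dom" "emb w \<in> A" "x = param w" by blast
    then show "x \<in> A \<inter> ball p r" using param_in(2)[of w] by (simp add: emb_def)
  qed
  ultimately have "emeasure M (A \<inter> ball p r) = (\<integral>\<^sup>+u\<in>?A. ennreal (area_element param u) \<partial>lborel)"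
    by simp
  also have "\<dots> = (\<integral>\<^sup>+w. ennreal (dens w) * indicator A (emb w) \<partial>lborel)"
    by (intro nn_integral_cong) (auto simp: indicator_def dens_def area_element_param)
  also have "\<dots> = emeasure chart_measure A" by (rule emeasure_chart_measure[OF A, symmetric])
  finally show ?thesis .
qed

end

text \<open>Compactness leaves finitely many balls. \<open>from_nat_into\<close> enumerates them
  with repetitions along the naturals, and \<open>disjointed\<close> makes the repeated ones
  empty.\<close>

lemma surface_chart_partition:
  assumes "compact S" "smooth_surface S" "S \<noteq> {}"
  obtains P :: "nat \<Rightarrow> quat" and T :: "nat \<Rightarrow> quat \<Rightarrow> quat" and h :: "nat \<Rightarrow> real^3 \<Rightarrow> real"
    and dh :: "nat \<Rightarrow> real^3 \<Rightarrow> real^3" and r :: "nat \<Rightarrow> real" and E :: "nat \<Rightarrow> quat set"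
  where "\<And>n. graph_chart S (P n) (T n) (h n) (dh n) (r n)" "\<And>n. E n \<in> sets borel"
    "\<And>n. E n \<subseteq> ball (P n) (r n)" "disjoint_family E" "S \<subseteq> (\<Union>n. E n)"
proof -
  have "\<forall>p\<in>S. \<exists>T h dh r. graph_chart S p T h dh r"
    using smooth_surface_chart[OF assms(2)] by metis
  then obtain T h dh r where c: "\<And>p. p \<in> S \<Longrightarrow> graph_chart S p (T p) (h p) (dh p) (r p)"
    by metis
  have "S \<subseteq> (\<Union>p\<in>S. ball p (r p))"
    using graph_chart.r_pos[OF c] by fastforce
  then obtain C where C: "C \<subseteq> S" "finite C" "S \<subseteq> (\<Union>p\<in>C. ball p (r p))"
    by (rule compactE_image[OF assms(1) open_ball])
  have "C \<noteq> {}" using C(3) assms(3) by auto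
  then have ran: "range (from_nat_into C) = C"
    using C(2) by (simp add: range_from_nat_into countable_finite)
  let ?P = "from_nat_into C"
  let ?B = "\<lambda>n. ball (?P n) (r (?P n))"
  show ?thesis
  proof (rule that)
    show "graph_chart S (?P n) (T (?P n)) (h (?P n)) (dh (?P n)) (r (?P n))" for n
      using c C(1) ran by blast
    have "range (disjointed ?B) \<subseteq> sets borel" by (rule sets.range_disjointed_sets) auto
    then show "disjointed ?B n \<in> sets borel" for n by blast
    show "disjointed ?B n \<subseteq> ?B n" for n by (rule disjointed_subset)
    show "disjoint_family (disjointed ?B)" by (rule disjoint_family_disjointed)
    show "S \<subseteq> (\<Union>n. disjointed ?B n)"
    proof
      fix x assume "x \<in> S"
      then obtain p where "p \<in> C" "x \<in> ball p (r p)" using C(3) by blast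
      moreover from this obtain n where "p = ?P n" using ran by (metis imageE)
      ultimately show "x \<in> (\<Union>n. disjointed ?B n)" unfolding UN_disjointed_eq by blast
    qed
  qed
qed

text \<open>A measurable set is a countable disjoint union of parts that lie in one chart ball each,
  where the value is forced.\<close>

lemma area_measure_unique:
  assumes S: "compact S" "smooth_surface S" "S \<noteq> {}"
    and M: "area_measure S M" and N: "area_measure S N"
  shows "M = N"
proof -
  obtain P T h dh r and E :: "nat \<Rightarrow> quat set" where c: "\<And>n :: nat. graph_chart S (P n) (T n) (h n) (dh n) (r n)"
    and E[measurable]: "\<And>n. E n \<in> sets borel" and Eb: "\<And>n. E n \<subseteq> ball (P n) (r n)"
    and dE: "disjoint_family E" and UE: "S \<subseteq> (\<Union>n. E n)"
    by (rule surface_chart_partition[OF S]) (rule that)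
  have sM: "sets M = sets (restrict_space borel S)" "sets N = sets (restrict_space borel S)"
    using M N by (auto simp: area_measure_def)
  show ?thesis
  proof (rule measure_eqI)
    show "sets M = sets N" using sM by simp
    fix A assume "A \<in> sets M"
    then have A: "A \<in> sets (restrict_space borel S)" using sM by simp
    then have AS: "A \<subseteq> S" using sets.sets_into_space[OF A] by (simp add: space_restrict_space)
    have AE: "A \<inter> E n \<in> sets (restrict_space borel S)" for n
      using A E[of n] S(1) by (auto simp: sets_restrict_space_iff compact_imp_closed intro!: sets.Int)
    have sum: "emeasure L A = (\<Sum>n. emeasure L (A \<inter> E n))" if "sets L = sets (restrict_space borel S)" for L
    proof -
      have "(\<Sum>n. emeasure L (A \<inter> E n)) = emeasure L (\<Union>n. A \<inter> E n)"
        using AE that disjoint_family_subset[OF dE, of "\<lambda>n. A \<inter> E n"]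
        by (intro suminf_emeasure) auto
      also have "(\<Union>n. A \<inter> E n) = A" using UE AS by blast
      finally show ?thesis by simp
    qed
    have "emeasure M (A \<inter> E n) = emeasure N (A \<inter> E n)" for n
    proof -
      have eq: "A \<inter> E n \<inter> ball (P n) (r n) = A \<inter> E n" using Eb by blast
      show ?thesis
        using graph_chart.emeasure_area_measure_ball[OF c[of n] M AE[of n]]
          graph_chart.emeasure_area_measure_ball[OF c[of n] N AE[of n]] by (simp add: eq)
    qed
    then show "emeasure M A = emeasure N A" using sum[OF sM(1)] sum[OF sM(2)] by simp
  qed
qed

text \<open>Each chart measure is used only on its piece \<open>E n\<close>. On the part of a
  parametrized set in that piece it equals the integral of the area element of the given
  parametrization, and these integrals add up.\<close>

lemma area_measure_exists:
  assumes S: "compact S" "smooth_surface S" "S \<noteq> {}"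
  shows "\<exists>M. area_measure S M"
proof -
  obtain P T h dh r and E :: "nat \<Rightarrow> quat set" where c: "\<And>n :: nat. graph_chart S (P n) (T n) (h n) (dh n) (r n)"
    and E[measurable]: "\<And>n. E n \<in> sets borel" and Eb: "\<And>n. E n \<subseteq> ball (P n) (r n)"
    and dE: "disjoint_family E" and UE: "S \<subseteq> (\<Union>n. E n)"
    by (rule surface_chart_partition[OF S]) (rule that)
  have cl: "closed S" using S(1) by (rule compact_imp_closed)
  define L where "L n = graph_chart.chart_measure S (P n) (T n) (h n) (dh n) (r n)" for n
  have sL: "sets (L n) = sets (restrict_space borel S)" for n
    unfolding L_def by (rule graph_chart.sets_chart_measure[OF c])
  \<comment> \<open>The sum over the charts is written as an integral over counting measure, so that
    the interchange of sums is \<open>nn_integral_suminf\<close>.\<close>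
  define \<mu> where "\<mu> A = (\<integral>\<^sup>+n. emeasure (L n) (A \<inter> E n) \<partial>count_space UNIV)" for A
  define M where "M = measure_of S (sets (restrict_space borel S)) \<mu>"
  have alg: "sigma_algebra S (sets (restrict_space borel S))"
    using sets.sigma_algebra_axioms[of "restrict_space borel S"] by (simp add: space_restrict_space)
  have sM: "sets M = sets (restrict_space borel S)"
    unfolding M_def by (rule sigma_algebra.sets_measure_of_eq[OF alg])
  have AE: "A \<inter> E n \<in> sets (restrict_space borel S)" if "A \<in> sets (restrict_space borel S)" for A n
    using that E[of n] cl by (auto simp: sets_restrict_space_iff intro!: sets.Int)
  have M: "emeasure M A = \<mu> A" if "A \<in> sets (restrict_space borel S)" for A
    unfolding M_def
  proof (rule emeasure_measure_of_sigma[OF alg _ _ that])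
    show "positive (sets (restrict_space borel S)) \<mu>" by (simp add: positive_def \<mu>_def)
    show "countably_additive (sets (restrict_space borel S)) \<mu>"
    proof (rule countably_additiveI)
      fix A :: "nat \<Rightarrow> quat set"
      assume A: "range A \<subseteq> sets (restrict_space borel S)" "disjoint_family A"
      have "(\<Sum>i. \<mu> (A i)) = (\<integral>\<^sup>+n. (\<Sum>i. emeasure (L n) (A i \<inter> E n)) \<partial>count_space UNIV)"
        unfolding \<mu>_def by (rule nn_integral_suminf[symmetric]) simp
      also have "\<dots> = (\<integral>\<^sup>+n. emeasure (L n) (\<Union>i. A i \<inter> E n) \<partial>count_space UNIV)"
        using A AE sL by (intro nn_integral_cong suminf_emeasure) (auto simp: disjoint_family_on_def image_subset_iff)
      also have "\<dots> = \<mu> (\<Union>i. A i)" by (simp add: \<mu>_def)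
      finally show "(\<Sum>i. \<mu> (A i)) = \<mu> (\<Union>i. A i)" .
    qed
  qed
  have "area_measure S M"
    unfolding area_measure_def
  proof (intro conjI allI impI sM)
    fix D X A assume lp: "local_parametrization S D X" and A: "A \<in> sets borel" "A \<subseteq> D"
    have XD: "X ` D \<subseteq> S" and inj: "inj_on X D" and cX: "continuous_on D X" and oD: "open D"
      by (rule local_parametrizationE[OF lp]; blast)+
    have XA: "X ` A \<in> sets (restrict_space borel S)"
      using borel_image_parametrization[OF cl lp A] XD A(2) by (intro sets_surface[OF cl]) auto
    define A' where "A' n = {u \<in> A. X u \<in> E n}" for n
    have A': "A' n \<in> sets borel" for n
    proof -
      have m: "(\<lambda>u. if u \<in> D then X u else 0) \<in> borel_measurable borel"
        using oD cX by (intro borel_measurable_continuous_on_if) auto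
      have "A' n = A \<inter> ((\<lambda>u. if u \<in> D then X u else 0) -` E n \<inter> space borel)"
        using A(2) by (auto simp: A'_def)
      then show ?thesis using measurable_sets[OF m E[of n]] A(1) by simp
    qed
    have ar[measurable]: "(\<lambda>u. indicator D u * area_element X u) \<in> borel_measurable borel"
      using borel_measurable_continuous_on_indicator[OF _ continuous_on_area_element[OF lp]] oD by simp
    have "emeasure (L n) (X ` A \<inter> E n) = (\<integral>\<^sup>+u. ennreal (area_element X u) * indicator (A' n) u \<partial>lborel)" for n
    proof -
      have "X ` A \<inter> E n = X ` A' n" by (auto simp: A'_def)
      moreover have "{u \<in> A' n. X u \<in> ball (P n) (r n)} = A' n" using Eb[of n] unfolding A'_def by blast
      moreover have "A' n \<subseteq> D" using A(2) by (auto simp: A'_def)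
      ultimately show ?thesis
        using graph_chart.emeasure_chart_measure_image[OF c[of n] cl lp A'[of n]] by (simp add: L_def)
    qed
    then have "emeasure M (X ` A) = (\<Sum>n. \<integral>\<^sup>+u. ennreal (area_element X u) * indicator (A' n) u \<partial>lborel)"
      by (simp add: M[OF XA] \<mu>_def nn_integral_count_space_nat)
    also have "\<dots> = (\<Sum>n. \<integral>\<^sup>+u. ennreal (indicator D u * area_element X u) * indicator (A' n) u \<partial>lborel)"
      using A(2) by (intro suminf_cong nn_integral_cong) (auto simp: indicator_def A'_def)
    also have "\<dots> = (\<integral>\<^sup>+u. (\<Sum>n. ennreal (indicator D u * area_element X u) * indicator (A' n) u) \<partial>lborel)"
      by (intro nn_integral_suminf[symmetric] borel_measurable_times measurable_ennreal
          borel_measurable_indicator) (use ar A' in simp_all)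
    also have "\<dots> = (\<integral>\<^sup>+u. ennreal (area_element X u) * indicator A u \<partial>lborel)"
    proof (rule nn_integral_cong)
      fix u
      have "disjoint_family A'" using dE by (auto simp: disjoint_family_on_def A'_def)
      then have "(\<Sum>n. indicator (A' n) u :: ennreal) = indicator (\<Union>n. A' n) u" by (rule suminf_indicator)
      also have "(\<Union>n. A' n) = A" using UE XD A(2) by (auto simp: A'_def) blast
      finally show "(\<Sum>n. ennreal (indicator D u * area_element X u) * indicator (A' n) u) =
          ennreal (area_element X u) * indicator A u"
        using A(2) by (auto simp: indicator_def)
    qed
    finally show "emeasure M (X ` A) = (\<integral>\<^sup>+u\<in>A. ennreal (area_element X u) \<partial>lborel)" .
  qed
  then show ?thesis by blast
qed

lemma area_measure_surface_measure:
  assumes "compact S" "smooth_surface S" "S \<noteq> {}"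
  shows "area_measure S (surface_measure S)"
proof -
  have "\<exists>!M. area_measure S M"
    using area_measure_exists[OF assms] area_measure_unique[OF assms] by blast
  then have "area_measure S (THE M. area_measure S M)" by (rule theI')
  then show ?thesis by (simp add: surface_measure_def area_measure_def)
qed

text \<open>As \<open>f\<close> vanishes on \<open>S\<close> outside the ball, only the restriction
  of \<open>M\<close> to the ball matters; it equals \<open>chart_measure\<close>, an image of
  Lebesgue measure with density.\<close>

lemma (in graph_chart) integral_area_measure:
  fixes f :: "quat \<Rightarrow> 'b::{banach, second_countable_topology}"
  assumes cl: "closed S" and M: "area_measure S M" and f: "f \<in> borel_measurable (restrict_space borel S)"
    and f0: "\<And>x. x \<in> S \<Longrightarrow> x \<notin> ball p r \<Longrightarrow> f x = 0"
  shows "integrable M f \<longleftrightarrow> integrable lborel (\<lambda>w. dens w *\<^sub>R f (emb w))"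
    and "integral\<^sup>L M f = (\<integral>w. dens w *\<^sub>R f (emb w) \<partial>lborel)"
proof -
  have sM[measurable_cong, simp]: "sets M = sets (restrict_space borel S)" using M by (simp add: area_measure_def)
  have spM: "space M = S" using sets_eq_imp_space_eq[OF sM] by (simp add: space_restrict_space)
  have f'[measurable]: "f \<in> borel_measurable M" using f sM by (simp cong: measurable_cong_sets)
  have b[measurable]: "ball p r \<inter> S \<in> sets M" using cl by (auto simp: sets_restrict_space_iff)
  have ind[measurable]: "(indicator (ball p r \<inter> S) :: quat \<Rightarrow> real) \<in> borel_measurable M"
    by (rule borel_measurable_indicator[OF b])
  have eq: "chart_measure = density M (\<lambda>x. ennreal (indicator (ball p r \<inter> S) x))"
  proof (rule measure_eqI)
    show "sets chart_measure = sets (density M (\<lambda>x. ennreal (indicator (ball p r \<inter> S) x)))" by simp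
    fix A assume "A \<in> sets chart_measure"
    then have A: "A \<in> sets (restrict_space borel S)" by simp
    then have A': "A \<in> sets M" by simp
    have AS: "A \<subseteq> S" using sets.sets_into_space[OF A'] spM by simp
    have "emeasure (density M (\<lambda>x. ennreal (indicator (ball p r \<inter> S) x))) A = (\<integral>\<^sup>+x. indicator (A \<inter> ball p r) x \<partial>M)"
      unfolding emeasure_density[OF measurable_compose[OF ind measurable_ennreal] A']
      using AS by (intro nn_integral_cong) (auto simp: indicator_def)
    also have "\<dots> = emeasure M (A \<inter> ball p r)"
    proof -
      have "A \<inter> ball p r = A \<inter> (ball p r \<inter> S)" using AS by blast
      then have "A \<inter> ball p r \<in> sets M" using A' b by (metis sets.Int)
      then show ?thesis by simp
    qed
    finally show "emeasure chart_measure A = emeasure (density M (\<lambda>x. ennreal (indicator (ball p r \<inter> S) x))) A"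
      using emeasure_area_measure_ball[OF M A] by simp
  qed
  have ff: "indicator (ball p r \<inter> S) x *\<^sub>R f x = f x" if "x \<in> space M" for x
    using f0[of x] that spM by (auto simp: indicator_def)
  have fe: "(\<lambda>w. f (emb w)) \<in> borel_measurable lborel"
    using measurable_compose[OF emb_measurable f] by simp
  have embd: "emb \<in> measurable (density lborel (\<lambda>w. ennreal (dens w))) (restrict_space borel S)" by simp
  have "integrable M f \<longleftrightarrow> integrable chart_measure f"
    unfolding eq by (subst integrable_density) (auto cong: Bochner_Integration.integrable_cong simp: ff)
  also have "\<dots> \<longleftrightarrow> integrable lborel (\<lambda>w. dens w *\<^sub>R f (emb w))"
    unfolding chart_measure_def integrable_distr_eq[OF embd f]
    by (subst integrable_density) (auto simp: fe)
  finally show "integrable M f \<longleftrightarrow> integrable lborel (\<lambda>w. dens w *\<^sub>R f (emb w))" .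
  have "integral\<^sup>L M f = integral\<^sup>L chart_measure f"
    unfolding eq by (subst integral_density) (auto cong: Bochner_Integration.integral_cong simp: ff)
  also have "\<dots> = (\<integral>w. dens w *\<^sub>R f (emb w) \<partial>lborel)"
    unfolding chart_measure_def integral_distr[OF embd f]
    by (subst integral_density) (auto simp: fe)
  finally show "integral\<^sup>L M f = (\<integral>w. dens w *\<^sub>R f (emb w) \<partial>lborel)" .
qed

section \<open>Outward unit normal\<close>

lemma closure_eq_Un_frontier: "open G \<Longrightarrow> closure G = G \<union> frontier G"
  using closure_Un_frontier[of G] by simp

context graph_chart
begin

lemma inner_inv_T_left: "inv T x \<bullet> y = x \<bullet> T y"
  using inner_inv_T[of x "T y"] by simp

lemma area_pos [simp]: "0 < area w"
  by (simp add: area_def add_pos_nonneg)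

lemma area_squared: "(area w)\<^sup>2 = 1 + (norm (dh w))\<^sup>2"
  by (simp add: area_def)

text \<open>The normalised gradient of the height fst (T x) - h (snd (T x)); it points to the side
  above the graph.\<close>

definition normal :: "real^3 \<Rightarrow> quat" where
  "normal w = (1 / area w) *\<^sub>R inv T (1, - dh w)"

lemma norm_normal: "norm (normal w) = 1"
proof -
  have "norm (inv T (1, - dh w)) = norm ((1::real), - dh w)"
    by (rule orthogonal_transformation_norm[OF orthogonal_inv_T])
  also have "\<dots> = area w" by (simp add: norm_Pair area_def)
  finally show ?thesis using area_pos[of w] by (simp add: normal_def del: area_pos)
qed

lemma inner_normal: "normal w \<bullet> v = (fst (T v) - dh w \<bullet> snd (T v)) / area w"
  unfolding normal_def inner_scaleR_left inner_inv_T_left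
  by (simp add: inner_prod_def diff_divide_distrib)

lemma p_eq_param: "param (snd (T p)) = p"
  by (rule param_inverse[OF p_in]) (simp add: r_pos)

lemma snd_T_p_in_dom: "snd (T p) \<in> chart_dom"
  by (rule snd_T_in_dom[OF p_in]) (simp add: r_pos)

text \<open>The derivative of the height along its own unit gradient is the length of the gradient,
  \<open>area\<close>. The factor \<open>c\<close> lets one lemma serve both the outward and the
  inward direction.\<close>

lemma height_derivative:
  "((\<lambda>t. fst (T (p + (t * c) *\<^sub>R normal (snd (T p)))) - h (snd (T (p + (t * c) *\<^sub>R normal (snd (T p))))))
    has_real_derivative c * area (snd (T p))) (at 0)"
proof -
  define u0 where "u0 = snd (T p)"
  define b where "b = c / area u0"
  have Tt: "T (p + (t * c) *\<^sub>R normal u0) = (fst (T p) + t * b, u0 - (t * b) *\<^sub>R dh u0)" for t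
    using linear_add[OF linear_T] linear_scale[OF linear_T] by (simp add: normal_def u0_def b_def prod_eq_iff)
  have "((\<lambda>t. fst (T p) + t * b - h (u0 - (t * b) *\<^sub>R dh u0)) has_derivative
      (\<lambda>t. t * b - dh u0 \<bullet> (- ((t * b) *\<^sub>R dh u0)))) (at 0)"
  proof (rule has_derivative_diff)
    show "((\<lambda>t. fst (T p) + t * b) has_derivative (\<lambda>t. t * b)) (at 0)"
      by (auto intro!: derivative_eq_intros)
    have d: "((\<lambda>t. u0 - (t * b) *\<^sub>R dh u0) has_derivative (\<lambda>t. - ((t * b) *\<^sub>R dh u0))) (at 0)"
      by (auto intro!: derivative_eq_intros)
    have "(h has_derivative (\<lambda>v. dh u0 \<bullet> v)) (at (u0 - (0 * b) *\<^sub>R dh u0))"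
      using h[of u0] r_pos by (simp add: u0_def)
    then show "((\<lambda>t. h (u0 - (t * b) *\<^sub>R dh u0)) has_derivative (\<lambda>t. dh u0 \<bullet> (- ((t * b) *\<^sub>R dh u0)))) (at 0)"
      by (rule has_derivative_compose[OF d])
  qed
  moreover have "t * b - dh u0 \<bullet> (- ((t * b) *\<^sub>R dh u0)) = c * area u0 * t" for t
  proof -
    have "t * b - dh u0 \<bullet> (- ((t * b) *\<^sub>R dh u0)) = t * b * (area u0)\<^sup>2"
      by (simp add: area_squared power2_norm_eq_inner algebra_simps)
    also have "\<dots> = c * area u0 * t"
      using area_pos[of u0] by (simp add: b_def power2_eq_square)
    finally show ?thesis .
  qed
  ultimately show ?thesis
    unfolding has_field_derivative_def Tt[unfolded u0_def] fst_conv snd_conv u0_def by simp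
qed

lemma eventually_in_ball: "\<forall>\<^sub>F t in at_right 0. p + (t * c) *\<^sub>R n \<in> ball p r"
proof -
  have "((\<lambda>t. p + (t * c) *\<^sub>R n) \<longlongrightarrow> p + (0 * c) *\<^sub>R n) (at_right 0)"
    by (intro tendsto_intros)
  then show ?thesis
    by (rule topological_tendstoD) (use r_pos in auto)
qed

end

context domain_chart
begin

lemma closure_iff:
  assumes "open G" "x \<in> ball p r"
  shows "x \<in> closure G \<longleftrightarrow> fst (T x) \<le> h (snd (T x))"
  unfolding closure_eq_Un_frontier[OF assms(1)] Un_iff below[OF assms(2)] graph[OF assms(2)] by argo

text \<open>Orthogonality to the tangent space fixes a unit vector up to sign, and the sign of the
  height derivative tells which of the two leaves the closure.\<close>

lemma outward_unit_normal_center: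
  assumes G: "open G"
  shows "outward_unit_normal G p = normal (snd (T p))"
proof -
  let ?n = "normal (snd (T p))"
  let ?k = "\<lambda>c t. fst (T (p + (t * c) *\<^sub>R ?n)) - h (snd (T (p + (t * c) *\<^sub>R ?n)))"
  have k0: "?k c 0 = 0" for c using p_eq by simp
  have out: "\<forall>\<^sub>F t in at_right 0. p + (t * c) *\<^sub>R ?n \<notin> closure G" if "c > 0" for c
  proof -
    have "0 < c * area (snd (T p))" using that by simp
    from DERIV_pos_inc_right[OF height_derivative this] obtain d where
      d: "d > 0" "\<And>t. 0 < t \<Longrightarrow> t < d \<Longrightarrow> ?k c 0 < ?k c (0 + t)" by blast
    have "\<forall>\<^sub>F t in at_right 0. ?k c t > 0"
      unfolding eventually_at_right_field using d k0[of c] by (intro exI[of _ d]) auto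
    then show ?thesis
      using eventually_in_ball[of c ?n]
    proof eventually_elim
      case (elim t)
      then show ?case using closure_iff[OF G elim(2)] by argo
    qed
  qed
  \<comment> \<open>This direction serves to reject the opposite unit vector in the uniqueness
    part.\<close>
  have inn: "\<forall>\<^sub>F t in at_right 0. p + (t * c) *\<^sub>R ?n \<in> closure G" if "c < 0" for c
  proof -
    have "c * area (snd (T p)) < 0" using that by (simp add: mult_neg_pos)
    from DERIV_neg_dec_right[OF height_derivative this] obtain d where
      d: "d > 0" "\<And>t. 0 < t \<Longrightarrow> t < d \<Longrightarrow> ?k c 0 > ?k c (0 + t)" by blast
    have "\<forall>\<^sub>F t in at_right 0. ?k c t < 0"
      unfolding eventually_at_right_field using d k0[of c] by (intro exI[of _ d]) auto
    then show ?thesis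
      using eventually_in_ball[of c ?n]
    proof eventually_elim
      case (elim t)
      then show ?case using closure_iff[OF G elim(2)] by argo
    qed
  qed
  show ?thesis
    unfolding outward_unit_normal_def
  proof (rule the_equality)
    show "norm ?n = 1 \<and>
      (\<forall>D X u v. local_parametrization (frontier G) D X \<longrightarrow> u \<in> D \<longrightarrow> X u = p \<longrightarrow>
        ?n \<bullet> frechet_derivative X (at u) v = 0) \<and>
      (\<forall>\<^sub>F t in at_right 0. p + t *\<^sub>R ?n \<notin> closure G)"
    proof (intro conjI allI impI norm_normal)
      show "\<forall>\<^sub>F t in at_right 0. p + t *\<^sub>R ?n \<notin> closure G" using out[of 1] by simp
      fix D X u v assume lp: "local_parametrization (frontier G) D X" and u: "u \<in> D" "X u = p"
      obtain DX :: "real^3 \<Rightarrow> ((real^3) \<Rightarrow>\<^sub>L quat)" where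
        D: "open D" "X ` D \<subseteq> frontier G" and DX: "\<And>u. u \<in> D \<Longrightarrow> (X has_derivative DX u) (at u)"
        and fd: "\<And>u. u \<in> D \<Longrightarrow> frechet_derivative X (at u) = DX u"
        by (rule local_parametrizationE[OF lp]) (rule that; blast)
      have "fst (T (DX u v)) = dh (snd (T (X u))) \<bullet> snd (T (DX u v))"
        by (rule tangent[OF DX[OF u(1)] D(1) u(1) D(2)]) (simp add: u r_pos)
      then show "?n \<bullet> frechet_derivative X (at u) v = 0"
        by (simp add: inner_normal fd[OF u(1)] u(2))
    qed
  next
    fix n assume n: "norm n = 1 \<and>
      (\<forall>D X u v. local_parametrization (frontier G) D X \<longrightarrow> u \<in> D \<longrightarrow> X u = p \<longrightarrow>
        n \<bullet> frechet_derivative X (at u) v = 0) \<and>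
      (\<forall>\<^sub>F t in at_right 0. p + t *\<^sub>R n \<notin> closure G)"
    define u0 where "u0 = snd (T p)"
    have fd: "frechet_derivative param (at u0) = (\<lambda>v. inv T (dh u0 \<bullet> v, v))"
      using frechet_derivative_at[OF has_derivative_param[OF dom_ball[OF snd_T_p_in_dom]]] by (simp add: u0_def)
    \<comment> \<open>The graph parametrization alone supplies all tangent directions and determines
      \<open>n\<close> up to a scalar.\<close>
    have "n \<bullet> frechet_derivative param (at u0) v = 0" for v
      using n local_parametrization_param snd_T_p_in_dom p_eq_param unfolding u0_def by blast
    then have ort: "T n \<bullet> (dh u0 \<bullet> v, v) = 0" for v
      unfolding fd by (simp add: inner_commute[of n] inner_inv_T_left) (simp add: inner_commute)
    define \<alpha> \<beta> where "\<alpha> = fst (T n)" and "\<beta> = snd (T n)"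
    have "(\<alpha> *\<^sub>R dh u0 + \<beta>) \<bullet> v = 0" for v
      using ort[of v] by (simp add: \<alpha>_def \<beta>_def inner_prod_def inner_add_left)
    then have "\<alpha> *\<^sub>R dh u0 + \<beta> = 0" by (metis inner_eq_zero_iff)
    then have "\<beta> = - (\<alpha> *\<^sub>R dh u0)" by (simp add: eq_neg_iff_add_eq_0 add.commute)
    then have "T n = \<alpha> *\<^sub>R (1, - dh u0)" by (simp add: \<alpha>_def \<beta>_def prod_eq_iff)
    then have "n = inv T (\<alpha> *\<^sub>R (1, - dh u0))" by (metis inv_T)
    also have "\<dots> = \<alpha> *\<^sub>R inv T (1, - dh u0)"
      by (rule linear_scale[OF bounded_linear.linear[OF bounded_linear_inv_T]])
    also have "\<dots> = (\<alpha> * area u0) *\<^sub>R normal u0" using area_pos[of u0] by (simp add: normal_def del: area_pos)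
    finally have n_eq: "n = (\<alpha> * area u0) *\<^sub>R ?n" by (simp add: u0_def)
    then have "\<bar>\<alpha> * area u0\<bar> = 1"
      using n norm_normal[of "snd (T p)"] norm_scaleR[of "\<alpha> * area u0" ?n] by simp
    moreover have "\<not> \<alpha> * area u0 < 0"
    proof
      assume "\<alpha> * area u0 < 0"
      then have "\<forall>\<^sub>F t in at_right 0. p + (t * (\<alpha> * area u0)) *\<^sub>R ?n \<in> closure G" by (rule inn)
      moreover have "\<forall>\<^sub>F t in at_right 0. p + (t * (\<alpha> * area u0)) *\<^sub>R ?n \<notin> closure G"
        using n n_eq by (simp add: scaleR_scaleR[symmetric] del: scaleR_scaleR)
      ultimately have "\<forall>\<^sub>F t in at_right (0::real). False" by eventually_elim simp
      then show False by simp
    qed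
    ultimately have "\<alpha> * area u0 = 1" by linarith
    then show "n = ?n" using n_eq by simp
  qed
qed

lemma outward_unit_normal_eq:
  assumes G: "open G" and x: "x \<in> frontier G" "x \<in> ball p r"
  shows "outward_unit_normal G x = normal (snd (T x))"
proof -
  have d: "0 < r - dist p x" using x(2) by simp
  interpret q: domain_chart G x T h dh "r - dist p x"
    by (rule domain_chart_at[OF x(1) d]) simp
  show ?thesis
    using q.outward_unit_normal_center[OF G] by (simp add: q.normal_def normal_def q.area_def area_def)
qed

end

text \<open>Supplies the measurability of boundary integrands. Continuity is local, and in a chart
  the normal is a continuous expression in the gradient \<open>dh\<close>.\<close>

lemma continuous_on_outward_unit_normal:
  assumes G: "open G" "connected G" "bounded G" and sm: "smooth_surface (frontier G)"
  shows "continuous_on (frontier G) (outward_unit_normal G)"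
  unfolding continuous_on_eq_continuous_within
proof
  fix p assume p: "p \<in> frontier G"
  obtain T h dh r where "domain_chart G p T h dh r" by (rule domain_chart_exists[OF G sm p])
  then interpret domain_chart G p T h dh r .
  have c: "continuous_on (frontier G \<inter> ball p r) (\<lambda>x. normal (snd (T x)))"
  proof -
    have n: "continuous_on (ball (snd (T p)) r) normal"
      unfolding normal_def area_def
      by (intro continuous_intros dh) (simp add: add_pos_nonneg less_imp_neq[symmetric])
    show ?thesis
    proof (rule continuous_on_compose2[OF n])
      show "(\<lambda>x. snd (T x)) ` (frontier G \<inter> ball p r) \<subseteq> ball (snd (T p)) r"
        using snd_T_in_ball by blast
    qed (intro continuous_intros)
  qed
  have "continuous_on (frontier G \<inter> ball p r) (outward_unit_normal G)"
    by (rule continuous_on_eq[OF c]) (simp add: outward_unit_normal_eq[OF G(1)])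
  then have "continuous (at p within frontier G \<inter> ball p r) (outward_unit_normal G)"
    using p r_pos by (simp add: continuous_on_eq_continuous_within)
  moreover have "at p within frontier G \<inter> ball p r = at p within frontier G"
    by (rule at_within_nhd[of p "ball p r"]) (use r_pos in auto)
  ultimately show "continuous (at p within frontier G) (outward_unit_normal G)" by simp
qed

section \<open>The Gauss-Green theorem\<close>

text \<open>The derivative is an explicit argument so that product rules compute it, and its
  continuity is stated direction by direction, without operator norms. On the boundary
  \<open>D\<close> is a limit of derivatives, not a derivative.\<close>

definition has_C1_extension ::
    "'a::real_normed_vector set \<Rightarrow> ('a \<Rightarrow> 'b::real_normed_vector) \<Rightarrow> ('a \<Rightarrow> 'a \<Rightarrow> 'b) \<Rightarrow> bool"
  where "has_C1_extension G f D \<longleftrightarrow> continuous_on (closure G) f \<and>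
    (\<forall>x\<in>G. (f has_derivative D x) (at x)) \<and> (\<forall>v. continuous_on (closure G) (\<lambda>x. D x v))"

text \<open>Compactness of the closure bounds the derivative in each basis direction; linearity
  combines the bounds.\<close>

lemma has_C1_extension_bounded:
  fixes f :: "'a::euclidean_space \<Rightarrow> 'b::real_normed_vector"
  assumes f: "has_C1_extension G f D" and G: "bounded G"
  obtains B where "B \<ge> 0" "\<And>x v. x \<in> G \<Longrightarrow> norm (D x v) \<le> B * norm v"
proof -
  have "compact (closure G)" using G by (simp add: compact_closure)
  then have "bounded ((\<lambda>x. D x b) ` closure G)" for b
    using f by (intro compact_imp_bounded compact_continuous_image) (auto simp: has_C1_extension_def)
  then have "\<exists>C. \<forall>x\<in>closure G. norm (D x b) \<le> C" for b by (auto simp: bounded_iff)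
  then obtain C where C: "\<And>b x. x \<in> closure G \<Longrightarrow> norm (D x b) \<le> C b" by metis
  define B where "B = (\<Sum>b\<in>Basis. \<bar>C b\<bar>)"
  have "norm (D x v) \<le> B * norm v" if x: "x \<in> G" for x v
  proof -
    have lin: "linear (D x)" using f x by (auto simp: has_C1_extension_def intro: has_derivative_linear)
    have "D x v = D x (\<Sum>b\<in>Basis. (v \<bullet> b) *\<^sub>R b)" by (simp add: euclidean_representation)
    also have "\<dots> = (\<Sum>b\<in>Basis. (v \<bullet> b) *\<^sub>R D x b)" by (simp add: linear_sum[OF lin] linear_scale[OF lin])
    finally have "norm (D x v) \<le> (\<Sum>b\<in>Basis. norm ((v \<bullet> b) *\<^sub>R D x b))" by (simp only: norm_sum)
    also have "\<dots> \<le> (\<Sum>b\<in>Basis. norm v * \<bar>C b\<bar>)"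
    proof (rule sum_mono)
      fix b :: 'a assume b: "b \<in> Basis"
      have "norm (D x b) \<le> \<bar>C b\<bar>" using C[of x b] x closure_subset[of G] by force
      then show "norm ((v \<bullet> b) *\<^sub>R D x b) \<le> norm v * \<bar>C b\<bar>"
        using Basis_le_norm[OF b, of v] by (simp add: mult_mono)
    qed
    finally show ?thesis by (simp add: B_def sum_distrib_left mult.commute)
  qed
  moreover have "B \<ge> 0" by (simp add: B_def sum_nonneg)
  ultimately show ?thesis using that by blast
qed

lemma has_C1_extension_zero_derivative:
  assumes f: "has_C1_extension G f D" and K: "closed K" "\<And>x. x \<notin> K \<Longrightarrow> f x = 0" and x: "x \<in> G" "x \<notin> K"
  shows "D x v = 0"
proof -
  have "(f has_derivative (\<lambda>v. 0)) (at x)"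
    by (rule has_derivative_transform_within_open[of "\<lambda>_. 0" _ _ _ "- K"]) (use K x in auto)
  moreover have "(f has_derivative D x) (at x)" using f x by (simp add: has_C1_extension_def)
  ultimately have "D x = (\<lambda>v. 0)" by (rule has_derivative_unique[rotated])
  then show ?thesis by simp
qed

text \<open>After rotation by \<open>T\<close> this is \<open>gauss_green_subgraph\<close>.
  \<open>G\<close> and the region below the graph agree only in the chart ball, which suffices
  because the field is supported there.\<close>

lemma (in domain_chart) gauss_green_local:
  fixes k :: "quat \<Rightarrow> 'b::euclidean_space"
  assumes G: "open G" "bounded G" and M: "area_measure (frontier G) M"
    and n: "continuous_on (frontier G) (outward_unit_normal G)"
    and k: "has_C1_extension G k Dk"
    and K: "compact K" "K \<subseteq> ball p r" and k0: "\<And>x. x \<notin> K \<Longrightarrow> k x = 0"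
  shows "integrable lborel (\<lambda>x. indicator G x *\<^sub>R Dk x v)"
    and "integrable M (\<lambda>x. (outward_unit_normal G x \<bullet> v) *\<^sub>R k x)"
    and "(\<integral>x. indicator G x *\<^sub>R Dk x v \<partial>lborel) = (\<integral>x. (outward_unit_normal G x \<bullet> v) *\<^sub>R k x \<partial>M)"
proof -
  let ?S = "frontier G"
  define Q where "Q = ball (snd (T p)) r"
  define w where "w y = k (inv T y)" for y
  \<comment> \<open>Outside the rotated ball points below the graph need not come from
    \<open>G\<close>, so \<open>Dk\<close> says nothing about them; the field is 0 near them, and so
    is its derivative.\<close>
  define Dw where "Dw y x = (if inv T y \<in> ball p r then Dk (inv T y) (inv T x) else 0)" for y x
  define Lo where "Lo = {y. snd y \<in> Q \<and> fst y < h (snd y)}"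
  define S0 where "S0 = {y. snd y \<in> Q \<and> fst y \<le> h (snd y)}"
  define Ob where "Ob = {y. inv T y \<in> ball p r}"
  have kc: "continuous_on (closure G) k" and kd: "\<And>x. x \<in> G \<Longrightarrow> (k has_derivative Dk x) (at x)"
    and Dkc: "\<And>v. continuous_on (closure G) (\<lambda>x. Dk x v)"
    using k by (auto simp: has_C1_extension_def)
  have clK: "closed K" using K(1) by (rule compact_imp_closed)
  have Dk0: "Dk x u = 0" if "x \<in> G" "x \<notin> K" for x u
    by (rule has_C1_extension_zero_derivative[OF k clK k0 that])
  have cinv: "continuous_on A (inv T)" for A
    using continuous_on_inv_T[OF continuous_on_id] by (simp add: id_def)
  have cT: "continuous_on A T" for A
    using continuous_on_T[OF continuous_on_id] by (simp add: id_def)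
  have oOb: "open Ob" using open_vimage[OF open_ball cinv] by (simp add: Ob_def vimage_def)
  have cK': "compact (T ` K)" by (intro compact_continuous_image cT K(1))
  have oK': "open (- T ` K)" using compact_imp_closed[OF cK'] by (simp add: open_Compl)
  have TK: "y \<in> T ` K \<longleftrightarrow> inv T y \<in> K" for y
  proof
    assume "inv T y \<in> K"
    then have "T (inv T y) \<in> T ` K" by (rule imageI)
    then show "y \<in> T ` K" by simp
  qed auto
  have cov: "y \<in> Ob \<or> y \<in> - T ` K" for y using TK K(2) by (auto simp: Ob_def)
  have LoG: "inv T y \<in> G" if "y \<in> Lo" "y \<in> Ob" for y
    using below[of "inv T y"] that by (simp add: Lo_def Ob_def)
  have S0G: "inv T y \<in> closure G" if "y \<in> S0" "y \<in> Ob" for y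
    using closure_iff[OF G(1), of "inv T y"] that by (simp add: S0_def Ob_def)
  obtain B where B: "B \<ge> 0" "\<And>x v. x \<in> G \<Longrightarrow> norm (Dk x v) \<le> B * norm v"
    by (rule has_C1_extension_bounded[OF k G(2)]) (rule that)
  have normi: "norm (inv T x) = norm x" for x by (rule orthogonal_transformation_norm[OF orthogonal_inv_T])
  obtain C1 where "\<forall>x\<in>h ` Q. norm x \<le> C1" using bounded_h unfolding bounded_iff Q_def by blast
  then have C1: "\<bar>h u\<bar> \<le> C1" if "u \<in> Q" for u using that by auto
  obtain C2 where "\<forall>x\<in>dh ` Q. norm x \<le> C2" using bounded_dh unfolding bounded_iff Q_def by blast
  then have C2: "norm (dh u) \<le> C2" if "u \<in> Q" for u using that by auto
  define C where "C = max C1 C2"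
  have Q: "open Q" by (simp add: Q_def)
  have hd: "(h has_derivative (\<lambda>v. dh u \<bullet> v)) (at u)" if "u \<in> Q" for u using h that by (simp add: Q_def)
  have dhc: "continuous_on Q (\<lambda>u. dh u \<bullet> x)" for x
    using dh by (intro continuous_intros) (simp add: Q_def)
  have hC: "\<bar>h u\<bar> \<le> C" if "u \<in> Q" for u using C1[OF that] by (simp add: C_def)
  have dhC: "\<bar>dh u \<bullet> x\<bar> \<le> C * norm x" if "u \<in> Q" for u x
  proof -
    have "\<bar>dh u \<bullet> x\<bar> \<le> norm (dh u) * norm x" by (rule Cauchy_Schwarz_ineq2)
    also have "\<dots> \<le> C * norm x" using C2[OF that] by (intro mult_right_mono) (auto simp: C_def)
    finally show ?thesis .
  qed
  have sK: "snd ` T ` K \<subseteq> Q" using K(2) snd_T_in_ball[of _ p r] by (auto simp: Q_def simp del: mem_ball)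
  have w0: "w y = 0" if "y \<notin> T ` K" for y using k0 that TK by (simp add: w_def)
  have wd: "(w has_derivative Dw y) (at y)" if y: "y \<in> {y. snd y \<in> Q \<and> fst y < h (snd y)}" for y
  proof (cases "y \<in> Ob")
    case True
    have "(k has_derivative Dk (inv T y)) (at (inv T y))" using kd LoG y True by (auto simp: Lo_def)
    then have "(w has_derivative (\<lambda>x. Dk (inv T y) (inv T x))) (at y)"
      unfolding w_def
      by (intro has_derivative_compose[OF bounded_linear.has_derivative[OF bounded_linear_inv_T has_derivative_ident]])
    then show ?thesis using True by (simp add: Dw_def[abs_def] Ob_def)
  next
    case False
    then have "y \<in> - T ` K" using cov by blast
    then have "(w has_derivative (\<lambda>v. 0)) (at y)"
      by (intro has_derivative_transform_within_open[of "\<lambda>_. 0" _ _ _ "- T ` K" w, OF _ oK']) (use w0 in auto)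
    then show ?thesis using False by (simp add: Dw_def[abs_def] Ob_def)
  qed
  have wc: "continuous_on {y. snd y \<in> Q \<and> fst y \<le> h (snd y)} w"
  proof -
    \<comment> \<open>Two relatively open pieces: in the rotated ball continuity comes from the
      closure of \<open>G\<close>, and off the support \<open>w\<close> is 0.\<close>
    have eq: "S0 = (S0 \<inter> Ob) \<union> (S0 \<inter> - T ` K)" using cov by blast
    have "continuous_on ((S0 \<inter> Ob) \<union> (S0 \<inter> - T ` K)) w"
    proof (rule continuous_on_Un_local_open)
      show "openin (top_of_set (S0 \<inter> Ob \<union> S0 \<inter> - T ` K)) (S0 \<inter> Ob)"
        unfolding eq[symmetric] by (rule openin_open_Int[OF oOb])
      show "openin (top_of_set (S0 \<inter> Ob \<union> S0 \<inter> - T ` K)) (S0 \<inter> - T ` K)"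
        unfolding eq[symmetric] by (rule openin_open_Int[OF oK'])
      show "continuous_on (S0 \<inter> Ob) w"
        unfolding w_def by (rule continuous_on_compose2[OF kc cinv]) (use S0G in auto)
      show "continuous_on (S0 \<inter> - T ` K) w"
        by (rule continuous_on_eq[of _ "\<lambda>_. 0"]) (use w0 in auto)
    qed
    then show ?thesis using eq by (simp add: S0_def)
  qed
  have Dc: "continuous_on {y. snd y \<in> Q \<and> fst y < h (snd y)} (\<lambda>y. Dw y x)" for x
  proof -
    have eq: "Lo = (Lo \<inter> Ob) \<union> (Lo \<inter> - T ` K)" using cov by blast
    have "continuous_on ((Lo \<inter> Ob) \<union> (Lo \<inter> - T ` K)) (\<lambda>y. Dw y x)"
    proof (rule continuous_on_Un_local_open)
      show "openin (top_of_set (Lo \<inter> Ob \<union> Lo \<inter> - T ` K)) (Lo \<inter> Ob)"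
        unfolding eq[symmetric] by (rule openin_open_Int[OF oOb])
      show "openin (top_of_set (Lo \<inter> Ob \<union> Lo \<inter> - T ` K)) (Lo \<inter> - T ` K)"
        unfolding eq[symmetric] by (rule openin_open_Int[OF oK'])
      have "continuous_on (Lo \<inter> Ob) (\<lambda>y. Dk (inv T y) (inv T x))"
        by (rule continuous_on_compose2[OF Dkc cinv]) (use LoG closure_subset in blast)
      then show "continuous_on (Lo \<inter> Ob) (\<lambda>y. Dw y x)"
        by (rule continuous_on_eq) (simp add: Dw_def Ob_def)
      show "continuous_on (Lo \<inter> - T ` K) (\<lambda>y. Dw y x)"
        by (rule continuous_on_eq[of _ "\<lambda>_. 0"]) (use LoG Dk0 TK in \<open>auto simp: Dw_def Ob_def\<close>)
    qed
    then show ?thesis using eq by (simp add: Lo_def)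
  qed
  have Db: "norm (Dw y x) \<le> B * norm x" if "y \<in> {y. snd y \<in> Q \<and> fst y < h (snd y)}" for y x
    using B(2)[OF LoG, of y "inv T x"] that B(1) by (auto simp: Dw_def Lo_def Ob_def normi)
  note gg = gauss_green_subgraph[where w = w and Dw = Dw and B = B and K = "T ` K" and C = C and h = h
      and dh = "\<lambda>u v. dh u \<bullet> v" and Q = Q and v = "T v",
      OF Q hd dhc hC dhC cK' sK w0 wd wc Dc Db]
  define \<Phi> where "\<Phi> y = indicator Lo y *\<^sub>R Dw y (T v)" for y
  have \<Phi>T: "\<Phi> (T x) = indicator G x *\<^sub>R Dk x v" for x
  proof (cases "x \<in> ball p r")
    case True
    then have "snd (T x) \<in> Q" unfolding Q_def by (rule snd_T_in_ball)
    then have "T x \<in> Lo \<longleftrightarrow> x \<in> G" using below[OF True] by (simp add: Lo_def)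
    then show ?thesis using True by (simp add: \<Phi>_def Dw_def indicator_def)
  next
    case False
    then have "x \<notin> K" using K(2) by blast
    then show ?thesis using False Dk0 by (simp add: \<Phi>_def Dw_def indicator_def)
  qed
  have \<Phi>i: "integrable lborel \<Phi>" using gg(1) by (simp add: \<Phi>_def[abs_def] Lo_def)
  then have \<Phi>m[measurable]: "\<Phi> \<in> borel_measurable borel" by simp
  have Tm: "T \<in> measurable lborel borel"
    using borel_measurable_continuous_onI[OF cT] by simp
  note dl = distr_lborel_orthogonal_transformation[OF T]
  have "integrable (distr lborel borel T) \<Phi>" using \<Phi>i by (simp add: dl)
  then show "integrable lborel (\<lambda>x. indicator G x *\<^sub>R Dk x v)"
    unfolding integrable_distr_eq[OF Tm \<Phi>m] by (simp add: \<Phi>T)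
  have int: "(\<integral>x. indicator G x *\<^sub>R Dk x v \<partial>lborel) = (\<integral>y. \<Phi> y \<partial>lborel)"
    using integral_distr[OF Tm \<Phi>m] by (simp add: dl \<Phi>T)
  define f where "f x = (outward_unit_normal G x \<bullet> v) *\<^sub>R k x" for x
  have "continuous_on ?S k"
    by (rule continuous_on_subset[OF kc]) (simp add: frontier_def)
  then have fm: "f \<in> borel_measurable (restrict_space borel ?S)"
    unfolding f_def by (intro borel_measurable_continuous_on_restrict continuous_intros n)
  have f0: "f x = 0" if "x \<in> ?S" "x \<notin> ball p r" for x
  proof -
    have "x \<notin> K" using that(2) K(2) by blast
    then show ?thesis by (simp add: f_def k0)
  qed
  \<comment> \<open>The surface density \<open>area u\<close> cancels the same root in the
    denominator of the normal, which leaves the weight of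
    \<open>gauss_green_subgraph\<close>.\<close>
  have bd: "dens u *\<^sub>R f (emb u) = indicator Q u *\<^sub>R (fst (T v) - dh u \<bullet> snd (T v)) *\<^sub>R w (h u, u)" for u
  proof (cases "u \<in> chart_dom")
    case True
    have "outward_unit_normal G (param u) = normal u"
      using outward_unit_normal_eq[OF G(1) param_in(1)[OF True] param_in(2)[OF True]] by simp
    then have "dens u *\<^sub>R f (emb u) = (area u * ((fst (T v) - dh u \<bullet> snd (T v)) / area u)) *\<^sub>R k (param u)"
      using True by (simp add: dens_def emb_def f_def inner_normal)
    also have "\<dots> = indicator Q u *\<^sub>R (fst (T v) - dh u \<bullet> snd (T v)) *\<^sub>R w (h u, u)"
      using dom_ball[OF True] area_pos[of u]
      by (simp add: Q_def w_def param_def indicator_def del: area_pos mem_ball)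
    finally show ?thesis .
  next
    case False
    have "w (h u, u) = 0" if "u \<in> Q"
    proof -
      have "param u \<notin> ball p r" using False that by (simp add: chart_dom_def Q_def)
      then have "param u \<notin> K" using K(2) by blast
      then show ?thesis using k0 by (simp add: w_def param_def)
    qed
    then show ?thesis using False by (auto simp: dens_def indicator_def)
  qed
  note ia = integral_area_measure[OF frontier_closed M fm f0]
  have "integrable lborel (\<lambda>u. dens u *\<^sub>R f (emb u))" using gg(2) by (simp add: bd)
  then show "integrable M (\<lambda>x. (outward_unit_normal G x \<bullet> v) *\<^sub>R k x)"
    using ia(1) by (simp add: f_def)
  show "(\<integral>x. indicator G x *\<^sub>R Dk x v \<partial>lborel) = (\<integral>x. (outward_unit_normal G x \<bullet> v) *\<^sub>R k x \<partial>M)"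
  proof -
    have "(\<integral>y. \<Phi> y \<partial>lborel) = (\<integral>u. dens u *\<^sub>R f (emb u) \<partial>lborel)"
      unfolding \<Phi>_def Lo_def bd by (rule gg(3))
    also have "\<dots> = integral\<^sup>L M f" by (rule ia(2)[symmetric])
    finally show ?thesis unfolding int by (simp add: f_def[abs_def])
  qed
qed

section \<open>Products, quotients and cutoffs up to the boundary\<close>

lemma has_C1_extension_bilinear:
  assumes "bounded_bilinear bil" "has_C1_extension G f Df" "has_C1_extension G g Dg"
  shows "has_C1_extension G (\<lambda>x. bil (f x) (g x)) (\<lambda>x v. bil (f x) (Dg x v) + bil (Df x v) (g x))"
  using assms(2,3) unfolding has_C1_extension_def
  by (auto intro!: bounded_bilinear.FDERIV[OF assms(1)] continuous_on_add
      bounded_bilinear.continuous_on[OF assms(1)])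

lemma has_C1_extension_sum:
  assumes "\<And>i. i \<in> I \<Longrightarrow> has_C1_extension G (f i) (Df i)"
  shows "has_C1_extension G (\<lambda>x. \<Sum>i\<in>I. f i x) (\<lambda>x v. \<Sum>i\<in>I. Df i x v)"
  using assms unfolding has_C1_extension_def
  by (auto intro!: has_derivative_sum continuous_on_sum)

lemma has_C1_extension_inverse:
  fixes s :: "'a::real_normed_vector \<Rightarrow> real"
  assumes s: "has_C1_extension G s Ds" and nz: "\<And>x. x \<in> closure G \<Longrightarrow> s x \<noteq> 0"
  shows "has_C1_extension G (\<lambda>x. inverse (s x)) (\<lambda>x v. - (inverse (s x) * Ds x v * inverse (s x)))"
  unfolding has_C1_extension_def
proof (intro conjI ballI allI)
  show "continuous_on (closure G) (\<lambda>x. inverse (s x))"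
    using s nz by (auto simp: has_C1_extension_def intro!: continuous_on_inverse)
  then show "continuous_on (closure G) (\<lambda>x. - (inverse (s x) * Ds x v * inverse (s x)))" for v
    using s by (auto simp: has_C1_extension_def intro!: continuous_intros)
  fix x assume x: "x \<in> G"
  then have "s x \<noteq> 0" using nz closure_subset by blast
  then show "((\<lambda>x. inverse (s x)) has_derivative (\<lambda>v. - (inverse (s x) * Ds x v * inverse (s x)))) (at x)"
    using s x by (auto simp: has_C1_extension_def intro!: has_derivative_inverse)
qed

text \<open>Squaring the positive part removes its corner at 0. The resulting cutoffs are
  \<open>C^1\<close>, which is all the regularity that the partition of unity must have.\<close>

lemma has_real_derivative_max_0_squared:
  "((\<lambda>t::real. (max 0 t)\<^sup>2) has_real_derivative 2 * max 0 t) (at t)"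
proof (cases t "0 :: real" rule: linorder_cases)
  case less
  have "((\<lambda>t::real. 0) has_real_derivative 0) (at t)" by simp
  then have "((\<lambda>t::real. (max 0 t)\<^sup>2) has_real_derivative 0) (at t)"
    by (rule has_field_derivative_transform_within_open[of _ _ _ "{..<0}"]) (use less in auto)
  then show ?thesis using less by simp
next
  case greater
  have "((\<lambda>t::real. t\<^sup>2) has_real_derivative 2 * t) (at t)" by (auto intro!: derivative_eq_intros)
  then have "((\<lambda>t::real. (max 0 t)\<^sup>2) has_real_derivative 2 * t) (at t)"
    by (rule has_field_derivative_transform_within_open[of _ _ _ "{0<..}"]) (use greater in auto)
  then show ?thesis using greater by simp
next
  case equal
  have "((\<lambda>h::real. ((max 0 (0 + h))\<^sup>2 - (max 0 0)\<^sup>2) / h) \<longlongrightarrow> 0) (at 0)"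
  proof (rule Lim_null_comparison[of _ "\<lambda>h. \<bar>h\<bar>"])
    show "((\<lambda>h::real. \<bar>h\<bar>) \<longlongrightarrow> 0) (at 0)" by (rule tendsto_eq_intros | simp)+
    show "\<forall>\<^sub>F h in at 0. norm (((max 0 (0 + h))\<^sup>2 - (max 0 0)\<^sup>2) / h) \<le> \<bar>h::real\<bar>"
      by (intro always_eventually allI) (auto simp: max_def power2_eq_square)
  qed
  then show ?thesis using equal by (simp add: DERIV_def)
qed

definition bump :: "'a::real_inner \<Rightarrow> real \<Rightarrow> 'a \<Rightarrow> real" where
  "bump c R x = (max 0 (R\<^sup>2 - (x - c) \<bullet> (x - c)))\<^sup>2"

lemma bump_nonneg: "0 \<le> bump c R x" by (simp add: bump_def)

lemma bump_pos: "x \<in> ball c R \<Longrightarrow> 0 < bump c R x"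
proof -
  assume "x \<in> ball c R"
  then have "norm (x - c) < R" by (simp add: dist_norm norm_minus_commute)
  then have "(norm (x - c))\<^sup>2 < R\<^sup>2" by (intro power_strict_mono) auto
  then show ?thesis by (simp add: bump_def power2_norm_eq_inner)
qed

lemma bump_zero: "0 \<le> R \<Longrightarrow> x \<notin> cball c R \<Longrightarrow> bump c R x = 0"
proof -
  assume "0 \<le> R" "x \<notin> cball c R"
  then have "R \<le> norm (x - c)" by (simp add: dist_norm norm_minus_commute)
  then have "R\<^sup>2 \<le> (norm (x - c))\<^sup>2" using \<open>0 \<le> R\<close> by (intro power_mono)
  then show ?thesis by (simp add: bump_def power2_norm_eq_inner)
qed

lemma has_C1_extension_bump:
  "has_C1_extension G (bump c R) (\<lambda>x v. 2 * max 0 (R\<^sup>2 - (x - c) \<bullet> (x - c)) * - (2 * ((x - c) \<bullet> v)))"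
  unfolding has_C1_extension_def
proof (intro conjI ballI allI)
  show "continuous_on (closure G) (bump c R)" unfolding bump_def by (intro continuous_intros)
  show "continuous_on (closure G) (\<lambda>x. 2 * max 0 (R\<^sup>2 - (x - c) \<bullet> (x - c)) * - (2 * ((x - c) \<bullet> v)))" for v
    by (intro continuous_intros)
  fix x
  have "((\<lambda>x. R\<^sup>2 - (x - c) \<bullet> (x - c)) has_derivative (\<lambda>v. - (2 * ((x - c) \<bullet> v)))) (at x)"
    by (auto intro!: derivative_eq_intros simp: inner_commute)
  from has_derivative_compose[OF this has_real_derivative_max_0_squared[unfolded has_field_derivative_def]]
  show "(bump c R has_derivative (\<lambda>v. 2 * max 0 (R\<^sup>2 - (x - c) \<bullet> (x - c)) * - (2 * ((x - c) \<bullet> v)))) (at x)"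
    unfolding bump_def .
qed

text \<open>The field vanishes near the complement of \<open>G\<close>, so it is differentiable on
  the whole space and its directional derivatives have integral 0.\<close>

lemma gauss_green_interior:
  fixes k :: "'a::euclidean_space \<Rightarrow> 'b::euclidean_space"
  assumes G: "open G" "bounded G" and k: "has_C1_extension G k Dk"
    and K: "closed K" "K \<subseteq> G" and k0: "\<And>x. x \<notin> K \<Longrightarrow> k x = 0"
  shows "integrable lborel (\<lambda>x. indicator G x *\<^sub>R Dk x v)" "(\<integral>x. indicator G x *\<^sub>R Dk x v \<partial>lborel) = 0"
proof -
  obtain B where B: "B \<ge> 0" "\<And>x v. x \<in> G \<Longrightarrow> norm (Dk x v) \<le> B * norm v"
    by (rule has_C1_extension_bounded[OF k G(2)]) (rule that)
  have der: "(k has_derivative (\<lambda>v. indicator G x *\<^sub>R Dk x v)) (at x)" for x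
  proof (cases "x \<in> G")
    case True
    then show ?thesis using k by (simp add: has_C1_extension_def)
  next
    case False
    then have x: "x \<in> - K" using K(2) by blast
    have "open (- K)" using K(1) by (rule open_Compl)
    then have "(k has_derivative (\<lambda>v. 0)) (at x)"
      by (rule has_derivative_transform_within_open[OF has_derivative_const[of 0] _ x]) (simp add: k0)
    then show ?thesis using False by simp
  qed
  have bd: "norm (indicator G x *\<^sub>R Dk x v) \<le> B * norm v" for x v
    using B by (simp add: indicator_def)
  have K': "bounded K" using G(2) K(2) bounded_subset by blast
  show "integrable lborel (\<lambda>x. indicator G x *\<^sub>R Dk x v)" "(\<integral>x. indicator G x *\<^sub>R Dk x v \<partial>lborel) = 0"
    using integral_directional_derivative_eq_0[OF der bd K' k0] by auto
qed

text \<open>Stated for one direction \<open>v\<close> at a time; divergences arise later as sums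
  over directions. The partition functions are bumps divided by their sum.\<close>

theorem gauss_green:
  fixes w :: "quat \<Rightarrow> 'b::euclidean_space"
  assumes G: "open G" "connected G" "bounded G" "G \<noteq> {}" and sm: "smooth_surface (frontier G)"
    and w: "has_C1_extension G w Dw"
  shows "integrable lborel (\<lambda>x. indicator G x *\<^sub>R Dw x v)"
    and "integrable (surface_measure (frontier G)) (\<lambda>x. (outward_unit_normal G x \<bullet> v) *\<^sub>R w x)"
    and "(\<integral>x. indicator G x *\<^sub>R Dw x v \<partial>lborel) =
      (\<integral>x. (outward_unit_normal G x \<bullet> v) *\<^sub>R w x \<partial>surface_measure (frontier G))"
proof -
  define M where "M = surface_measure (frontier G)"
  have cF: "compact (frontier G)" using G(3) by (rule compact_frontier_bounded)
  have "G \<noteq> UNIV" using G(3) not_bounded_UNIV by blast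
  then have "frontier G \<noteq> {}" using G(4) by (simp add: frontier_eq_empty)
  then have M: "area_measure (frontier G) M"
    unfolding M_def by (rule area_measure_surface_measure[OF cF sm])
  then have sM: "space M = frontier G"
    using sets_eq_imp_space_eq[of M "restrict_space borel (frontier G)"]
    by (simp add: area_measure_def space_restrict_space)
  note nc = continuous_on_outward_unit_normal[OF G(1-3) sm]
  let ?gg = "\<lambda>k Dk. integrable lborel (\<lambda>x. indicator G x *\<^sub>R Dk x v) \<and>
    integrable M (\<lambda>x. (outward_unit_normal G x \<bullet> v) *\<^sub>R k x) \<and>
    (\<integral>x. indicator G x *\<^sub>R Dk x v \<partial>lborel) = (\<integral>x. (outward_unit_normal G x \<bullet> v) *\<^sub>R k x \<partial>M)"
  \<comment> \<open>The radius precedes the field in the quantifiers, so the finite cover is fixed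
    before the pieces of the field are formed.\<close>
  have loc: "\<exists>R>0. \<forall>(k :: quat \<Rightarrow> 'b) Dk. has_C1_extension G k Dk \<longrightarrow> (\<forall>x. x \<notin> cball p R \<longrightarrow> k x = 0) \<longrightarrow> ?gg k Dk"
    if p: "p \<in> closure G" for p
  proof (cases "p \<in> G")
    case True
    then obtain R where R: "R > 0" "cball p R \<subseteq> G" using G(1) open_contains_cball by blast
    have "?gg k Dk" if k: "has_C1_extension G k Dk" "\<forall>x. x \<notin> cball p R \<longrightarrow> k x = 0" for k :: "quat \<Rightarrow> 'b" and Dk
    proof -
      have "k x = 0" if "x \<notin> cball p R" for x using k(2) that by blast
      note i = gauss_green_interior[OF G(1,3) k(1) closed_cball R(2) this]
      have "(outward_unit_normal G x \<bullet> v) *\<^sub>R k x = 0" if "x \<in> space M" for x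
      proof -
        have "x \<notin> G" using that G(1) unfolding sM frontier_def by (simp add: interior_open)
        then have "x \<notin> cball p R" using R(2) by blast
        then have "k x = 0" using k(2) by blast
        then show ?thesis by simp
      qed
      note z = this
      have "integrable M (\<lambda>x. (outward_unit_normal G x \<bullet> v) *\<^sub>R k x)"
        by (rule Bochner_Integration.integrable_cong[OF refl z, THEN iffD2])
           (simp_all add: Bochner_Integration.integrable_zero)
      moreover have "(\<integral>x. (outward_unit_normal G x \<bullet> v) *\<^sub>R k x \<partial>M) = 0"
        using Bochner_Integration.integral_cong[OF refl z] by simp
      ultimately show ?thesis using i by simp
    qed
    then show ?thesis using R(1) by blast
  next
    case False
    then have "p \<in> frontier G" using p closure_eq_Un_frontier[OF G(1)] by blast
    then obtain T h dh r where "domain_chart G p T h dh r" by (rule domain_chart_exists[OF G(1-3) sm])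
    then interpret domain_chart G p T h dh r .
    have R: "r / 2 > 0" "cball p (r / 2) \<subseteq> ball p r" using r_pos by auto
    have "?gg k Dk" if k: "has_C1_extension G k Dk" "\<forall>x. x \<notin> cball p (r / 2) \<longrightarrow> k x = 0" for k :: "quat \<Rightarrow> 'b" and Dk
    proof -
      have k0: "k x = 0" if "x \<notin> cball p (r / 2)" for x using k(2) that by blast
      show ?thesis by (intro conjI gauss_green_local[OF G(1,3) M nc k(1) compact_cball R(2) k0])
    qed
    then show ?thesis using R(1) by blast
  qed
  obtain R where
    R': "\<forall>p\<in>closure G. R p > 0 \<and> (\<forall>(k :: quat \<Rightarrow> 'b) Dk. has_C1_extension G k Dk \<longrightarrow>
      (\<forall>x. x \<notin> cball p (R p) \<longrightarrow> k x = 0) \<longrightarrow> ?gg k Dk)"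
    by (rule exE[OF bchoice[OF ballI[OF loc]]]) (assumption, rule that)
  have R1: "R p > 0" if "p \<in> closure G" for p using R' that by simp
  have R2: "p \<in> closure G \<Longrightarrow> has_C1_extension G k Dk \<Longrightarrow>
      (\<And>x. x \<notin> cball p (R p) \<Longrightarrow> k x = 0) \<Longrightarrow> ?gg k Dk" for p and k :: "quat \<Rightarrow> 'b" and Dk
    by (rule conjunct2[OF bspec[OF R'], rule_format])
  have "compact (closure G)" using G(3) by (simp add: compact_closure)
  moreover have "closure G \<subseteq> (\<Union>p\<in>closure G. ball p (R p))" using R1 by fastforce
  ultimately obtain C where C: "C \<subseteq> closure G" "finite C" "closure G \<subseteq> (\<Union>p\<in>C. ball p (R p))"
    by (rule compactE_image[OF _ open_ball])
  define D\<chi> where "D\<chi> p x v = 2 * max 0 ((R p)\<^sup>2 - (x - p) \<bullet> (x - p)) * - (2 * ((x - p) \<bullet> v))" for p x v :: quat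
  \<comment> \<open>The sum of the bumps is positive on the closure of \<open>G\<close>, exactly
    where the quotient must be \<open>C^1\<close> up to the boundary.\<close>
  define s where "s x = (\<Sum>p\<in>C. bump p (R p) x)" for x
  define Ds where "Ds x v = (\<Sum>p\<in>C. D\<chi> p x v)" for x v
  have \<chi>: "has_C1_extension G (bump p (R p)) (D\<chi> p)" for p
    unfolding D\<chi>_def by (rule has_C1_extension_bump)
  have s: "has_C1_extension G s Ds"
    unfolding s_def Ds_def by (rule has_C1_extension_sum[OF \<chi>])
  have spos: "s x > 0" if x: "x \<in> closure G" for x
  proof -
    obtain p where "p \<in> C" "x \<in> ball p (R p)" using C(3) x by blast
    then show ?thesis
      unfolding s_def using C(2) bump_pos bump_nonneg by (intro sum_pos2[of C p]) auto
  qed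
  define D1 where "D1 x v = - (inverse (s x) * Ds x v * inverse (s x))" for x v
  have i: "has_C1_extension G (\<lambda>x. inverse (s x)) D1"
    unfolding D1_def by (rule has_C1_extension_inverse[OF s]) (use spos in force)
  define D2 where "D2 x v = inverse (s x) *\<^sub>R Dw x v + D1 x v *\<^sub>R w x" for x v
  have iw: "has_C1_extension G (\<lambda>x. inverse (s x) *\<^sub>R w x) D2"
    unfolding D2_def by (rule has_C1_extension_bilinear[OF bounded_bilinear_scaleR i w])
  define k where "k p x = bump p (R p) x *\<^sub>R inverse (s x) *\<^sub>R w x" for p x
  define Dk where "Dk p x v = bump p (R p) x *\<^sub>R D2 x v + D\<chi> p x v *\<^sub>R inverse (s x) *\<^sub>R w x" for p x v
  have k: "has_C1_extension G (k p) (Dk p)" for p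
    unfolding k_def Dk_def by (rule has_C1_extension_bilinear[OF bounded_bilinear_scaleR \<chi> iw])
  have ggk: "?gg (k p) (Dk p)" if "p \<in> C" for p
  proof (rule R2[OF _ k])
    show pG: "p \<in> closure G" using that C(1) by blast
    show "k p x = 0" if "x \<notin> cball p (R p)" for x
      using bump_zero[OF _ that] R1[OF pG] by (simp add: k_def)
  qed
  have w_eq: "w x = (\<Sum>p\<in>C. k p x)" if "x \<in> closure G" for x
  proof -
    have "(\<Sum>p\<in>C. k p x) = s x *\<^sub>R inverse (s x) *\<^sub>R w x"
      by (simp add: k_def s_def scaleR_sum_left[symmetric] del: scaleR_scaleR)
    then show ?thesis using spos[OF that] by simp
  qed
  \<comment> \<open>Uniqueness of derivatives replaces the computation that the derivatives of the
    partition functions add up to 0.\<close>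
  have Dw_eq: "Dw x v = (\<Sum>p\<in>C. Dk p x v)" if x: "x \<in> G" for x
  proof -
    have "((\<lambda>x. \<Sum>p\<in>C. k p x) has_derivative (\<lambda>v. \<Sum>p\<in>C. Dk p x v)) (at x)"
      using has_C1_extension_sum[of C G k Dk] k x by (simp add: has_C1_extension_def)
    then have "(w has_derivative (\<lambda>v. \<Sum>p\<in>C. Dk p x v)) (at x)"
      by (rule has_derivative_transform_within_open[OF _ G(1) x])
         (simp add: w_eq[OF subsetD[OF closure_subset]])
    moreover have "(w has_derivative Dw x) (at x)" using w x by (simp add: has_C1_extension_def)
    ultimately have "Dw x = (\<lambda>v. \<Sum>p\<in>C. Dk p x v)" by (rule has_derivative_unique[rotated])
    then show ?thesis by simp
  qed
  have e1: "indicator G x *\<^sub>R Dw x v = (\<Sum>p\<in>C. indicator G x *\<^sub>R Dk p x v)" for x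
    using Dw_eq[of x] by (simp add: indicator_def)
  have e2: "(outward_unit_normal G x \<bullet> v) *\<^sub>R w x = (\<Sum>p\<in>C. (outward_unit_normal G x \<bullet> v) *\<^sub>R k p x)"
    if "x \<in> space M" for x
    using w_eq[of x] that by (simp add: sM frontier_def scaleR_sum_right)
  show "integrable lborel (\<lambda>x. indicator G x *\<^sub>R Dw x v)"
    unfolding e1 using ggk by (intro Bochner_Integration.integrable_sum) auto
  have "integrable M (\<lambda>x. (outward_unit_normal G x \<bullet> v) *\<^sub>R w x) \<longleftrightarrow>
      integrable M (\<lambda>x. \<Sum>p\<in>C. (outward_unit_normal G x \<bullet> v) *\<^sub>R k p x)"
    by (rule Bochner_Integration.integrable_cong[OF refl e2])
  then show "integrable (surface_measure (frontier G)) (\<lambda>x. (outward_unit_normal G x \<bullet> v) *\<^sub>R w x)"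
    unfolding M_def[symmetric] using ggk by (simp add: Bochner_Integration.integrable_sum)
  have "(\<integral>x. indicator G x *\<^sub>R Dw x v \<partial>lborel) = (\<Sum>p\<in>C. \<integral>x. indicator G x *\<^sub>R Dk p x v \<partial>lborel)"
    unfolding e1 using ggk by (intro Bochner_Integration.integral_sum) auto
  also have "\<dots> = (\<Sum>p\<in>C. \<integral>x. (outward_unit_normal G x \<bullet> v) *\<^sub>R k p x \<partial>M)"
    using ggk by (intro sum.cong) auto
  also have "\<dots> = (\<integral>x. (\<Sum>p\<in>C. (outward_unit_normal G x \<bullet> v) *\<^sub>R k p x) \<partial>M)"
    using ggk by (intro Bochner_Integration.integral_sum[symmetric]) auto
  also have "\<dots> = (\<integral>x. (outward_unit_normal G x \<bullet> v) *\<^sub>R w x \<partial>M)"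
    by (rule Bochner_Integration.integral_cong[OF refl e2[symmetric]])
  finally show "(\<integral>x. indicator G x *\<^sub>R Dw x v \<partial>lborel) =
      (\<integral>x. (outward_unit_normal G x \<bullet> v) *\<^sub>R w x \<partial>surface_measure (frontier G))"
    by (simp add: M_def)
qed

section \<open>The change of variables induced by the diffeomorphism\<close>

lemma UNIV_option_3: "(UNIV :: 3 option set) = {None, Some 1, Some 2, Some 3}"
  by (auto simp: UNIV_option_conv UNIV_3)

text \<open>Permutations that move \<open>None\<close> contribute a zero factor. The Jacobian of
  \<open>lift a\<close> has this block form because the real part is left unchanged.\<close>

lemma det_option_3_block:
  fixes A :: "real^(3 option)^(3 option)"
  assumes "A $ None $ None = 1" "\<And>k. A $ None $ Some k = 0" "\<And>k. A $ Some k $ None = 0"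
  shows "det A = det (\<chi> i j. A $ Some i $ Some j :: real^3^3)"
proof -
  have f0: "finite {Some 1, Some 2, Some (3 :: 3)}" "None \<notin> {Some 1, Some 2, Some (3 :: 3)}"
    and f1: "finite {Some 2, Some (3 :: 3)}" "Some 1 \<notin> {Some 2, Some (3 :: 3)}"
    and f2: "finite {Some (3 :: 3)}" "Some 2 \<notin> {Some (3 :: 3)}"
    by auto
  show ?thesis
    unfolding det_3
    unfolding det_def UNIV_option_3
    unfolding sum_over_permutations_insert[OF f0]
    unfolding sum_over_permutations_insert[OF f1]
    unfolding sum_over_permutations_insert[OF f2]
    unfolding permutes_sing
    by (simp add: sign_swap_id permutation_swap_id permutation_compose sign_compose sign_id swap_id_eq assms)
qed

lemma has_derivative_lift:
  assumes "(a has_derivative Da) (at (snd x))"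
  shows "(lift a has_derivative (\<lambda>v. (fst v, Da (snd v)))) (at x)"
  unfolding lift_def
  by (intro has_derivative_Pair has_derivative_compose[OF has_derivative_snd[OF has_derivative_ident] assms]
      has_derivative_fst has_derivative_ident)

lemma partial_derivative_eq:
  assumes "(f has_derivative D) (at x)"
  shows "partial_derivative v f x = D v"
proof -
  have "((\<lambda>t. f (x + t *\<^sub>R v)) has_derivative (\<lambda>t. D (t *\<^sub>R v))) (at 0)"
    by (rule has_derivative_compose[of "\<lambda>t. x + t *\<^sub>R v" "\<lambda>t. t *\<^sub>R v" 0 UNIV f D])
       (auto intro!: derivative_eq_intros assms)
  then have "((\<lambda>t. f (x + t *\<^sub>R v)) has_vector_derivative D v) (at 0)"
    by (simp add: has_vector_derivative_def linear_scale[OF has_derivative_linear[OF assms]])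
  then show ?thesis unfolding partial_derivative_def by (rule vector_derivative_at)
qed

lemma M_coeff_eq:
  assumes "(a has_derivative Da) (at (snd x))"
  shows "M_coeff a x = \<bar>det (matrix Da)\<bar>"
proof -
  let ?A = "jacobian_matrix (lift a) x"
  have A: "?A $ i $ j = (fst (qunit j), Da (snd (qunit j))) \<bullet> qunit i" for i j
    by (simp add: jacobian_matrix_def partial_derivative_eq[OF has_derivative_lift[OF assms]])
  have "linear Da" using assms by (rule has_derivative_linear)
  then have "Da 0 = 0" by (rule linear_0)
  then have "det ?A = det (\<chi> i j. ?A $ Some i $ Some j :: real^3^3)"
    by (intro det_option_3_block) (simp_all add: A qvec_def)
  also have "(\<chi> i j. ?A $ Some i $ Some j :: real^3^3) = matrix Da"
    by (simp add: A qvec_def matrix_def vec_eq_iff inner_axis)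
  finally show ?thesis by (simp add: M_coeff_def)
qed

text \<open>\<open>lift a\<close> preserves the real part, so on each slice with fixed real part it
  is \<open>a\<close> on an open subset of \<open>U\<close>. The change of variables in
  \<open>real^3\<close> applies slice by slice, and Tonelli reassembles the slices.\<close>

lemma integral_lift_image:
  fixes a :: "real^3 \<Rightarrow> real^3" and F :: "quat \<Rightarrow> 'b::{banach, second_countable_topology}"
  assumes \<Omega>: "open \<Omega>" "open (lift a ` \<Omega>)" and U: "open U" "\<And>x. x \<in> \<Omega> \<Longrightarrow> snd x \<in> U"
    and der: "\<And>u. u \<in> U \<Longrightarrow> (a has_derivative blinfun_apply (Da u)) (at u)" and Da: "continuous_on U Da"
    and inj: "inj_on a U"
    and F: "(\<lambda>y. indicator (lift a ` \<Omega>) y *\<^sub>R F y) \<in> borel_measurable borel"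
  shows "(\<integral>y. indicator (lift a ` \<Omega>) y *\<^sub>R F y \<partial>lborel) =
    (\<integral>x. indicator \<Omega> x *\<^sub>R M_coeff a x *\<^sub>R F (lift a x) \<partial>lborel)"
proof -
  define G where "G = lift a ` \<Omega>"
  define J where "J x = indicator \<Omega> x * \<bar>det (matrix (blinfun_apply (Da (snd x))))\<bar>" for x :: quat
  define L where "L x = (if x \<in> \<Omega> then lift a x else 0)" for x
  have [measurable]: "\<Omega> \<in> sets borel" "G \<in> sets borel" using \<Omega> by (simp_all add: G_def)
  have ca: "continuous_on U a"
    using has_derivative_continuous[OF der] by (auto intro: continuous_at_imp_continuous_on)
  have "continuous_on \<Omega> (lift a)"
    unfolding lift_def using U(2)
    by (intro continuous_intros continuous_on_compose2[OF ca]) auto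
  then have L[measurable]: "L \<in> borel_measurable borel"
    unfolding L_def[abs_def] by (intro borel_measurable_continuous_on_if) auto
  have cdet: "continuous_on U (\<lambda>u. \<bar>det (matrix (blinfun_apply (Da u)))\<bar>)"
    unfolding det_3 matrix_def by (simp, intro continuous_intros Da)
  have J[measurable]: "J \<in> borel_measurable borel"
  proof -
    have "continuous_on \<Omega> (\<lambda>x. \<bar>det (matrix (blinfun_apply (Da (snd x))))\<bar>)"
      by (rule continuous_on_compose2[OF cdet continuous_on_snd[OF continuous_on_id]]) (use U(2) in auto)
    from borel_measurable_continuous_on_indicator[OF borel_open[OF \<Omega>(1)] this]
    show ?thesis by (simp add: J_def[abs_def])
  qed
  have J_nonneg: "0 \<le> J x" for x by (simp add: J_def)
  have eq: "density lborel (\<lambda>y. ennreal (indicator G y)) = distr (density lborel (\<lambda>x. ennreal (J x))) borel L"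
    (is "?M = ?N")
  proof (rule measure_eqI)
    fix B assume "B \<in> sets ?M"
    then have B[measurable]: "B \<in> sets borel" by simp
    have slice: "(\<integral>\<^sup>+u. indicator (G \<inter> B) (z, u) \<partial>lborel) =
      (\<integral>\<^sup>+u. ennreal (J (z, u)) * indicator B (L (z, u)) \<partial>lborel)" for z
    proof -
      define Z where "Z = {u. (z, u) \<in> \<Omega>}"
      have "open Z"
        using open_vimage[OF \<Omega>(1), of "\<lambda>u. (z, u)"] by (simp add: Z_def vimage_def continuous_intros)
      moreover have aZ: "a ` Z = {u. (z, u) \<in> G}"
      proof (intro equalityI subsetI)
        fix v assume "v \<in> a ` Z"
        then obtain u where "(z, u) \<in> \<Omega>" "v = a u" by (auto simp: Z_def)
        then have "(z, v) = lift a (z, u)" "(z, u) \<in> \<Omega>" by (simp_all add: lift_def)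
        then show "v \<in> {u. (z, u) \<in> G}" unfolding G_def mem_Collect_eq by (rule image_eqI)
      qed (auto simp: Z_def G_def lift_def)
      moreover have "open {u. (z, u) \<in> G}"
        using open_vimage[OF \<Omega>(2), of "\<lambda>u. (z, u)"] by (simp add: G_def vimage_def continuous_intros)
      ultimately have Zb: "Z \<in> sets borel" "a ` Z \<in> sets borel" by simp_all
      have ZU: "Z \<subseteq> U" using U(2) by (force simp: Z_def)
      have Jm: "(\<lambda>u. indicator Z u * \<bar>det (matrix (blinfun_apply (Da u)))\<bar>) \<in> borel_measurable borel"
        using borel_measurable_continuous_on_indicator[OF Zb(1) continuous_on_subset[OF cdet ZU]] by simp
      have Bm: "(\<lambda>u. indicator B (z, u) :: ennreal) \<in> borel_measurable borel" by measurable
      have "(\<integral>\<^sup>+u. indicator (G \<inter> B) (z, u) \<partial>lborel) = (\<integral>\<^sup>+u. indicator (a ` Z) u * indicator B (z, u) \<partial>lborel)"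
        unfolding aZ by (intro nn_integral_cong) (auto simp: indicator_def)
      also have "\<dots> = (\<integral>\<^sup>+u. ennreal (indicator Z u * \<bar>det (matrix (blinfun_apply (Da u)))\<bar>) * indicator B (z, a u) \<partial>lborel)"
        by (rule nn_integral_change_of_variables[OF Zb der _ Jm Bm])
           (use ZU inj in \<open>auto intro: inj_on_subset\<close>)
      also have "\<dots> = (\<integral>\<^sup>+u. ennreal (J (z, u)) * indicator B (L (z, u)) \<partial>lborel)"
        by (intro nn_integral_cong) (auto simp: J_def L_def Z_def lift_def indicator_def)
      finally show ?thesis .
    qed
    have "emeasure ?M B = (\<integral>\<^sup>+y. indicator (G \<inter> B) y \<partial>lborel)"
      by (simp add: emeasure_density indicator_inter_arith ennreal_indicator)
    also have "\<dots> = (\<integral>\<^sup>+z. \<integral>\<^sup>+u. indicator (G \<inter> B) (z, u) \<partial>lborel \<partial>lborel)"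
      using lborel.nn_integral_fst[of "indicator (G \<inter> B) :: quat \<Rightarrow> ennreal" lborel] by (simp add: lborel_prod)
    also have "\<dots> = (\<integral>\<^sup>+z. \<integral>\<^sup>+u. ennreal (J (z, u)) * indicator B (L (z, u)) \<partial>lborel \<partial>lborel)"
      by (simp add: slice)
    also have "\<dots> = (\<integral>\<^sup>+x. ennreal (J x) * indicator B (L x) \<partial>lborel)"
      using lborel.nn_integral_fst[of "\<lambda>x. ennreal (J x) * indicator B (L x)" lborel] by (simp add: lborel_prod)
    also have "\<dots> = (\<integral>\<^sup>+x. ennreal (J x) * indicator (L -` B \<inter> space lborel) x \<partial>lborel)"
      by (intro nn_integral_cong) (auto simp: indicator_def)
    also have "\<dots> = emeasure ?N B"
      using measurable_sets[OF L B] by (subst emeasure_distr) (auto simp: emeasure_density)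
    finally show "emeasure ?M B = emeasure ?N B" .
  qed simp
  define F' where "F' y = indicator G y *\<^sub>R F y" for y
  have F'[measurable]: "F' \<in> borel_measurable borel" using F by (simp add: F'_def[abs_def] G_def)
  have "(\<integral>y. F' y \<partial>lborel) = (\<integral>y. indicator G y *\<^sub>R F' y \<partial>lborel)"
    by (intro Bochner_Integration.integral_cong) (auto simp: F'_def split: split_indicator)
  also have "\<dots> = integral\<^sup>L ?M F'" by (subst integral_density) auto
  also have "\<dots> = (\<integral>x. J x *\<^sub>R F' (L x) \<partial>lborel)"
  proof -
    have "integral\<^sup>L ?N F' = (\<integral>x. F' (L x) \<partial>density lborel (\<lambda>x. ennreal (J x)))"
      by (rule integral_distr) auto
    also have "\<dots> = (\<integral>x. J x *\<^sub>R F' (L x) \<partial>lborel)"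
      by (rule integral_density) (auto simp: J_nonneg)
    finally show ?thesis by (simp add: eq)
  qed
  also have "\<dots> = (\<integral>x. indicator \<Omega> x *\<^sub>R M_coeff a x *\<^sub>R F (lift a x) \<partial>lborel)"
  proof (rule Bochner_Integration.integral_cong[OF refl])
    fix x
    show "J x *\<^sub>R F' (L x) = indicator \<Omega> x *\<^sub>R M_coeff a x *\<^sub>R F (lift a x)"
      using M_coeff_eq[OF der[OF U(2)], of x]
      by (cases "x \<in> \<Omega>") (simp_all add: J_def F'_def L_def G_def)
  qed
  finally show ?thesis by (simp add: F'_def G_def)
qed

section \<open>The divergence of the quaternionic field\<close>

lemma bounded_bilinear_qmult: "bounded_bilinear (*\<^sub>H)"
  unfolding bilinear_conv_bounded_bilinear[symmetric] bilinear_def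
proof (intro conjI allI linearI)
  fix x y z :: quat and c :: real
  show "x *\<^sub>H (y + z) = x *\<^sub>H y + x *\<^sub>H z"
    by (simp add: qmult_def cross_add_right inner_add_right scaleR_add_right scaleR_add_left distrib_left)
  show "(y + z) *\<^sub>H x = y *\<^sub>H x + z *\<^sub>H x"
    by (simp add: qmult_def cross_add_left inner_add_left scaleR_add_right scaleR_add_left distrib_right)
  show "x *\<^sub>H (c *\<^sub>R y) = c *\<^sub>R (x *\<^sub>H y)"
    by (simp add: qmult_def cross_mult_right algebra_simps)
  show "(c *\<^sub>R y) *\<^sub>H x = c *\<^sub>R (y *\<^sub>H x)"
    by (simp add: qmult_def cross_mult_left algebra_simps)
qed

interpretation qmult: bounded_bilinear "(*\<^sub>H)"
  by (rule bounded_bilinear_qmult)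

lemma qvec_square: "qvec v *\<^sub>H qvec v = (- (v \<bullet> v)) *\<^sub>R qunit None"
  by (simp add: qmult_def qvec_def)

lemma has_C1_extension_linear:
  assumes "bounded_linear L" shows "has_C1_extension G L (\<lambda>x. L)"
  using bounded_linear.continuous_on[OF assms continuous_on_id] bounded_linear_imp_has_derivative[OF assms]
  by (simp add: has_C1_extension_def)

text \<open>The outside of a large ball is connected and misses the frontier. An unbounded
  \<open>G\<close> would meet it, hence contain it together with points of the real axis.\<close>

lemma bounded_if_real_axis_disjoint:
  fixes G :: "quat set"
  assumes F: "compact (frontier G)" and ax: "\<And>y. y \<in> G \<Longrightarrow> snd y \<noteq> 0"
  shows "bounded G"
proof (rule ccontr)
  assume unb: "\<not> bounded G"
  obtain R where R: "frontier G \<subseteq> cball 0 R"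
    using compact_imp_bounded[OF F] by (force simp: bounded_iff)
  have "2 \<le> DIM(quat)" by simp
  then have "connected (- cball (0::quat) R)"
    by (intro connected_complement_bounded_convex) auto
  moreover have "- cball 0 R \<inter> frontier G = {}" using R by blast
  moreover have "- cball 0 R \<inter> G \<noteq> {}"
  proof
    assume "- cball 0 R \<inter> G = {}"
    then have "G \<subseteq> cball 0 R" by blast
    then show False using unb bounded_subset[OF bounded_cball] by blast
  qed
  ultimately have "- cball 0 R \<subseteq> G" using connected_Int_frontier[of "- cball 0 R" G] by blast
  moreover have "(\<bar>R\<bar> + 1, 0) \<in> - cball (0::quat) R" by (simp add: norm_Pair)
  ultimately have "(\<bar>R\<bar> + 1, 0) \<in> G" by blast
  from ax[OF this] show False by simp
qed

text \<open>
  With \<open>q = qvec (snd y)\<close> the hypotheses say that \<open>\<phi>\<close> and \<open>\<psi>\<close> solve \<open>\<partial>\<^sub>0\<phi> + (E\<phi>) q/|q|\<^sup>2 = 0\<close> and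
  \<open>\<partial>\<^sub>0\<psi> + q/|q|\<^sup>2 (E\<psi>) = 0\<close>, where \<open>E\<close> is the Euler operator in the vector variable. The
  divergence of the field \<open>\<phi> \<nu> \<psi>\<close> is then \<open>\<phi> (\<Sum>\<^sub>k \<partial>\<^sub>k (2 y\<^sub>k q/|q|\<^sup>2)) \<psi> = 4 \<phi> q/|q|\<^sup>2 \<psi>\<close>.
\<close>

lemma integral_nu_eq:
  fixes \<phi> \<psi> :: "quat \<Rightarrow> quat"
  assumes G: "open G" "connected G" "bounded G" "G \<noteq> {}" and sm: "smooth_surface (frontier G)"
    and \<phi>: "has_C1_extension G \<phi> D\<phi>" and \<psi>: "has_C1_extension G \<psi> D\<psi>"
    and nz: "\<And>y. y \<in> closure G \<Longrightarrow> snd y \<noteq> 0"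
    and left: "\<And>y. y \<in> G \<Longrightarrow> qvec (snd y) *\<^sub>H D\<psi> y (1, 0) = D\<psi> y (0, snd y)"
    and right: "\<And>y. y \<in> G \<Longrightarrow> D\<phi> y (1, 0) *\<^sub>H qvec (snd y) = D\<phi> y (0, snd y)"
  shows "integrable lborel (\<lambda>y. indicator G y *\<^sub>R (\<phi> y *\<^sub>H ((1 / (norm (snd y))\<^sup>2) *\<^sub>R qvec (snd y)) *\<^sub>H \<psi> y))"
    and "integral_nu G \<phi> \<psi> =
    4 *\<^sub>R (\<integral>y. indicator G y *\<^sub>R (\<phi> y *\<^sub>H ((1 / (norm (snd y))\<^sup>2) *\<^sub>R qvec (snd y)) *\<^sub>H \<psi> y) \<partial>lborel)"
proof -
  let ?M = "surface_measure (frontier G)" and ?n = "outward_unit_normal G"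
  define q where "q y = qvec (snd y)" for y :: quat
  define s where "s y = snd y \<bullet> snd y" for y :: quat
  define Ds where "Ds y v = snd y \<bullet> snd v + snd v \<bullet> snd y" for y v :: quat
  define N where "N y = inverse (s y)" for y
  define DN where "DN y v = - (inverse (s y) * Ds y v * inverse (s y))" for y v
  define P where "P y = (\<phi> y *\<^sub>H q y) *\<^sub>H \<psi> y" for y
  define DP where "DP y v = (\<phi> y *\<^sub>H q y) *\<^sub>H D\<psi> y v + (\<phi> y *\<^sub>H qvec (snd v) + D\<phi> y v *\<^sub>H q y) *\<^sub>H \<psi> y" for y v
  define c where "c k y = snd y $ k * N y" for k and y :: quat
  define Dc where "Dc k y v = snd y $ k * DN y v + snd v $ k * N y" for k and y v :: quat
  define w0 where "w0 y = \<phi> y *\<^sub>H \<psi> y" for y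
  define Dw0 where "Dw0 y v = \<phi> y *\<^sub>H D\<psi> y v + D\<phi> y v *\<^sub>H \<psi> y" for y v
  define w where "w k y = c k y *\<^sub>R P y" for k y
  define Dw where "Dw k y v = c k y *\<^sub>R DP y v + Dc k y v *\<^sub>R P y" for k y v
  define e where "e k = (0 :: real, axis k 1 :: real^3)" for k
  have snd_ext: "has_C1_extension G (snd :: quat \<Rightarrow> real^3) (\<lambda>y v. snd v)"
    by (rule has_C1_extension_linear[OF bounded_linear_snd])
  have q: "has_C1_extension G q (\<lambda>y v. qvec (snd v))"
    unfolding q_def qvec_def
    by (rule has_C1_extension_linear) (intro bounded_linear_Pair bounded_linear_zero bounded_linear_snd)
  have s: "has_C1_extension G s Ds"
    unfolding s_def Ds_def by (rule has_C1_extension_bilinear[OF bounded_bilinear_inner snd_ext snd_ext])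
  have N: "has_C1_extension G N DN"
    unfolding N_def DN_def by (rule has_C1_extension_inverse[OF s]) (use nz in \<open>simp add: s_def\<close>)
  have P: "has_C1_extension G P DP"
    unfolding P_def DP_def
    by (intro has_C1_extension_bilinear[OF bounded_bilinear_qmult] \<phi> \<psi> q)
  have c: "has_C1_extension G (c k) (Dc k)" for k
    unfolding c_def Dc_def
    by (intro has_C1_extension_bilinear[OF bounded_bilinear_mult] N has_C1_extension_linear
        bounded_linear_compose[OF bounded_linear_vec_nth bounded_linear_snd])
  have w: "has_C1_extension G (w k) (Dw k)" for k
    unfolding w_def Dw_def by (rule has_C1_extension_bilinear[OF bounded_bilinear_scaleR c P])
  have w0: "has_C1_extension G w0 Dw0"
    unfolding w0_def Dw0_def by (rule has_C1_extension_bilinear[OF bounded_bilinear_qmult \<phi> \<psi>])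
  note g0 = gauss_green[OF G sm w0, of "(1, 0)"]
  note gk = gauss_green[OF G sm w]
  have div: "Dw0 y (1, 0) + (\<Sum>k\<in>UNIV. Dw k y (e k)) = (2 * N y) *\<^sub>R P y" if y: "y \<in> G" for y
  proof -
    have "s y \<noteq> 0" using nz[OF subsetD[OF closure_subset y]] by (simp add: s_def)
    then have Ns: "N y * s y = 1" by (simp add: N_def)
    \<comment> \<open>The divergence of y/|y|^2 in three variables: 3 from the coordinates, -2 from
      the factor 1/|y|^2.\<close>
    have "(\<Sum>k\<in>UNIV. Dc k y (e k)) = 3 * N y - 2 * (N y * s y) * N y"
      by (simp add: Dc_def DN_def Ds_def e_def sum_3 inner_axis inner_axis' N_def[symmetric])
        (simp add: s_def inner_vec_def sum_3 algebra_simps)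
    then have sc: "(\<Sum>k\<in>UNIV. Dc k y (e k)) = N y" by (simp add: Ns)
    have lin: "linear (DP y)" using P y by (auto simp: has_C1_extension_def intro: has_derivative_linear)
    have ysum: "(0, snd y) = (\<Sum>k\<in>UNIV. (snd y $ k) *\<^sub>R e k)"
      by (simp add: e_def sum_3 prod_eq_iff vec_eq_iff forall_3 axis_def)
    have "(\<Sum>k\<in>UNIV. c k y *\<^sub>R DP y (e k)) = N y *\<^sub>R DP y (0, snd y)"
      unfolding ysum linear_sum[OF lin] linear_scale[OF lin]
      by (simp add: c_def scaleR_sum_right mult.commute)
    then have "(\<Sum>k\<in>UNIV. Dw k y (e k)) = N y *\<^sub>R DP y (0, snd y) + N y *\<^sub>R P y"
      unfolding Dw_def sum.distrib by (simp add: scaleR_sum_left[symmetric] sc)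
    \<comment> \<open>The Euler derivative of the product of \<phi>, q and \<psi>: the factor q is
      homogeneous of degree 1 and returns \<open>P y\<close>; on the outer factors the equations and
      q^2 = -|q|^2 trade the Euler derivative for the one in the real direction.\<close>
    moreover have "DP y (0, snd y) = P y - s y *\<^sub>R Dw0 y (1, 0)"
    proof -
      have qq: "q y *\<^sub>H q y = (- s y) *\<^sub>R qunit None" by (simp add: q_def s_def qvec_square)
      have "(\<phi> y *\<^sub>H q y) *\<^sub>H D\<psi> y (0, snd y) = \<phi> y *\<^sub>H ((q y *\<^sub>H q y) *\<^sub>H D\<psi> y (1, 0))"
        unfolding left[OF y, symmetric] q_def by (simp add: qmult_assoc)
      also have "\<dots> = - (s y *\<^sub>R (\<phi> y *\<^sub>H D\<psi> y (1, 0)))"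
        unfolding qq qmult.scaleR_left qmult.scaleR_right qunit_mult by simp
      finally have 1: "(\<phi> y *\<^sub>H q y) *\<^sub>H D\<psi> y (0, snd y) = - (s y *\<^sub>R (\<phi> y *\<^sub>H D\<psi> y (1, 0)))" .
      have "D\<phi> y (0, snd y) *\<^sub>H q y = D\<phi> y (1, 0) *\<^sub>H (q y *\<^sub>H q y)"
        unfolding right[OF y, symmetric] q_def by (simp add: qmult_assoc)
      also have "\<dots> = - (s y *\<^sub>R D\<phi> y (1, 0))"
        unfolding qq qmult.scaleR_right qunit_mult by simp
      finally have 2: "D\<phi> y (0, snd y) *\<^sub>H q y = - (s y *\<^sub>R D\<phi> y (1, 0))" .
      show ?thesis
        unfolding DP_def snd_conv 1 2 q_def[symmetric] P_def Dw0_def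
        by (simp add: qmult.add_left qmult.minus_left qmult.scaleR_left qmult.diff_left scaleR_add_right)
    qed
    \<comment> \<open>The real derivative now cancels \<open>Dw0 y (1, 0)\<close>. One copy of
      \<open>N y *\<^sub>R P y\<close> arises here, the other from the divergence of the
      coefficients \<open>c k\<close>.\<close>
    moreover have "N y *\<^sub>R (P y - s y *\<^sub>R Dw0 y (1, 0)) = N y *\<^sub>R P y - Dw0 y (1, 0)"
      by (simp add: scaleR_diff_right Ns)
    moreover have "(2 * N y) *\<^sub>R P y = N y *\<^sub>R P y + N y *\<^sub>R P y"
      by (simp only: mult_2 scaleR_add_left)
    ultimately show ?thesis by simp
  qed
  have NP: "N y *\<^sub>R P y = \<phi> y *\<^sub>H ((1 / (norm (snd y))\<^sup>2) *\<^sub>R qvec (snd y)) *\<^sub>H \<psi> y" for y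
    by (simp add: N_def s_def P_def q_def power2_norm_eq_inner qmult.scaleR_left qmult.scaleR_right inverse_eq_divide)
  \<comment> \<open>The divergence without the factor 2 of \<open>nu_density\<close>; that factor
    and the 2 in \<open>I_eq\<close> make up the constant 4.\<close>
  define I where "I y = indicator G y *\<^sub>R Dw0 y (1, 0) + (\<Sum>k\<in>UNIV. indicator G y *\<^sub>R Dw k y (e k))" for y
  have I_eq: "I y = 2 *\<^sub>R (indicator G y *\<^sub>R (N y *\<^sub>R P y))" for y
  proof (cases "y \<in> G")
    case True
    then have "I y = (2 * N y) *\<^sub>R P y" using div[OF True] by (simp add: I_def)
    then show ?thesis using True by simp
  qed (simp add: I_def)
  have Ii: "integrable lborel I"
    unfolding I_def using g0(1) gk(1)
    by (intro Bochner_Integration.integrable_add Bochner_Integration.integrable_sum) auto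
  have half: "indicator G y *\<^sub>R (N y *\<^sub>R P y) = (1/2) *\<^sub>R I y" for y by (simp add: I_eq)
  show "integrable lborel (\<lambda>y. indicator G y *\<^sub>R (\<phi> y *\<^sub>H ((1 / (norm (snd y))\<^sup>2) *\<^sub>R qvec (snd y)) *\<^sub>H \<psi> y))"
    unfolding NP[symmetric] half using Ii by simp
  have nu: "\<phi> y *\<^sub>H nu_density y n *\<^sub>H \<psi> y =
      2 *\<^sub>R ((n \<bullet> (1, 0)) *\<^sub>R w0 y + (\<Sum>k\<in>UNIV. (n \<bullet> e k) *\<^sub>R w k y))" for y n
  proof -
    have "(\<Sum>k\<in>UNIV. (n \<bullet> e k) *\<^sub>R w k y) = (\<Sum>k\<in>UNIV. snd y $ k * snd n $ k) *\<^sub>R (N y *\<^sub>R P y)"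
      by (simp add: w_def c_def e_def inner_prod_def inner_axis scaleR_sum_left sum_3 algebra_simps)
    moreover have "\<phi> y *\<^sub>H nu_density y n *\<^sub>H \<psi> y = (2 * fst n) *\<^sub>R w0 y +
        (2 / (norm (snd y))\<^sup>2 * (\<Sum>k\<in>UNIV. snd y $ k * snd n $ k)) *\<^sub>R P y"
      unfolding nu_density_def qmult.add_right qmult.add_left qmult.scaleR_right qmult.scaleR_left qunit_mult
        w0_def P_def q_def ..
    moreover have "2 / (norm (snd y))\<^sup>2 = 2 * N y"
      by (simp add: N_def s_def power2_norm_eq_inner inverse_eq_divide)
    ultimately show ?thesis by (simp add: inner_prod_def scaleR_add_right mult_ac)
  qed
  have "integral_nu G \<phi> \<psi> = 2 *\<^sub>R ((\<integral>y. (?n y \<bullet> (1, 0)) *\<^sub>R w0 y \<partial>?M) + (\<Sum>k\<in>UNIV. \<integral>y. (?n y \<bullet> e k) *\<^sub>R w k y \<partial>?M))"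
    unfolding integral_nu_def nu using g0(2) gk(2)
    by (simp add: Bochner_Integration.integral_add Bochner_Integration.integral_sum Bochner_Integration.integrable_sum)
  also have "\<dots> = 2 *\<^sub>R (\<integral>y. I y \<partial>lborel)"
    unfolding I_def g0(3)[symmetric] gk(3)[symmetric] using g0(1) gk(1)
    by (simp only: Bochner_Integration.integral_add Bochner_Integration.integral_sum
        Bochner_Integration.integrable_sum)
  also have "\<dots> = 4 *\<^sub>R (\<integral>y. indicator G y *\<^sub>R (N y *\<^sub>R P y) \<partial>lborel)"
    unfolding half by simp
  finally show "integral_nu G \<phi> \<psi> =
    4 *\<^sub>R (\<integral>y. indicator G y *\<^sub>R (\<phi> y *\<^sub>H ((1 / (norm (snd y))\<^sup>2) *\<^sub>R qvec (snd y)) *\<^sub>H \<psi> y) \<partial>lborel)"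
    unfolding NP .
qed

section \<open>The two equations in the coordinates of the image\<close>

lemma linear_eq_sum_axis:
  fixes L :: "real^3 \<Rightarrow> 'b::real_vector"
  assumes "linear L"
  shows "(\<Sum>i\<in>UNIV. (v $ i) *\<^sub>R L (axis i 1)) = L v"
proof -
  have "v = (\<Sum>i\<in>UNIV. (v $ i) *\<^sub>R axis i 1)"
    by (simp add: sum_3 vec_eq_iff forall_3 axis_def)
  then have "L v = L (\<Sum>i\<in>UNIV. (v $ i) *\<^sub>R axis i 1)" by (rule arg_cong)
  then show ?thesis by (simp add: linear_sum[OF assms] linear_scale[OF assms])
qed

text \<open>The sum over j differentiates the inverse at the point \<open>a u\<close> in the
  direction of that same vector: the coefficients are those of the Euler field, pulled back by
  \<open>a\<close>.\<close>

lemma u_coeff_eq: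
  assumes "(inv_into U a has_derivative Db) (at (a u))"
  shows "u_coeff U a i u = Db (a u) $ i"
proof -
  have lin: "linear (\<lambda>v. Db v $ i)"
    using bounded_linear_compose[OF bounded_linear_vec_nth has_derivative_bounded_linear[OF assms]]
    by (rule bounded_linear.linear)
  have "partial_derivative v (\<lambda>y. inv_into U a y $ i) (a u) = Db v $ i" for v
    by (rule partial_derivative_eq[OF bounded_linear.has_derivative[OF bounded_linear_vec_nth assms]])
  then show ?thesis using linear_eq_sum_axis[OF lin, of "a u"] by (simp add: u_coeff_def)
qed

text \<open>By the chain rule the right-hand side is the Euler derivative, at
  \<open>lift a x\<close>, of \<open>f\<close> composed with the inverse of
  \<open>lift a\<close>.\<close>

lemma sum_u_coeff:
  assumes b: "(inv_into U a has_derivative Db) (at (a (snd x)))" and f: "(f has_derivative Df) (at x)"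
  shows "(\<Sum>i\<in>UNIV. u_coeff U a i (snd x) *\<^sub>R partial_derivative (qunit (Some i)) f x) = Df (0, Db (a (snd x)))"
proof -
  have "linear (\<lambda>v. Df (0, v))"
    using bounded_linear_compose[OF has_derivative_bounded_linear[OF f]
        bounded_linear_Pair[OF bounded_linear_zero bounded_linear_ident]]
    by (rule bounded_linear.linear)
  from linear_eq_sum_axis[OF this] show ?thesis
    by (simp add: u_coeff_eq[OF b] partial_derivative_eq[OF f] qvec_def)
qed

text \<open>The chain rule, with continuity up to the boundary because closure points go to closure
  points and their vector parts stay in \<open>V\<close>, where the derivative of \<open>b\<close>
  is continuous. \<open>Df\<close> is handed back so that the equations can be expressed through
  it.\<close>

lemma has_C1_extension_compose_lift:
  assumes f: "C1_closure \<Omega> f"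
    and G: "lift b ` G \<subseteq> \<Omega>" "lift b ` closure G \<subseteq> closure \<Omega>" "\<And>y. y \<in> closure G \<Longrightarrow> snd y \<in> V"
    and b: "\<And>v. v \<in> V \<Longrightarrow> (b has_derivative blinfun_apply (Db v)) (at v)" and Db: "continuous_on V Db"
  obtains Df where "\<And>x. x \<in> \<Omega> \<Longrightarrow> (f has_derivative blinfun_apply (Df x)) (at x)"
    "has_C1_extension G (f \<circ> lift b) (\<lambda>y v. Df (lift b y) (fst v, Db (snd y) (snd v)))"
proof -
  have cf: "continuous_on (closure \<Omega>) f" using f by (simp add: C1_closure_def)
  obtain Df where *: "(\<forall>x\<in>\<Omega>. (f has_derivative blinfun_apply (Df x)) (at x)) \<and> continuous_on (closure \<Omega>) Df"
    using f[unfolded C1_closure_def, THEN conjunct2] by (rule exE) (rule that)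
  then have cDf: "continuous_on (closure \<Omega>) Df"
    and Df: "\<And>x. x \<in> \<Omega> \<Longrightarrow> (f has_derivative blinfun_apply (Df x)) (at x)" by simp_all
  have cb: "continuous_on V b"
    by (intro continuous_at_imp_continuous_on ballI has_derivative_continuous[OF b])
  have "continuous_on (closure G) (\<lambda>y. b (snd y))"
    by (rule continuous_on_compose2[OF cb continuous_on_snd[OF continuous_on_id]]) (use G(3) in blast)
  then have cl: "continuous_on (closure G) (lift b)"
    unfolding lift_def by (intro continuous_intros)
  have "has_C1_extension G (f \<circ> lift b) (\<lambda>y v. Df (lift b y) (fst v, Db (snd y) (snd v)))"
    unfolding has_C1_extension_def
  proof (intro conjI ballI allI)
    show "continuous_on (closure G) (f \<circ> lift b)"
      unfolding comp_def by (rule continuous_on_compose2[OF cf cl G(2)])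
    have "continuous_on (closure G) (\<lambda>y. Df (lift b y))" by (rule continuous_on_compose2[OF cDf cl G(2)])
    moreover have "continuous_on (closure G) (\<lambda>y. Db (snd y))"
      by (rule continuous_on_compose2[OF Db]) (use G(3) in \<open>auto intro!: continuous_intros\<close>)
    ultimately show "continuous_on (closure G) (\<lambda>y. Df (lift b y) (fst v, Db (snd y) (snd v)))" for v
      by (intro continuous_intros)
    fix y assume y: "y \<in> G"
    then have "lift b y \<in> \<Omega>" "snd y \<in> V" using G(1,3) closure_subset by blast+
    then show "(f \<circ> lift b has_derivative (\<lambda>v. Df (lift b y) (fst v, Db (snd y) (snd v)))) (at y)"
      unfolding comp_def by (intro has_derivative_compose[OF has_derivative_lift[OF b] Df])
  qed
  with Df show ?thesis by (rule that)
qed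

theorem corollary3p25:
  fixes U V :: "(real^3) set"
    and s t :: ereal
    and a :: "real^3 \<Rightarrow> real^3"
    and \<Omega> :: "quat set"
    and f g :: "quat \<Rightarrow> quat"
  assumes "open U" and "connected U" and "U \<noteq> {}"
    and "open V" and "connected V" and "V \<noteq> {}"
    and "s < t"
    and "C1_diffeomorphism U V a"
    and "open \<Omega>" and "connected \<Omega>" and "\<Omega> \<noteq> {}"
    and "\<Omega> \<subseteq> einterval s t \<times> U"
    and "closure (lift a ` \<Omega>) \<subseteq> einterval s t \<times> V"
    and "compact (frontier \<Omega>)" and "smooth_surface (frontier \<Omega>)"
    and "compact (frontier (lift a ` \<Omega>))" and "smooth_surface (frontier (lift a ` \<Omega>))"
    and "\<And>y. y \<in> closure (lift a ` \<Omega>) \<Longrightarrow> snd y \<noteq> 0"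
    and "C1_closure \<Omega> f" and "C1_closure \<Omega> g"
    and "\<And>x. x \<in> \<Omega> \<Longrightarrow> H_left U a f x = 0"
    and "\<And>x. x \<in> \<Omega> \<Longrightarrow> H_right U a g x = 0"
  shows "integral_J_nu U a \<Omega> g f =
    4 *\<^sub>R (\<integral>x\<in>\<Omega>. M_coeff a x *\<^sub>R
      (g x *\<^sub>H ((1 / (norm (a (snd x)))\<^sup>2) *\<^sub>R qvec (a (snd x))) *\<^sub>H f x) \<partial>lborel)"
proof -
  define b where "b = inv_into U a"
  define G where "G = lift a ` \<Omega>"
  have bij: "bij_betw a U V" and C1a: "C1_on U a" and C1b: "C1_on V b"
    using assms(8) by (auto simp: C1_diffeomorphism_def b_def)
  obtain Da :: "real^3 \<Rightarrow> ((real^3) \<Rightarrow>\<^sub>L (real^3))"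
    where Da: "\<And>u. u \<in> U \<Longrightarrow> (a has_derivative blinfun_apply (Da u)) (at u)" and cDa: "continuous_on U Da"
    using C1a unfolding C1_on_def by blast
  obtain Db :: "real^3 \<Rightarrow> ((real^3) \<Rightarrow>\<^sub>L (real^3))"
    where Db: "\<And>v. v \<in> V \<Longrightarrow> (b has_derivative blinfun_apply (Db v)) (at v)" and cDb: "continuous_on V Db"
    using C1b unfolding C1_on_def by blast
  have inj: "inj_on a U" using bij by (rule bij_betw_imp_inj_on)
  have ba: "b (a u) = u" if "u \<in> U" for u unfolding b_def using inj that by (rule inv_into_f_f)
  have ab: "a (b v) = v" if "v \<in> V" for v
    unfolding b_def using bij that by (rule bij_betw_inv_into_right)
  have aV: "a u \<in> V" if "u \<in> U" for u using bij that by (rule bij_betwE[THEN bspec])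
  have \<Omega>U: "fst x \<in> einterval s t" "snd x \<in> U" if "x \<in> \<Omega>" for x
    using assms(12) that by (auto simp: mem_Times_iff)
  have clG: "fst y \<in> einterval s t" "snd y \<in> V" if "y \<in> closure G" for y
    using assms(13) that by (auto simp: mem_Times_iff G_def)
  have lba: "lift b (lift a x) = x" if "x \<in> \<Omega>" for x
    using ba[OF \<Omega>U(2)[OF that]] by (simp add: lift_def)
  have lab: "lift a (lift b y) = y" if "snd y \<in> V" for y
    using ab[OF that] by (simp add: lift_def)
  have cb: "continuous_on V b"
    using has_derivative_continuous[OF Db] by (auto intro: continuous_at_imp_continuous_on)
  have ca: "continuous_on U a"
    using has_derivative_continuous[OF Da] by (auto intro: continuous_at_imp_continuous_on)
  have clb: "continuous_on (UNIV \<times> V) (lift b)"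
    unfolding lift_def by (intro continuous_intros continuous_on_compose2[OF cb]) auto
  \<comment> \<open>Writing the image as a preimage under the inverse gives its openness from the
    continuity of \<open>b\<close>.\<close>
  have G_eq: "G = (UNIV \<times> V) \<inter> lift b -` \<Omega>"
  proof (intro equalityI subsetI)
    fix y assume "y \<in> G"
    then obtain x where x: "x \<in> \<Omega>" "y = lift a x" by (auto simp: G_def)
    then show "y \<in> (UNIV \<times> V) \<inter> lift b -` \<Omega>"
      using lba[OF x(1)] aV[OF \<Omega>U(2)[OF x(1)]] by (simp add: mem_Times_iff) (simp add: lift_def)
  next
    fix y assume y: "y \<in> (UNIV \<times> V) \<inter> lift b -` \<Omega>"
    then have "y = lift a (lift b y)" by (intro lab[symmetric]) auto
    then show "y \<in> G" using y unfolding G_def by blast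
  qed
  have oG: "open G"
    unfolding G_eq by (intro continuous_open_preimage clb open_Times assms open_UNIV)
  have "continuous_on \<Omega> (lift a)"
    unfolding lift_def by (intro continuous_intros continuous_on_compose2[OF ca]) (use \<Omega>U in auto)
  then have coG: "connected G" unfolding G_def using assms(10) by (rule connected_continuous_image)
  have nz: "snd y \<noteq> 0" if "y \<in> closure G" for y using assms(18) that by (simp add: G_def)
  \<comment> \<open>The exclusion of the real axis acts twice: here for boundedness, and later for
    the division by |y|^2.\<close>
  have bG: "bounded G"
    by (rule bounded_if_real_axis_disjoint[OF assms(16)[folded G_def] nz[OF subsetD[OF closure_subset]]])
  have neG: "G \<noteq> {}" using assms(11) by (simp add: G_def)
  have sub1: "lift b ` G \<subseteq> \<Omega>" using G_eq by blast
  \<comment> \<open>The inverse is continuous on the closure of \<open>G\<close> because that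
    closure stays over \<open>V\<close>.\<close>
  have sub2: "lift b ` closure G \<subseteq> closure \<Omega>"
  proof (rule image_closure_subset)
    show "continuous_on (closure G) (lift b)"
      by (rule continuous_on_subset[OF clb]) (use clG in \<open>auto simp: mem_Times_iff\<close>)
    show "lift b ` G \<subseteq> closure \<Omega>" using sub1 closure_subset by blast
  qed simp
  obtain Df where Df: "\<And>x. x \<in> \<Omega> \<Longrightarrow> (f has_derivative blinfun_apply (Df x)) (at x)"
    and DF: "has_C1_extension G (f \<circ> lift b) (\<lambda>y v. Df (lift b y) (fst v, Db (snd y) (snd v)))"
    by (rule has_C1_extension_compose_lift[OF assms(19) sub1 sub2 clG(2) Db cDb]) (assumption | rule that)+
  obtain Dg where Dg: "\<And>x. x \<in> \<Omega> \<Longrightarrow> (g has_derivative blinfun_apply (Dg x)) (at x)"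
    and DG: "has_C1_extension G (g \<circ> lift b) (\<lambda>y v. Dg (lift b y) (fst v, Db (snd y) (snd v)))"
    by (rule has_C1_extension_compose_lift[OF assms(20) sub1 sub2 clG(2) Db cDb]) (assumption | rule that)+
  have pre: "lift b y \<in> \<Omega>" "a (snd (lift b y)) = snd y"
      "(inv_into U a has_derivative blinfun_apply (Db (snd y))) (at (a (snd (lift b y))))" if "y \<in> G" for y
  proof -
    have V: "snd y \<in> V" using that G_eq by auto
    show "lift b y \<in> \<Omega>" using that sub1 by blast
    show "a (snd (lift b y)) = snd y" using ab[OF V] by (simp add: lift_def)
    then show "(inv_into U a has_derivative blinfun_apply (Db (snd y))) (at (a (snd (lift b y))))"
      using Db[OF V] by (simp add: b_def)
  qed
  \<comment> \<open>At x = \<open>lift b y\<close> the factor \<open>a (snd x)\<close> is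
    \<open>snd y\<close>, and the sum over i becomes an Euler derivative: the form that
    \<open>integral_nu_eq\<close> expects.\<close>
  have left: "qvec (snd y) *\<^sub>H Df (lift b y) (1, 0) = Df (lift b y) (0, Db (snd y) (snd y))" if y: "y \<in> G" for y
    using assms(21)[OF pre(1)[OF y]] unfolding H_left_def sum_u_coeff[OF pre(3)[OF y] Df[OF pre(1)[OF y]]]
    by (simp add: partial_derivative_eq[OF Df[OF pre(1)[OF y]]] pre(2)[OF y])
  have right: "Dg (lift b y) (1, 0) *\<^sub>H qvec (snd y) = Dg (lift b y) (0, Db (snd y) (snd y))" if y: "y \<in> G" for y
    using assms(22)[OF pre(1)[OF y]] unfolding H_right_def sum_u_coeff[OF pre(3)[OF y] Dg[OF pre(1)[OF y]]]
    by (simp add: partial_derivative_eq[OF Dg[OF pre(1)[OF y]]] pre(2)[OF y])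
  define Z where "Z y = (g \<circ> lift b) y *\<^sub>H ((1 / (norm (snd y))\<^sup>2) *\<^sub>R qvec (snd y)) *\<^sub>H (f \<circ> lift b) y" for y
  have sm: "smooth_surface (frontier G)" using assms(17) by (simp add: G_def)
  have nu: "integrable lborel (\<lambda>y. indicator G y *\<^sub>R Z y)"
    "integral_nu G (g \<circ> lift b) (f \<circ> lift b) = 4 *\<^sub>R (\<integral>y. indicator G y *\<^sub>R Z y \<partial>lborel)"
    unfolding Z_def
    by (rule integral_nu_eq[OF oG coG bG neG sm DG DF nz]; simp add: left right)+
  \<comment> \<open>The integrability obtained with the boundary formula also supplies the
    measurability for the change of variables.\<close>
  have Zm: "(\<lambda>y. indicator (lift a ` \<Omega>) y *\<^sub>R Z y) \<in> borel_measurable borel"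
    using borel_measurable_integrable[OF nu(1)] by (simp add: G_def)
  have "integral_J_nu U a \<Omega> g f = 4 *\<^sub>R (\<integral>y. indicator G y *\<^sub>R Z y \<partial>lborel)"
    using nu(2) by (simp add: integral_J_nu_def G_def b_def)
  also have "(\<integral>y. indicator G y *\<^sub>R Z y \<partial>lborel) =
      (\<integral>x. indicator \<Omega> x *\<^sub>R M_coeff a x *\<^sub>R Z (lift a x) \<partial>lborel)"
    unfolding G_def
    by (rule integral_lift_image[OF assms(9) oG[unfolded G_def] assms(1) \<Omega>U(2) Da cDa inj Zm])
  also have "\<dots> = (\<integral>x. indicator \<Omega> x *\<^sub>R (M_coeff a x *\<^sub>R
      (g x *\<^sub>H ((1 / (norm (a (snd x)))\<^sup>2) *\<^sub>R qvec (a (snd x))) *\<^sub>H f x)) \<partial>lborel)"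
  proof (rule Bochner_Integration.integral_cong[OF refl])
    fix x
    show "indicator \<Omega> x *\<^sub>R M_coeff a x *\<^sub>R Z (lift a x) = indicator \<Omega> x *\<^sub>R (M_coeff a x *\<^sub>R
      (g x *\<^sub>H ((1 / (norm (a (snd x)))\<^sup>2) *\<^sub>R qvec (a (snd x))) *\<^sub>H f x))"
      using lba[of x] by (cases "x \<in> \<Omega>") (simp_all add: Z_def, simp add: lift_def)
  qed
  finally show ?thesis unfolding set_lebesgue_integral_def .
qed

end
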